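(* Let $q$ be a prime power. For every integer $n \geq 1$, \[ \frac{0.38}{q^{n+1}} \leq \|P_{GL} - \Lambda_{GL,z-1,n}\|_{TV} \leq \frac{14}{q^{n+1}}. \]
   Context: For a partition $\lambda$ (of any non-negative integer), $m_i(\lambda)$ is the number of parts equal to $i$ and $\lambda'_i = m_i(\lambda)+m_{i+1}(\lambda)+\cdots$. Set $|Aut(\lambda)| = q^{\sum_i (\lambda'_i)^2} \prod_i \prod_{k=1}^{m_i(\lambda)} (1-q^{-k})$. The Cohen–Lenstra measure $P_{GL}$ on the set of all partitions of all non-negative integers is $P_{GL}(\lambda) = \prod_{i \geq 1}(1-q^{-i}) \cdot \frac{1}{|Aut(\lambda)|}$. For $g \in GL(n,q)$, regard $\mathbb{F}_q^n$ as an $\mathbb{F}_q[z]$-module with $z$ acting as $g$; its $(z-1)$-primary component is isomorphic to $\bigoplus_i \mathbb{F}_q[z]/((z-1)^{\lambda_i})$ for a unique partition $\lambda_{z-1}(g)$ (the partition attached to $z-1$ in the rational canonical form of $g$). $\Lambda_{GL,z-1,n}$ is the distribution of $\lambda_{z-1}(g)$ when $g$ is uniformly random in $GL(n,q)$. The total variation distance is $\|P-Q\|_{TV} = \frac12\sum_x |P(x)-Q(x)|$. *)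

theory Defs
  imports
    "HOL-Analysis.Infinite_Sum"
    "HOL-Analysis.Infinite_Products"
    "HOL-Probability.Probability_Mass_Function"
    "HOL-Library.Multiset"
    "HOL-Algebra.QuotRing"
    "Jordan_Normal_Form.VS_Connect"
begin

section \<open>Partitions and the Cohen--Lenstra measure\<close>

text \<open>A partition is the multiset of its parts, all of which are positive; the multiplicity
  $m_i(\mu)$ is \<open>count \<mu> i\<close>, and \<open>{#}\<close> is the partition of $0$.\<close>

definition partitions :: "nat multiset set" where
  "partitions = {\<mu>. 0 \<notin># \<mu>}"

definition conj_part :: "nat multiset \<Rightarrow> nat \<Rightarrow> nat" where
  "conj_part \<mu> i = size {#j \<in># \<mu>. i \<le> j#}"

text \<open>The index ranges lose nothing: no part of \<open>\<mu>\<close> exceeds \<open>\<Sum>\<^sub># \<mu>\<close>, so \<open>conj_part \<mu> i = 0\<close> for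
  larger \<open>i\<close>, and the inner product is empty when \<open>i\<close> is not a part.\<close>

definition aut_card :: "nat \<Rightarrow> nat multiset \<Rightarrow> real" where
  "aut_card q \<mu> =
     real q ^ (\<Sum>i = 1..\<Sum>\<^sub># \<mu>. (conj_part \<mu> i)\<^sup>2) *
     (\<Prod>i\<in>set_mset \<mu>. \<Prod>k = 1..count \<mu> i. 1 - 1 / real q ^ k)"

definition P_GL :: "nat \<Rightarrow> nat multiset \<Rightarrow> real" where
  "P_GL q \<mu> = (\<Prod>i. 1 - 1 / real q ^ Suc i) * (1 / aut_card q \<mu>)"

definition tv_dist :: "'b set \<Rightarrow> ('b \<Rightarrow> real) \<Rightarrow> ('b \<Rightarrow> real) \<Rightarrow> real" where
  "tv_dist S P Q = 1 / 2 * (\<Sum>\<^sub>\<infinity>x\<in>S. \<bar>P x - Q x\<bar>)"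


section \<open>Modules\<close>

definition mod_isomorphic ::
  "('r, 'x) ring_scheme \<Rightarrow> ('r, 'a, 'y) module_scheme \<Rightarrow> ('r, 'b, 'z) module_scheme \<Rightarrow> bool" where
  "mod_isomorphic R M N \<longleftrightarrow>
     (\<exists>f \<in> LinearCombinations.module_hom R M N. bij_betw f (carrier M) (carrier N))"

definition primary_component ::
  "('r, 'x) ring_scheme \<Rightarrow> ('r, 'a) module \<Rightarrow> 'r \<Rightarrow> ('r, 'a) module" where
  "primary_component R M p =
     M\<lparr>carrier := {m \<in> carrier M. \<exists>k::nat. (p [^]\<^bsub>R\<^esub> k) \<odot>\<^bsub>M\<^esub> m = \<zero>\<^bsub>M\<^esub>}\<rparr>"

text \<open>The quotient ring \<open>R Quot I\<close> as an \<open>R\<close>-module.\<close>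

definition quot_module :: "('r, 'x) ring_scheme \<Rightarrow> 'r set \<Rightarrow> ('r, 'r set) module" where
  "quot_module R I =
     \<lparr>carrier = carrier (R Quot I), mult = mult (R Quot I), one = one (R Quot I),
      zero = zero (R Quot I), add = add (R Quot I),
      smult = (\<lambda>r X. (I +>\<^bsub>R\<^esub> r) \<otimes>\<^bsub>R Quot I\<^esub> X)\<rparr>"

text \<open>The direct sum of a finite family, realised as its product. The ring fields \<open>mult\<close> and
  \<open>one\<close> play no role in a module.\<close>

definition dsum_module :: "'i set \<Rightarrow> ('i \<Rightarrow> ('r, 'a) module) \<Rightarrow> ('r, 'i \<Rightarrow> 'a) module" where
  "dsum_module A M =
     \<lparr>carrier = (\<Pi>\<^sub>E i\<in>A. carrier (M i)), mult = undefined, one = undefined,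
      zero = (\<lambda>i\<in>A. \<zero>\<^bsub>M i\<^esub>), add = (\<lambda>x y. \<lambda>i\<in>A. x i \<oplus>\<^bsub>M i\<^esub> y i),
      smult = (\<lambda>r x. \<lambda>i\<in>A. r \<odot>\<^bsub>M i\<^esub> x i)\<rparr>"


section \<open>The partition attached to $z - 1$\<close>

text \<open>The action $p \cdot v = p(g)\,v$, evaluated by Horner's scheme:
  $(a + z p) \cdot v = a v + g (p \cdot v)$.\<close>

definition poly_act :: "'a::field mat \<Rightarrow> 'a poly \<Rightarrow> 'a vec \<Rightarrow> 'a vec" where
  "poly_act g p v = fold_coeffs (\<lambda>a w. a \<cdot>\<^sub>v v + g *\<^sub>v w) p (0\<^sub>v (dim_row g))"

definition mat_module :: "'a::field mat \<Rightarrow> ('a poly, 'a vec) module" where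
  "mat_module g =
     \<lparr>carrier = carrier_vec (dim_row g), mult = undefined, one = undefined,
      zero = 0\<^sub>v (dim_row g), add = (+), smult = poly_act g\<rparr>"

text \<open>The module $\bigoplus_i F[z]/(p^{\mu_i})$; the order in which the parts are listed is
  immaterial up to isomorphism.\<close>

definition primary_type :: "'a::field poly \<Rightarrow> nat multiset \<Rightarrow> ('a poly, nat \<Rightarrow> 'a poly set) module" where
  "primary_type p \<mu> =
     (let xs = sorted_list_of_multiset \<mu>
      in dsum_module {..<length xs} (\<lambda>i. quot_module class_ring (PIdl\<^bsub>class_ring\<^esub> (p ^ (xs ! i)))))"

definition lambda_z1 :: "'a::field mat \<Rightarrow> nat multiset" where
  "lambda_z1 g =
     (THE \<mu>. \<mu> \<in> partitions \<and>
        mod_isomorphic class_ring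
          (primary_component class_ring (mat_module g) [:-1, 1:]) (primary_type [:-1, 1:] \<mu>))"

definition GL :: "nat \<Rightarrow> 'a::field mat set" where
  "GL n = {g \<in> carrier_mat n n. invertible_mat g}"

definition Lambda_GL :: "'a::{field,finite} itself \<Rightarrow> nat \<Rightarrow> nat multiset pmf" where
  "Lambda_GL _ n = map_pmf lambda_z1 (pmf_of_set (GL n :: 'a mat set))"

end

(*
  Write T = g - 1. The partition of g is determined by card (ker T^i) = q^(sum_j min(lambda_j, i)),
  which makes sense for every square matrix T; call it the type of T. A rank m matrix T of size n
  factors as A B with A injective and B surjective, and T' = B A has size m; since
  ker T^(i+1) = B^(-1)(ker T'^i), the type of T' arises from that of T by lowering every part by one.
  Counting the pairs (A, B) in two ways gives a recursion, whose solution is that the fraction of T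
  (relative to GL(n,q)) of type lambda is 1/|Aut lambda|, and that of T with T + 1 invertible is
  d_(n - |lambda|) / |Aut lambda|, where d_k is the proportion of g in GL(k,q) without eigenvalue 1.

  Put x = 1/q. Summing over all types, the sum of 1/|Aut lambda| over |lambda| = k is
  s_k = x^k / ((1-x)...(1-x^k)), and s_0 d_n + ... + s_n d_0 = 1. Inverting generating functions,
  d_k is a partial sum of Euler's alternating series for P = prod_i (1 - x^i), so
  |d_k - P| is at most the next term. The total variation distance is half of
  sum_(k <= n) s_k |d_(n-k) - P| plus the P_GL-mass 1 - prod_(i>n) (1 - x^i) of the partitions of
  size > n, and this mass is also a lower bound for the sum.
*)

theory Submission
  imports Defs
    "Jordan_Normal_Form.Matrix_Kernel"
    "HOL-Computational_Algebra.Formal_Power_Series"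
begin

section \<open>Linear algebra over a finite field\<close>

text \<open>Partitions are compared by cardinalities of kernels: over a finite field
  \<open>card\<close> is a dimension in disguise, and counting matrices by type needs no orbits or
  centralizers. Normal forms enter only once, for \<open>lambda_z1\<close>: its \<open>THE\<close>
  has content only if the primary component is a direct sum of cyclic modules. The same
  decomposition shows that every square matrix has a type.

  The recursion is the same whether or not T + 1 has to be invertible, since A B and B A have the
  same nonzero eigenvalues. A Boolean flag lets it run once for both. Without the condition all
  matrices are counted, and q^(n^2) / card GL(n,q) yields the sums of 1/|Aut lambda|; with it the
  elements g = T + 1 of GL(n,q) are counted, and the sums weighted with d_k give 1.

  Numerically all rests on prod_i (1 - x^i) \<ge> 1/4 for x \<le> 1/2. It gives s_k \<le> 4 x^k and
  bounds the two parts of the doubled distance by 24 x^(n+1) and 2 x^(n+1), so the upper constant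
  obtained is 13. The lower one is 1: the first part is at least the second, which is at least
  x^(n+1).\<close>

definition mat_range :: "'a::field mat \<Rightarrow> 'a vec set" where
  "mat_range A = (*\<^sub>v) A ` carrier_vec (dim_col A)"

definition inj_mat :: "'a::field mat \<Rightarrow> bool" where
  "inj_mat A \<longleftrightarrow> mat_kernel A = {0\<^sub>v (dim_col A)}"

definition surj_mat :: "'a::field mat \<Rightarrow> bool" where
  "surj_mat A \<longleftrightarrow> mat_range A = carrier_vec (dim_row A)"

definition lin_subspace :: "nat \<Rightarrow> 'a::field vec set \<Rightarrow> bool" where
  "lin_subspace n W \<longleftrightarrow> W \<subseteq> carrier_vec n \<and> 0\<^sub>v n \<in> W \<and>
     (\<forall>v\<in>W. \<forall>w\<in>W. v + w \<in> W) \<and> (\<forall>c. \<forall>v\<in>W. c \<cdot>\<^sub>v v \<in> W)"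

text \<open>Encoded as a block matrix with empty lower blocks, so that the rules for
  \<open>four_block_mat\<close> apply.\<close>

definition hcat :: "'a::field mat \<Rightarrow> 'a mat \<Rightarrow> 'a mat" where
  "hcat A B = four_block_mat A B (0\<^sub>m 0 (dim_col A)) (0\<^sub>m 0 (dim_col B))"

lemma lin_subspace_carrier [simp]: "lin_subspace n (carrier_vec n)"
  by (simp add: lin_subspace_def)

lemma lin_subspaceD:
  assumes "lin_subspace n W"
  shows "W \<subseteq> carrier_vec n" "0\<^sub>v n \<in> W" "v \<in> W \<Longrightarrow> w \<in> W \<Longrightarrow> v + w \<in> W" "v \<in> W \<Longrightarrow> c \<cdot>\<^sub>v v \<in> W"
  using assms by (auto simp: lin_subspace_def)

lemma mat_rangeI: "A \<in> carrier_mat n m \<Longrightarrow> v \<in> carrier_vec m \<Longrightarrow> A *\<^sub>v v \<in> mat_range A"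
  by (auto simp: mat_range_def)

lemma mat_rangeE:
  assumes "x \<in> mat_range A" "A \<in> carrier_mat n m"
  obtains v where "v \<in> carrier_vec m" "x = A *\<^sub>v v"
  using assms by (auto simp: mat_range_def)

lemma inj_matI:
  assumes "A \<in> carrier_mat n m" "\<And>v. v \<in> carrier_vec m \<Longrightarrow> A *\<^sub>v v = 0\<^sub>v n \<Longrightarrow> v = 0\<^sub>v m"
  shows "inj_mat A"
  unfolding inj_mat_def mat_kernel_def using assms by auto

lemma inj_matD:
  assumes "inj_mat A" "A \<in> carrier_mat n m" "v \<in> carrier_vec m" "A *\<^sub>v v = 0\<^sub>v n"
  shows "v = 0\<^sub>v m"
  using assms unfolding inj_mat_def mat_kernel_def by auto

lemma inj_mat_inj:
  assumes "inj_mat A" and A: "A \<in> carrier_mat n m" and v: "v \<in> carrier_vec m" and w: "w \<in> carrier_vec m"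
    and eq: "A *\<^sub>v v = A *\<^sub>v w"
  shows "v = w"
proof -
  have "A *\<^sub>v w \<in> carrier_vec n" using A w by (rule mult_mat_vec_carrier)
  then have "A *\<^sub>v (v - w) = 0\<^sub>v n"
    by (simp add: mult_minus_distrib_mat_vec[OF A v w] eq)
  then have d: "v - w = 0\<^sub>v m" using v w by (intro inj_matD[OF assms(1) A]) simp_all
  have "(v - w) $ i = 0" if "i < m" for i using that d by simp
  then show ?thesis using v w by (intro eq_vecI) auto
qed

lemma lin_subspace_mat_kernel:
  fixes A :: "'a::field mat"
  assumes "A \<in> carrier_mat n m"
  shows "lin_subspace m (mat_kernel A)"
  unfolding lin_subspace_def mat_kernel[OF assms]
proof (intro conjI ballI allI)
  show "0\<^sub>v m \<in> {v \<in> carrier_vec m. A *\<^sub>v v = 0\<^sub>v n}" using assms by auto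
next
  fix v w assume "v \<in> {v \<in> carrier_vec m. A *\<^sub>v v = 0\<^sub>v n}" "w \<in> {v \<in> carrier_vec m. A *\<^sub>v v = 0\<^sub>v n}"
  then show "v + w \<in> {v \<in> carrier_vec m. A *\<^sub>v v = 0\<^sub>v n}"
    using mult_add_distrib_mat_vec[OF assms, of v w] by simp
next
  fix c v assume "v \<in> {v \<in> carrier_vec m. A *\<^sub>v v = 0\<^sub>v n}"
  then show "c \<cdot>\<^sub>v v \<in> {v \<in> carrier_vec m. A *\<^sub>v v = 0\<^sub>v n}"
  proof -
    have "c \<cdot>\<^sub>v 0\<^sub>v n = (0\<^sub>v n :: 'a vec)" by (intro eq_vecI) simp_all
    then show ?thesis using \<open>v \<in> _\<close> mult_mat_vec[OF assms, of v c] by simp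
  qed
qed blast

lemma lin_subspace_mat_range:
  fixes A :: "'a::field mat"
  assumes A: "A \<in> carrier_mat n m"
  shows "lin_subspace n (mat_range A)"
proof -
  have rI: "A *\<^sub>v v \<in> mat_range A" if "v \<in> carrier_vec m" for v
    using that A by (auto simp: mat_range_def)
  have rD: "\<exists>v\<in>carrier_vec m. w = A *\<^sub>v v" if "w \<in> mat_range A" for w
    using that A by (auto simp: mat_range_def)
  show ?thesis
    unfolding lin_subspace_def
  proof (intro conjI ballI allI)
    show "mat_range A \<subseteq> carrier_vec n" using A by (auto simp: mat_range_def)
    have "A *\<^sub>v 0\<^sub>v m = 0\<^sub>v n" using A by auto
    then show "0\<^sub>v n \<in> mat_range A" using rI[of "0\<^sub>v m"] by simp
  next
    fix x y assume "x \<in> mat_range A" "y \<in> mat_range A"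
    then obtain v w where "v \<in> carrier_vec m" "x = A *\<^sub>v v" "w \<in> carrier_vec m" "y = A *\<^sub>v w"
      using rD[of x] rD[of y] by blast
    then show "x + y \<in> mat_range A"
      using rI[of "v + w"] by (simp add: mult_add_distrib_mat_vec[OF A])
  next
    fix c x assume "x \<in> mat_range A"
    then obtain v where "v \<in> carrier_vec m" "x = A *\<^sub>v v" using rD[of x] by blast
    then show "c \<cdot>\<^sub>v x \<in> mat_range A" using rI[of "c \<cdot>\<^sub>v v"] by (simp add: mult_mat_vec[OF A])
  qed
qed

section \<open>Cardinalities of vector and matrix spaces, kernels and ranges\<close>

lemma carrier_vec_0: "carrier_vec 0 = {0\<^sub>v 0}"
  by auto

lemma bij_betw_carrier_vec_PiE:
  "bij_betw (\<lambda>f. vec n f) ({..<n} \<rightarrow>\<^sub>E UNIV) (carrier_vec n)"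
  by (rule bij_betw_byWitness[where f' = "\<lambda>v. \<lambda>i\<in>{..<n}. v $ i"])
    (auto intro!: ext simp: PiE_def extensional_def)

lemma card_carrier_vec: "card (carrier_vec n :: 'a::finite vec set) = CARD('a) ^ n"
  using bij_betw_same_card[OF bij_betw_carrier_vec_PiE[of n, where 'a='a]]
  by (simp add: card_PiE)

lemma finite_carrier_vec [simp]: "finite (carrier_vec n :: 'a::finite vec set)"
  using bij_betw_finite[OF bij_betw_carrier_vec_PiE[of n, where 'a='a]]
  by (simp add: finite_PiE)

text \<open>A matrix is the family of its columns. Each column gets its own set because the
  solutions of \<open>B * A = D\<close> restrict column j to a fibre that depends on j.\<close>

lemma bij_betw_carrier_mat_PiE:
  assumes "\<And>j. j < m \<Longrightarrow> S j \<subseteq> carrier_vec n"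
  shows "bij_betw (\<lambda>f. mat n m (\<lambda>(i,j). f j $ i)) (\<Pi>\<^sub>E j\<in>{..<m}. S j) {A \<in> carrier_mat n m. \<forall>j<m. col A j \<in> S j}"
proof (rule bij_betw_byWitness[where f' = "\<lambda>A. \<lambda>j\<in>{..<m}. col A j"])
  have c: "col (mat n m (\<lambda>(i, j). f j $ i)) j = f j" if f: "f \<in> (\<Pi>\<^sub>E j\<in>{..<m}. S j)" and j: "j < m" for f j
  proof -
    have "f j \<in> carrier_vec n" using PiE_mem[OF f, of j] j assms[OF j] by blast
    then show ?thesis using j by (intro eq_vecI) simp_all
  qed
  show "\<forall>f\<in>\<Pi>\<^sub>E j\<in>{..<m}. S j. (\<lambda>j\<in>{..<m}. col (mat n m (\<lambda>(i, j). f j $ i)) j) = f"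
  proof (intro ballI ext)
    fix f j assume f: "f \<in> (\<Pi>\<^sub>E j\<in>{..<m}. S j)"
    show "(\<lambda>j\<in>{..<m}. col (mat n m (\<lambda>(i, j). f j $ i)) j) j = f j"
      using c[OF f, of j] PiE_arb[OF f, of j] by (cases "j < m") simp_all
  qed
  show "(\<lambda>f. mat n m (\<lambda>(i,j). f j $ i)) ` (\<Pi>\<^sub>E j\<in>{..<m}. S j) \<subseteq> {A \<in> carrier_mat n m. \<forall>j<m. col A j \<in> S j}"
  proof (intro image_subsetI CollectI conjI allI impI)
    fix f j assume f: "f \<in> (\<Pi>\<^sub>E j\<in>{..<m}. S j)" and j: "j < m"
    show "col (mat n m (\<lambda>(i, j). f j $ i)) j \<in> S j"
      unfolding c[OF f j] using PiE_mem[OF f, of j] j by simp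
  qed (rule mat_carrier)
  show "\<forall>A\<in>{A \<in> carrier_mat n m. \<forall>j<m. col A j \<in> S j}. mat n m (\<lambda>(i, j). (\<lambda>j\<in>{..<m}. col A j) j $ i) = A"
  proof
    fix A assume "A \<in> {A \<in> carrier_mat n m. \<forall>j<m. col A j \<in> S j}"
    then have "A \<in> carrier_mat n m" by blast
    then show "mat n m (\<lambda>(i, j). (\<lambda>j\<in>{..<m}. col A j) j $ i) = A" by (intro eq_matI) simp_all
  qed
  show "(\<lambda>A. \<lambda>j\<in>{..<m}. col A j) ` {A \<in> carrier_mat n m. \<forall>j<m. col A j \<in> S j} \<subseteq> (\<Pi>\<^sub>E j\<in>{..<m}. S j)"
    by (intro image_subsetI restrict_PiE_iff[THEN iffD2]) simp
qed

lemma card_mats_with_cols: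
  assumes "\<And>j. j < m \<Longrightarrow> S j \<subseteq> carrier_vec n"
  shows "card {A \<in> carrier_mat n m. \<forall>j<m. col A j \<in> S j} = (\<Prod>j<m. card (S j))"
  using bij_betw_same_card[OF bij_betw_carrier_mat_PiE[OF assms]] by (simp add: card_PiE)

lemma finite_carrier_mat [simp]: "finite (carrier_mat n m :: 'a::finite mat set)"
proof -
  have "(carrier_mat n m :: 'a mat set) \<subseteq> mat n m ` (({..<n} \<times> {..<m}) \<rightarrow>\<^sub>E UNIV)"
  proof
    fix A :: "'a mat" assume "A \<in> carrier_mat n m"
    then have "A = mat n m (restrict (($$) A) ({..<n} \<times> {..<m}))" by (intro eq_matI) simp_all
    then show "A \<in> mat n m ` (({..<n} \<times> {..<m}) \<rightarrow>\<^sub>E UNIV)"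
      by (rule image_eqI[where x = "restrict (($$) A) ({..<n} \<times> {..<m})"]) (simp_all add: restrict_PiE_iff del: restrict_apply)
  qed
  moreover have "finite (({..<n} \<times> {..<m}) \<rightarrow>\<^sub>E (UNIV :: 'a set))" by (simp add: finite_PiE)
  ultimately show ?thesis by (meson finite_imageI finite_subset)
qed

lemma finite_vec_subset: "W \<subseteq> carrier_vec n \<Longrightarrow> finite (W :: 'a::finite vec set)"
  using finite_carrier_vec finite_subset by blast

lemma finite_mat_subset: "W \<subseteq> carrier_mat n m \<Longrightarrow> finite (W :: 'a::finite mat set)"
  using finite_carrier_mat finite_subset by blast

lemma mat_kernel_subset: "A \<in> carrier_mat n m \<Longrightarrow> mat_kernel A \<subseteq> carrier_vec m"
  by (auto simp: mat_kernel_def)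

lemma mat_range_subset: "A \<in> carrier_mat n m \<Longrightarrow> mat_range A \<subseteq> carrier_vec n"
  by (auto simp: mat_range_def)

text \<open>The fibre is the translate of the kernel by any preimage \<open>u\<close> of
  \<open>w\<close>.\<close>

lemma card_fibre:
  fixes A :: "'a::field mat"
  assumes A: "A \<in> carrier_mat n m" and w: "w \<in> mat_range A"
  shows "card {v \<in> carrier_vec m. A *\<^sub>v v = w} = card (mat_kernel A)"
proof -
  obtain u where u: "u \<in> carrier_vec m" "w = A *\<^sub>v u" using A w by (auto simp: mat_range_def)
  have "bij_betw (\<lambda>v. u + v) (mat_kernel A) {v \<in> carrier_vec m. A *\<^sub>v v = w}"
    unfolding mat_kernel[OF A]
  proof (rule bij_betw_byWitness[where f' = "\<lambda>v. v - u"])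
    show "\<forall>v\<in>{v \<in> carrier_vec m. A *\<^sub>v v = 0\<^sub>v n}. u + v - u = v"
      using u(1) by (auto intro!: eq_vecI)
    show "\<forall>v\<in>{v \<in> carrier_vec m. A *\<^sub>v v = w}. u + (v - u) = v"
      using u(1) by (auto intro!: eq_vecI)
    have "w \<in> carrier_vec n" unfolding u(2) using A u(1) by (rule mult_mat_vec_carrier)
    then show "(+) u ` {v \<in> carrier_vec m. A *\<^sub>v v = 0\<^sub>v n} \<subseteq> {v \<in> carrier_vec m. A *\<^sub>v v = w}"
      using u by (intro image_subsetI) (simp add: mult_add_distrib_mat_vec[OF A])
    show "(\<lambda>v. v - u) ` {v \<in> carrier_vec m. A *\<^sub>v v = w} \<subseteq> {v \<in> carrier_vec m. A *\<^sub>v v = 0\<^sub>v n}"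
      using u \<open>w \<in> carrier_vec n\<close> by (intro image_subsetI) (simp add: mult_minus_distrib_mat_vec[OF A])
  qed
  from bij_betw_same_card[OF this] show ?thesis by (rule sym)
qed

text \<open>The fibres over \<open>S\<close> are disjoint and equinumerous. With \<open>S\<close>
  the whole range this is rank-nullity in counting form; with \<open>S\<close> the kernel of a power
  it drives the recursion for types.\<close>

lemma card_preimage:
  fixes A :: "'a::{field,finite} mat"
  assumes A: "A \<in> carrier_mat n m" and S: "S \<subseteq> mat_range A"
  shows "card {v \<in> carrier_vec m. A *\<^sub>v v \<in> S} = card S * card (mat_kernel A)"
proof -
  have fS: "finite S" using S mat_range_subset[OF A] finite_vec_subset by (metis order_trans)
  have "{v \<in> carrier_vec m. A *\<^sub>v v \<in> S} = (\<Union>w\<in>S. {v \<in> carrier_vec m. A *\<^sub>v v = w})" by auto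
  also have "card \<dots> = (\<Sum>w\<in>S. card {v \<in> carrier_vec m. A *\<^sub>v v = w})"
    using fS by (intro card_UN_disjoint) auto
  also have "\<dots> = (\<Sum>w\<in>S. card (mat_kernel A))"
    using card_fibre[OF A] S by (intro sum.cong) auto
  finally show ?thesis by simp
qed

lemma card_range_kernel:
  fixes A :: "'a::{field,finite} mat"
  assumes A: "A \<in> carrier_mat n m"
  shows "card (mat_range A) * card (mat_kernel A) = CARD('a) ^ m"
proof -
  have "{v \<in> carrier_vec m. A *\<^sub>v v \<in> mat_range A} = carrier_vec m"
    using A by (auto simp: mat_range_def)
  then show ?thesis using card_preimage[OF A subset_refl] card_carrier_vec[where 'a='a] by simp
qed

lemma card_range_inj_mat:
  fixes A :: "'a::{field,finite} mat"
  assumes "A \<in> carrier_mat n m" "inj_mat A"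
  shows "card (mat_range A) = CARD('a) ^ m"
  using card_range_kernel[OF assms(1)] assms(2) by (simp add: inj_mat_def)

lemma inj_mat_of_card_range:
  fixes A :: "'a::{field,finite} mat"
  assumes "A \<in> carrier_mat n m" "card (mat_range A) = CARD('a) ^ m"
  shows "inj_mat A"
proof -
  have "card (mat_kernel A) = 1" using card_range_kernel[OF assms(1)] assms(2) by simp
  then obtain x where "mat_kernel A = {x}" by (auto simp: card_1_singleton_iff)
  then show ?thesis
    using lin_subspaceD(2)[OF lin_subspace_mat_kernel[OF assms(1)]] assms(1) by (auto simp: inj_mat_def)
qed

lemma inj_iff_surj_square:
  fixes A :: "'a::{field,finite} mat"
  assumes "A \<in> carrier_mat n n"
  shows "inj_mat A \<longleftrightarrow> surj_mat A"
proof
  assume "inj_mat A"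
  then have "card (mat_range A) = card (carrier_vec n :: 'a vec set)"
    using card_range_inj_mat[OF assms] card_carrier_vec[where 'a='a] by simp
  then have "mat_range A = carrier_vec n"
    by (intro card_subset_eq mat_range_subset[OF assms] finite_carrier_vec)
  then show "surj_mat A" using assms by (auto simp: surj_mat_def)
next
  assume "surj_mat A"
  then show "inj_mat A"
    using assms by (intro inj_mat_of_card_range[OF assms]) (auto simp: surj_mat_def card_carrier_vec)
qed

section \<open>Matrices placed side by side\<close>

lemma hcat_carrier [simp, intro]:
  "A \<in> carrier_mat n a \<Longrightarrow> B \<in> carrier_mat n b \<Longrightarrow> hcat A B \<in> carrier_mat n (a + b)"
  unfolding hcat_def using four_block_carrier_mat[of A n a "0\<^sub>m 0 (dim_col B)" 0 b] by auto

lemma hcat_mult_vec: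
  fixes A :: "'a::field mat"
  assumes "A \<in> carrier_mat n a" "B \<in> carrier_mat n b" "v \<in> carrier_vec a" "w \<in> carrier_vec b"
  shows "hcat A B *\<^sub>v (v @\<^sub>v w) = A *\<^sub>v v + B *\<^sub>v w"
proof -
  have "hcat A B *\<^sub>v (v @\<^sub>v w) = (A *\<^sub>v v + B *\<^sub>v w) @\<^sub>v (0\<^sub>m 0 a *\<^sub>v v + 0\<^sub>m 0 b *\<^sub>v w)"
    unfolding hcat_def using assms by (subst four_block_mat_mult_vec[of A n a B b _ 0]) auto
  also have "\<dots> = A *\<^sub>v v + B *\<^sub>v w" using assms by (auto intro!: eq_vecI)
  finally show ?thesis .
qed

lemma append_vec_cases:
  assumes "u \<in> carrier_vec (a + b)"
  obtains v w where "v \<in> carrier_vec a" "w \<in> carrier_vec b" "u = v @\<^sub>v w"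
  using vec_first_last_append[OF assms] vec_first_carrier vec_last_carrier by metis

lemma hcat_inj:
  assumes "A \<in> carrier_mat n a" "B \<in> carrier_mat n b" "A' \<in> carrier_mat n a" "B' \<in> carrier_mat n b"
  shows "hcat A B = hcat A' B' \<longleftrightarrow> A = A' \<and> B = B'"
proof
  assume eq: "hcat A B = hcat A' B'"
  have "A $$ (i,j) = A' $$ (i,j)" if "i < n" "j < a" for i j
    using arg_cong[OF eq, of "\<lambda>M. M $$ (i,j)"] that assms by (auto simp: hcat_def)
  moreover have "B $$ (i,j) = B' $$ (i,j)" if "i < n" "j < b" for i j
    using arg_cong[OF eq, of "\<lambda>M. M $$ (i,a+j)"] that assms by (auto simp: hcat_def)
  ultimately show "A = A' \<and> B = B'" using assms by (auto intro!: eq_matI)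
qed auto

lemma hcat_cases:
  fixes M :: "'a::field mat"
  assumes "M \<in> carrier_mat n (a + b)"
  obtains A B where "A \<in> carrier_mat n a" "B \<in> carrier_mat n b" "M = hcat A B"
proof
  let ?A = "mat n a (\<lambda>(i,j). M $$ (i,j))" and ?B = "mat n b (\<lambda>(i,j). M $$ (i,a+j))"
  show "?A \<in> carrier_mat n a" "?B \<in> carrier_mat n b" by auto
  show "M = hcat ?A ?B" using assms by (auto intro!: eq_matI simp: hcat_def)
qed

lemma mult_hcat:
  fixes A :: "'a::field mat"
  assumes "A \<in> carrier_mat n a" "B \<in> carrier_mat n b" "M \<in> carrier_mat k n"
  shows "M * hcat A B = hcat (M * A) (M * B)"
proof (rule eq_matI)
  fix i j assume "i < dim_row (hcat (M * A) (M * B))" "j < dim_col (hcat (M * A) (M * B))"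
  then have ij: "i < k" "j < a + b" using assms by (auto simp: hcat_def)
  have "col (hcat A B) j = (if j < a then col A j else col B (j - a))"
    using ij assms by (auto intro!: eq_vecI simp: hcat_def)
  then show "(M * hcat A B) $$ (i, j) = hcat (M * A) (M * B) $$ (i, j)"
    using ij assms by (auto simp: hcat_def)
qed (use assms in \<open>auto simp: hcat_def\<close>)

text \<open>The range of \<open>hcat A B\<close> is the sum of the two ranges, the least subspace
  that contains both. Testing against subspaces \<open>W\<close> spares a definition of sums of
  subspaces.\<close>

lemma mat_range_hcat_subset_iff:
  fixes A :: "'a::field mat"
  assumes A: "A \<in> carrier_mat n a" and B: "B \<in> carrier_mat n b" and W: "lin_subspace n W"
  shows "mat_range (hcat A B) \<subseteq> W \<longleftrightarrow> mat_range A \<subseteq> W \<and> mat_range B \<subseteq> W"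
proof
  assume l: "mat_range (hcat A B) \<subseteq> W"
  have "A *\<^sub>v v + B *\<^sub>v w \<in> W" if "v \<in> carrier_vec a" "w \<in> carrier_vec b" for v w
    using l that hcat_mult_vec[OF A B that] hcat_carrier[OF A B] 
    by (force simp: mat_range_def)
  note W' = this
  have z: "A *\<^sub>v 0\<^sub>v a = 0\<^sub>v n" "B *\<^sub>v 0\<^sub>v b = 0\<^sub>v n" using A B by auto
  have "A *\<^sub>v v \<in> W" if v: "v \<in> carrier_vec a" for v
    using W'[OF v, of "0\<^sub>v b"] z mult_mat_vec_carrier[OF A v] by simp
  moreover have "B *\<^sub>v w \<in> W" if w: "w \<in> carrier_vec b" for w
    using W'[OF _ w, of "0\<^sub>v a"] z mult_mat_vec_carrier[OF B w] by simp
  ultimately show "mat_range A \<subseteq> W \<and> mat_range B \<subseteq> W"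
    using A B by (auto simp: mat_range_def)
next
  assume r: "mat_range A \<subseteq> W \<and> mat_range B \<subseteq> W"
  show "mat_range (hcat A B) \<subseteq> W"
  proof
    fix x assume "x \<in> mat_range (hcat A B)"
    then obtain u where "u \<in> carrier_vec (a + b)" "x = hcat A B *\<^sub>v u"
      using hcat_carrier[OF A B] by (auto simp: mat_range_def)
    then obtain v w where "v \<in> carrier_vec a" "w \<in> carrier_vec b" "x = A *\<^sub>v v + B *\<^sub>v w"
      using append_vec_cases hcat_mult_vec[OF A B] by metis
    moreover from this have "A *\<^sub>v v \<in> W" "B *\<^sub>v w \<in> W" using r A B by (auto simp: mat_range_def)
    ultimately show "x \<in> W" using lin_subspaceD(3)[OF W] by simp
  qed
qed

lemma inj_mat_hcat_left:
  fixes A :: "'a::field mat"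
  assumes A: "A \<in> carrier_mat n a" and B: "B \<in> carrier_mat n b" and inj: "inj_mat (hcat A B)"
  shows "inj_mat A"
proof (rule inj_matI[OF A])
  fix v assume v: "v \<in> carrier_vec a" "A *\<^sub>v v = 0\<^sub>v n"
  then have "hcat A B *\<^sub>v (v @\<^sub>v 0\<^sub>v b) = 0\<^sub>v n"
    using hcat_mult_vec[OF A B, of v "0\<^sub>v b"] A B by auto
  then have "v @\<^sub>v 0\<^sub>v b = 0\<^sub>v (a + b)"
    using inj_matD[OF inj hcat_carrier[OF A B]] v by auto
  also have "0\<^sub>v (a + b) = 0\<^sub>v a @\<^sub>v (0\<^sub>v b :: 'a vec)" by (auto intro!: eq_vecI)
  finally show "v = 0\<^sub>v a" using v append_vec_eq[of v a "0\<^sub>v a"] by auto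
qed

lemma zero_append_vec: "0\<^sub>v a @\<^sub>v 0\<^sub>v b = 0\<^sub>v (a + b)"
  by (auto intro!: eq_vecI)

text \<open>Makes appending one more column an instance of \<open>hcat\<close>.\<close>

definition colmat :: "'a vec \<Rightarrow> 'a mat" where
  "colmat w = mat (dim_vec w) 1 (\<lambda>(i,_). w $ i)"

lemma colmat_carrier [simp, intro]: "w \<in> carrier_vec n \<Longrightarrow> colmat w \<in> carrier_mat n 1"
  by (auto simp: colmat_def)

lemma hcat_colmat_carrier [simp, intro]:
  "A \<in> carrier_mat n m \<Longrightarrow> w \<in> carrier_vec n \<Longrightarrow> hcat A (colmat w) \<in> carrier_mat n (Suc m)"
  using hcat_carrier[of A n m "colmat w" 1] colmat_carrier[of w n] by simp

lemma colmat_mult_vec: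
  fixes w :: "'a::field vec"
  assumes "c \<in> carrier_vec 1"
  shows "colmat w *\<^sub>v c = (c $ 0) \<cdot>\<^sub>v w"
  using assms by (auto intro!: eq_vecI simp: colmat_def scalar_prod_def)

lemma mat_range_colmat:
  fixes w :: "'a::field vec"
  assumes w: "w \<in> carrier_vec n" and W: "lin_subspace n W"
  shows "mat_range (colmat w) \<subseteq> W \<longleftrightarrow> w \<in> W"
proof
  assume l: "mat_range (colmat w) \<subseteq> W"
  have "colmat w *\<^sub>v vec 1 (\<lambda>_. 1) \<in> mat_range (colmat w)"
    using colmat_carrier[OF w] unfolding mat_range_def by auto
  then have "colmat w *\<^sub>v vec 1 (\<lambda>_. 1) \<in> W" using l by blast
  then show "w \<in> W" by (simp add: colmat_mult_vec)
next
  assume "w \<in> W"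
  then show "mat_range (colmat w) \<subseteq> W"
    using colmat_carrier[OF w] W by (auto simp: mat_range_def colmat_mult_vec lin_subspace_def)
qed

text \<open>A linear dependency among the columns of the enlarged matrix either has last coefficient
  0, hence is one among the columns of \<open>A\<close>, or can be solved for
  \<open>w\<close>.\<close>

lemma inj_mat_add_col_iff:
  fixes A :: "'a::field mat"
  assumes A: "A \<in> carrier_mat n m" and w: "w \<in> carrier_vec n"
  shows "inj_mat (hcat A (colmat w)) \<longleftrightarrow> inj_mat A \<and> w \<notin> mat_range A"
proof safe
  note cw = colmat_carrier[OF w]
  note H = hcat_carrier[OF A cw]
  assume inj: "inj_mat (hcat A (colmat w))"
  show "inj_mat A" by (rule inj_mat_hcat_left[OF A cw inj])
  assume "w \<in> mat_range A"
  then obtain v where v: "v \<in> carrier_vec m" "w = A *\<^sub>v v" using A by (auto simp: mat_range_def)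
  \<comment> \<open>If w is A v, then v followed by the coefficient -1 is a nontrivial
    dependency.\<close>
  let ?e = "vec 1 (\<lambda>_. -1 :: 'a)"
  have e: "?e \<in> carrier_vec 1" by (rule vec_carrier)
  have "hcat A (colmat w) *\<^sub>v (v @\<^sub>v ?e) = w + (-1) \<cdot>\<^sub>v w"
    using hcat_mult_vec[OF A cw v(1) e] colmat_mult_vec[OF e, of w] v(2) by simp
  also have "\<dots> = 0\<^sub>v n" using w by (intro eq_vecI) simp_all
  finally have "v @\<^sub>v ?e = 0\<^sub>v (m + 1)"
    using inj_matD[OF inj H append_carrier_vec[OF v(1) e]] by blast
  then have "(v @\<^sub>v ?e) $ m = 0\<^sub>v (m + 1) $ m" by metis
  then show False using v(1) by simp
next
  note cw = colmat_carrier[OF w]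
  assume inj: "inj_mat A" and nr: "w \<notin> mat_range A"
  show "inj_mat (hcat A (colmat w))"
  proof (rule inj_matI[OF hcat_carrier[OF A cw]])
    fix u assume u: "u \<in> carrier_vec (m + 1)" "hcat A (colmat w) *\<^sub>v u = 0\<^sub>v n"
    then obtain v c where vc: "v \<in> carrier_vec m" "c \<in> carrier_vec 1" "u = v @\<^sub>v c"
      using append_vec_cases by metis
    then have eq: "A *\<^sub>v v + (c $ 0) \<cdot>\<^sub>v w = 0\<^sub>v n"
      using u hcat_mult_vec[OF A cw, of v c] by (simp add: colmat_mult_vec)
    have c0: "c $ 0 = 0"
    proof (rule ccontr)
      assume c: "c $ 0 \<noteq> 0"
      have "w = A *\<^sub>v ((- inverse (c $ 0)) \<cdot>\<^sub>v v)"
      proof (rule eq_vecI)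
        fix i assume "i < dim_vec (A *\<^sub>v ((- inverse (c $ 0)) \<cdot>\<^sub>v v))"
        then have i: "i < n" using A by auto
        then have "(A *\<^sub>v v) $ i + c $ 0 * w $ i = 0"
          using arg_cong[OF eq, of "\<lambda>x. x $ i"] A w by auto
        then show "w $ i = (A *\<^sub>v ((- inverse (c $ 0)) \<cdot>\<^sub>v v)) $ i"
          using c i A vc by (simp add: mult_mat_vec[of _ n m] field_simps add_eq_0_iff2)
      qed (use A w in auto)
      then have "w \<in> mat_range A" using A vc by (auto simp: mat_range_def)
      then show False using nr by simp
    qed
    then have c': "c = 0\<^sub>v 1" using vc by (auto intro!: eq_vecI)
    have "(c $ 0) \<cdot>\<^sub>v w = 0\<^sub>v n" using c0 w by (intro eq_vecI) simp_all
    then have "A *\<^sub>v v = 0\<^sub>v n" using eq mult_mat_vec_carrier[OF A vc(1)] by simp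
    then have "v = 0\<^sub>v m" using inj_matD[OF inj A] vc by auto
    then show "u = 0\<^sub>v (m + 1)" using vc c' zero_append_vec by metis
  qed
qed

lemma colmat_cases:
  assumes "B \<in> carrier_mat n 1"
  obtains w where "w \<in> carrier_vec n" "B = colmat w"
proof
  show "col B 0 \<in> carrier_vec n" using assms by auto
  show "B = colmat (col B 0)" using assms by (auto intro!: eq_matI simp: colmat_def)
qed

lemma colmat_inj: "colmat v = colmat w \<longleftrightarrow> v = w"
proof
  assume eq: "colmat v = colmat w"
  have "dim_vec v = dim_vec w" using arg_cong[OF eq, of dim_row] by (simp add: colmat_def)
  moreover have "v $ i = w $ i" if "i < dim_vec v" for i
    using arg_cong[OF eq, of "\<lambda>M. M $$ (i,0)"] that calculation by (simp add: colmat_def)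
  ultimately show "v = w" by auto
qed auto

lemma inj_mat_no_cols: "inj_mat (0\<^sub>m n 0 :: 'a::field mat)"
  by (rule inj_matI[OF zero_carrier_mat]) (simp only: carrier_vec_0 singleton_iff)

lemma mat_range_no_cols:
  assumes W: "lin_subspace n W"
  shows "mat_range (0\<^sub>m n 0 :: 'a::field mat) \<subseteq> W"
proof
  fix x assume "x \<in> mat_range (0\<^sub>m n 0 :: 'a mat)"
  then obtain v :: "'a vec" where "v \<in> carrier_vec 0" "x = 0\<^sub>m n 0 *\<^sub>v v"
    using zero_carrier_mat by (rule mat_rangeE)
  then have "x = 0\<^sub>v n" by (intro eq_vecI) (simp_all add: scalar_prod_def)
  then show "x \<in> W" using lin_subspaceD(2)[OF W] by simp
qed

text \<open>The columns are chosen one after another: the column with index i has to avoid the span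
  of its predecessors, which has \<open>CARD('a) ^ i\<close> elements. This span lies in
  \<open>W\<close>, so the truncated subtraction is exact as long as there are predecessors to
  extend; if \<open>m\<close> is too large, both sides are 0.\<close>

lemma card_inj_mats_into:
  fixes W :: "'a::{field,finite} vec set"
  assumes W: "lin_subspace n W"
  shows "card {A \<in> carrier_mat n m. inj_mat A \<and> mat_range A \<subseteq> W} = (\<Prod>i<m. card W - CARD('a) ^ i)"
proof (induction m)
  case 0
  have "{A \<in> carrier_mat n 0. inj_mat A \<and> mat_range A \<subseteq> W} = {0\<^sub>m n 0}"
    using inj_mat_no_cols mat_range_no_cols[OF W] by (auto intro!: eq_matI)
  then show ?case by simp
next
  case (Suc m)
  let ?S = "\<lambda>m. {A \<in> carrier_mat n m. inj_mat A \<and> mat_range A \<subseteq> W}"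
  have Wn: "W \<subseteq> carrier_vec n" using lin_subspaceD(1)[OF W] .
  have mem: "hcat A (colmat w) \<in> ?S (Suc m) \<longleftrightarrow> A \<in> ?S m \<and> w \<in> W - mat_range A"
    if "A \<in> carrier_mat n m" "w \<in> carrier_vec n" for A w
    using inj_mat_add_col_iff[OF that] mat_range_hcat_subset_iff[OF that(1) colmat_carrier[OF that(2)] W]
      mat_range_colmat[OF that(2) W] hcat_colmat_carrier[OF that] that by blast
  have "bij_betw (\<lambda>(A,w). hcat A (colmat w)) (SIGMA A:?S m. W - mat_range A) (?S (Suc m))"
    unfolding bij_betw_def
  proof (intro conjI inj_onI subset_antisym subsetI)
    fix x y assume x: "x \<in> (SIGMA A:?S m. W - mat_range A)" and y: "y \<in> (SIGMA A:?S m. W - mat_range A)"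
      and eq: "(case x of (A, w) \<Rightarrow> hcat A (colmat w)) = (case y of (A, w) \<Rightarrow> hcat A (colmat w))"
    obtain A w where xw: "x = (A, w)" "A \<in> carrier_mat n m" "w \<in> carrier_vec n" using x Wn by blast
    obtain A' w' where yw: "y = (A', w')" "A' \<in> carrier_mat n m" "w' \<in> carrier_vec n" using y Wn by blast
    show "x = y"
      using eq xw yw hcat_inj[OF xw(2) colmat_carrier[OF xw(3)] yw(2) colmat_carrier[OF yw(3)]]
      by (simp add: colmat_inj)
  next
    fix M assume "M \<in> (\<lambda>(A,w). hcat A (colmat w)) ` (SIGMA A:?S m. W - mat_range A)"
    then obtain A w where Aw: "M = hcat A (colmat w)" "A \<in> ?S m" "w \<in> W - mat_range A" by auto
    then have "A \<in> carrier_mat n m" "w \<in> carrier_vec n" using Wn by blast+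
    from mem[OF this] Aw show "M \<in> ?S (Suc m)" by simp
  next
    fix M assume M: "M \<in> ?S (Suc m)"
    then have "M \<in> carrier_mat n (m + 1)" by simp
    then obtain A B where AB: "A \<in> carrier_mat n m" "B \<in> carrier_mat n 1" "M = hcat A B"
      by (rule hcat_cases)
    from AB(2) obtain w where w: "w \<in> carrier_vec n" "B = colmat w" by (rule colmat_cases)
    have "hcat A (colmat w) \<in> ?S (Suc m)" using M unfolding AB(3) w(2) .
    then have "(A, w) \<in> (SIGMA A:?S m. W - mat_range A)" unfolding mem[OF AB(1) w(1)] by blast
    moreover have "M = (\<lambda>(A,w). hcat A (colmat w)) (A, w)" using AB w by simp
    ultimately show "M \<in> (\<lambda>(A,w). hcat A (colmat w)) ` (SIGMA A:?S m. W - mat_range A)" by (rule rev_image_eqI)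
  qed
  then have "card (?S (Suc m)) = card (SIGMA A:?S m. W - mat_range A)"
    by (rule bij_betw_same_card[symmetric])
  also have "\<dots> = (\<Sum>A\<in>?S m. card (W - mat_range A))"
    using finite_vec_subset[OF Wn] finite_mat_subset[of "?S m" n m] by (intro card_SigmaI) blast+
  also have "\<dots> = (\<Sum>A\<in>?S m. card W - CARD('a) ^ m)"
  proof (rule sum.cong[OF refl])
    fix A assume A: "A \<in> ?S m"
    have "card (W - mat_range A) = card W - card (mat_range A)"
      using A finite_subset[OF _ finite_vec_subset[OF Wn]] by (intro card_Diff_subset) blast+
    then show "card (W - mat_range A) = card W - CARD('a) ^ m"
      using A card_range_inj_mat[of A n m] by simp
  qed
  also have "\<dots> = (\<Prod>i<Suc m. card W - CARD('a) ^ i)" using Suc.IH by simp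
  finally show ?case .
qed

section \<open>Basis extension, linear systems and inverses\<close>

lemma hcat_assoc:
  assumes "A \<in> carrier_mat n a" "B \<in> carrier_mat n b" "C \<in> carrier_mat n c"
  shows "hcat (hcat A B) C = hcat A (hcat B C)"
  using assms by (auto intro!: eq_matI simp: hcat_def)

lemma hcat_empty: "A \<in> carrier_mat n a \<Longrightarrow> hcat A (0\<^sub>m n 0) = A"
  by (auto intro!: eq_matI simp: hcat_def)

lemma hcat_empty_left: "A \<in> carrier_mat n a \<Longrightarrow> hcat (0\<^sub>m n 0) A = A"
  by (auto intro!: eq_matI simp: hcat_def)

text \<open>Any element of \<open>W\<close> outside the current range can be appended as a column;
  the number of elements still missed then decreases, and it serves as induction measure.\<close>

lemma basis_extension:
  fixes W :: "'a::{field,finite} vec set"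
  assumes W: "lin_subspace n W" and "A \<in> carrier_mat n m" "inj_mat A" "mat_range A \<subseteq> W"
  shows "\<exists>l. \<exists>B\<in>carrier_mat n l. inj_mat (hcat A B) \<and> mat_range (hcat A B) = W"
  using assms(2-)
proof (induction "card (W - mat_range A)" arbitrary: A m rule: less_induct)
  case less
  show ?case
  proof (cases "mat_range A = W")
    case True
    then show ?thesis using less.prems hcat_empty by (metis zero_carrier_mat)
  next
    case False
    then obtain w where w: "w \<in> W" "w \<notin> mat_range A" using less.prems by auto
    then have wn: "w \<in> carrier_vec n" using lin_subspaceD(1)[OF W] by auto
    let ?A = "hcat A (colmat w)"
    have A': "?A \<in> carrier_mat n (Suc m)" using less.prems wn by blast
    have sub: "mat_range ?A \<subseteq> W"
      using mat_range_hcat_subset_iff[OF less.prems(1) colmat_carrier[OF wn] W]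
        mat_range_colmat[OF wn W] less.prems w by blast
    have "mat_range A \<subseteq> mat_range ?A" "w \<in> mat_range ?A"
      using mat_range_hcat_subset_iff[OF less.prems(1) colmat_carrier[OF wn] lin_subspace_mat_range[OF A']]
        mat_range_colmat[OF wn lin_subspace_mat_range[OF A']] by blast+
    then have "card (W - mat_range ?A) < card (W - mat_range A)"
      using w finite_vec_subset[OF lin_subspaceD(1)[OF W]] by (intro psubset_card_mono) blast+
    moreover have "inj_mat ?A" using inj_mat_add_col_iff less.prems wn w by blast
    ultimately obtain l B where B: "B \<in> carrier_mat n l" "inj_mat (hcat ?A B)" "mat_range (hcat ?A B) = W"
      using less.hyps[OF _ A' _ sub] by blast
    then have "hcat ?A B = hcat A (hcat (colmat w) B)"
      using hcat_assoc[OF less.prems(1) colmat_carrier[OF wn]] by blast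
    moreover have "hcat (colmat w) B \<in> carrier_mat n (1 + l)"
      using B wn by blast
    ultimately show ?thesis using B by metis
  qed
qed

lemma col_in_mat_range:
  fixes A :: "'a::field mat"
  assumes A: "A \<in> carrier_mat n k" and j: "j < k"
  shows "col A j \<in> mat_range A"
proof -
  have "A *\<^sub>v unit_vec k j = col A j"
    using A j by (intro eq_vecI) (simp_all add: scalar_prod_right_unit[of _ k])
  then show ?thesis using mat_rangeI[OF A unit_vec_carrier, of j] by simp
qed

lemma matrix_solve:
  fixes A :: "'a::field mat"
  assumes A: "A \<in> carrier_mat n m" and D: "D \<in> carrier_mat n k" and sub: "mat_range D \<subseteq> mat_range A"
  shows "\<exists>X\<in>carrier_mat m k. A * X = D"
proof -
  have "\<exists>x\<in>carrier_vec m. A *\<^sub>v x = col D j" if j: "j < k" for j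
    using rev_subsetD[OF col_in_mat_range[OF D j] sub] A by (auto simp: mat_range_def)
  then have ex: "\<exists>x. x \<in> carrier_vec m \<and> A *\<^sub>v x = col D j" if "j < k" for j using that by blast
  define x where "x j = (SOME x. x \<in> carrier_vec m \<and> A *\<^sub>v x = col D j)" for j
  have x: "x j \<in> carrier_vec m" "A *\<^sub>v x j = col D j" if "j < k" for j
    using someI_ex[OF ex[OF that]] unfolding x_def by blast+
  let ?X = "mat m k (\<lambda>(i,j). x j $ i)"
  have "A * ?X = D"
  proof (rule eq_matI)
    fix i j assume ij: "i < dim_row D" "j < dim_col D"
    have "col ?X j = x j" using x(1)[of j] ij D by (intro eq_vecI) auto
    then have "(A * ?X) $$ (i,j) = (A *\<^sub>v x j) $ i" using ij A D by simp
    then show "(A * ?X) $$ (i,j) = D $$ (i,j)" using x(2)[of j] ij D by simp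
  qed (use A D in auto)
  then show ?thesis by (intro bexI[of _ ?X]) simp_all
qed

lemma mat_range_mult_subset:
  fixes A :: "'a::field mat"
  assumes A: "A \<in> carrier_mat n m" and B: "B \<in> carrier_mat m k"
  shows "mat_range (A * B) \<subseteq> mat_range A"
proof
  fix x assume "x \<in> mat_range (A * B)"
  then obtain v where "v \<in> carrier_vec k" "x = (A * B) *\<^sub>v v"
    using B unfolding mat_range_def by auto
  then have v: "v \<in> carrier_vec k" "x = A *\<^sub>v (B *\<^sub>v v)"
    using assoc_mult_mat_vec[OF A B] by simp_all
  have "B *\<^sub>v v \<in> carrier_vec m" using B v(1) by (rule mult_mat_vec_carrier)
  then show "x \<in> mat_range A" unfolding v(2) by (rule mat_rangeI[OF A])
qed

lemma surj_mat_right_inverse: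
  fixes B :: "'a::field mat"
  assumes B: "B \<in> carrier_mat m n" and "surj_mat B"
  shows "\<exists>R\<in>carrier_mat n m. B * R = 1\<^sub>m m"
proof (rule matrix_solve[OF B one_carrier_mat])
  show "mat_range (1\<^sub>m m) \<subseteq> mat_range B"
    using assms mat_range_subset[OF one_carrier_mat[of m, where 'a='a]] by (simp add: surj_mat_def)
qed

lemma inj_square_inverse:
  fixes A :: "'a::{field,finite} mat"
  assumes A: "A \<in> carrier_mat n n" and "inj_mat A"
  shows "\<exists>B\<in>carrier_mat n n. A * B = 1\<^sub>m n \<and> B * A = 1\<^sub>m n"
proof -
  obtain B where B: "B \<in> carrier_mat n n" "A * B = 1\<^sub>m n"
    using surj_mat_right_inverse[OF A] inj_iff_surj_square[OF A] assms(2) by blast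
  then show ?thesis using mat_mult_left_right_inverse[OF A B(1,2)] by blast
qed

lemma inj_mat_left_inverseI:
  fixes A :: "'a::field mat"
  assumes A: "A \<in> carrier_mat n m" and L: "L \<in> carrier_mat m n" and LA: "L * A = 1\<^sub>m m"
  shows "inj_mat A"
proof (rule inj_matI[OF A])
  fix v assume v: "v \<in> carrier_vec m" "A *\<^sub>v v = 0\<^sub>v n"
  have "v = (L * A) *\<^sub>v v" using v LA by simp
  also have "\<dots> = L *\<^sub>v (A *\<^sub>v v)" using L A v by (rule_tac assoc_mult_mat_vec)
  also have "\<dots> = 0\<^sub>v m" using v L by auto
  finally show "v = 0\<^sub>v m" .
qed

lemma transpose_hcat_mult_vec:
  fixes A :: "'a::field mat"
  assumes A: "A \<in> carrier_mat n a" and B: "B \<in> carrier_mat n b" and v: "v \<in> carrier_vec n"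
  shows "transpose_mat (hcat A B) *\<^sub>v v = (transpose_mat A *\<^sub>v v) @\<^sub>v (transpose_mat B *\<^sub>v v)"
proof (rule eq_vecI)
  fix i assume "i < dim_vec ((transpose_mat A *\<^sub>v v) @\<^sub>v (transpose_mat B *\<^sub>v v))"
  then have i: "i < a + b" using A B by simp
  have "col (hcat A B) i = (if i < a then col A i else col B (i - a))"
    using i A B by (intro eq_vecI) (auto simp: hcat_def)
  then show "(transpose_mat (hcat A B) *\<^sub>v v) $ i = ((transpose_mat A *\<^sub>v v) @\<^sub>v (transpose_mat B *\<^sub>v v)) $ i"
    using i A B carrier_matD[OF hcat_carrier[OF A B]] by auto
qed (use A B in \<open>auto simp: hcat_def\<close>)

lemma card_field_gt_1: "CARD('a::{field,finite}) > 1"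
proof -
  have "card {0, 1 :: 'a} \<le> CARD('a)" by (rule card_mono) auto
  then show ?thesis by simp
qed

text \<open>Lets the count of injections serve for surjections. From right to left, the columns of
  the transpose are completed to an invertible matrix \<open>?P\<close>.\<close>

lemma surj_mat_iff_inj_transpose:
  fixes B :: "'a::{field,finite} mat"
  assumes B: "B \<in> carrier_mat m n"
  shows "surj_mat B \<longleftrightarrow> inj_mat (transpose_mat B)"
proof
  assume "surj_mat B"
  then obtain R where R: "R \<in> carrier_mat n m" "B * R = 1\<^sub>m m"
    using surj_mat_right_inverse[OF B] by blast
  then have "transpose_mat R * transpose_mat B = 1\<^sub>m m"
    using transpose_mult[OF B R(1)] by simp
  then show "inj_mat (transpose_mat B)"
    using B R(1) by (intro inj_mat_left_inverseI[of _ n m "transpose_mat R"]) auto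
next
  assume inj: "inj_mat (transpose_mat B)"
  let ?A = "transpose_mat B"
  have A: "?A \<in> carrier_mat n m" using B by simp
  obtain l X where X: "X \<in> carrier_mat n l" "inj_mat (hcat ?A X)" "mat_range (hcat ?A X) = carrier_vec n"
    using basis_extension[OF lin_subspace_carrier A inj mat_range_subset[OF A]] by blast
  let ?P = "hcat ?A X"
  have P: "?P \<in> carrier_mat n (m + l)" using A X by blast
  have "CARD('a) ^ (m + l) = CARD('a) ^ n"
    using card_range_inj_mat[OF P X(2)] X(3) card_carrier_vec[of n, where 'a='a] by simp
  then have ml: "m + l = n" using card_field_gt_1[where 'a='a] by (simp add: power_inject_exp)
  then have P': "?P \<in> carrier_mat n n" using P by simp
  obtain L where L: "L \<in> carrier_mat n n" "L * ?P = 1\<^sub>m n" using inj_square_inverse[OF P' X(2)] by blast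
  have tPL: "transpose_mat ?P * transpose_mat L = 1\<^sub>m n"
    using transpose_mult[OF L(1) P'] L(2) by simp
  show "surj_mat B"
    unfolding surj_mat_def
  proof
    show "mat_range B \<subseteq> carrier_vec (dim_row B)" using B mat_range_subset[OF B] by simp
    show "carrier_vec (dim_row B) \<subseteq> mat_range B"
    proof
      fix w :: "'a vec" assume "w \<in> carrier_vec (dim_row B)"
      then have w: "w \<in> carrier_vec m" using B by simp
      \<comment> \<open>The target \<open>w\<close> is padded with zeros for the columns of
        \<open>X\<close>; the first block of the equation for \<open>?v\<close> then reads B v =
        w.\<close>
      let ?w = "w @\<^sub>v 0\<^sub>v l" and ?v = "transpose_mat L *\<^sub>v (w @\<^sub>v 0\<^sub>v l)"
      have w': "?w \<in> carrier_vec n" using append_carrier_vec[OF w zero_carrier_vec[of l]] ml by simp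
      have v: "?v \<in> carrier_vec n" using L(1) w' by (intro mult_mat_vec_carrier[of _ n n]) simp_all
      have "transpose_mat ?P *\<^sub>v ?v = (transpose_mat ?P * transpose_mat L) *\<^sub>v ?w"
        using P' L(1) w' by (intro assoc_mult_mat_vec[symmetric, of _ n n _ n]) simp_all
      also have "\<dots> = ?w" using w' by (simp add: tPL)
      finally have "(transpose_mat ?A *\<^sub>v ?v) @\<^sub>v (transpose_mat X *\<^sub>v ?v) = w @\<^sub>v 0\<^sub>v l"
        using transpose_hcat_mult_vec[OF A X(1) v] by simp
      moreover have "transpose_mat ?A *\<^sub>v ?v \<in> carrier_vec m" using B v by simp
      ultimately have "transpose_mat ?A *\<^sub>v ?v = w" using append_vec_eq[OF _ w] by blast
      then have "B *\<^sub>v ?v = w" by simp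
      then show "w \<in> mat_range B" using mat_rangeI[OF B v] by simp
    qed
  qed
qed

section \<open>Counting injective, surjective and invertible matrices\<close>

lemma card_inj_mats:
  "card {A \<in> carrier_mat n m. inj_mat (A :: 'a::{field,finite} mat)} = (\<Prod>i<m. CARD('a) ^ n - CARD('a) ^ i)"
proof -
  have "{A \<in> carrier_mat n m. inj_mat (A :: 'a mat)} =
      {A \<in> carrier_mat n m. inj_mat A \<and> mat_range A \<subseteq> carrier_vec n}"
    using mat_range_subset by blast
  then show ?thesis
    using card_inj_mats_into[OF lin_subspace_carrier[of n, where 'a='a]] by (simp add: card_carrier_vec)
qed

lemma card_surj_mats:
  "card {B \<in> carrier_mat m n. surj_mat (B :: 'a::{field,finite} mat)} = (\<Prod>i<m. CARD('a) ^ n - CARD('a) ^ i)"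
proof -
  have "bij_betw transpose_mat {B \<in> carrier_mat m n. surj_mat (B :: 'a mat)} {A \<in> carrier_mat n m. inj_mat A}"
    by (rule bij_betw_byWitness[where f' = transpose_mat])
      (auto simp: surj_mat_iff_inj_transpose)
  from bij_betw_same_card[OF this] show ?thesis unfolding card_inj_mats .
qed

lemma GL_eq_inj_mats: "GL n = {A \<in> carrier_mat n n. inj_mat (A :: 'a::{field,finite} mat)}"
proof (intro subset_antisym subsetI)
  fix A :: "'a mat" assume "A \<in> GL n"
  then obtain B where A: "A \<in> carrier_mat n n" and B: "A * B = 1\<^sub>m n" "B * A = 1\<^sub>m (dim_row B)"
    by (auto simp: GL_def invertible_mat_def inverts_mat_def)
  have "dim_row B = n" using arg_cong[OF B(2), of dim_col] A by simp
  moreover have "dim_col B = n" using arg_cong[OF B(1), of dim_col] A by simp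
  ultimately have "B \<in> carrier_mat n n" "B * A = 1\<^sub>m n" using B(2) by auto
  then show "A \<in> {A \<in> carrier_mat n n. inj_mat A}"
    using inj_mat_left_inverseI[OF A] A by simp
next
  fix A :: "'a mat" assume "A \<in> {A \<in> carrier_mat n n. inj_mat A}"
  then have A: "A \<in> carrier_mat n n" "inj_mat A" by auto
  then obtain B where "B \<in> carrier_mat n n" "A * B = 1\<^sub>m n" "B * A = 1\<^sub>m n"
    using inj_square_inverse by blast
  then have "invertible_mat A" 
    using A unfolding invertible_mat_def inverts_mat_def by (intro conjI exI[of _ B]) auto
  then show "A \<in> GL n" using A by (simp add: GL_def)
qed

lemma card_GL: "card (GL n :: 'a::{field,finite} mat set) = (\<Prod>i<n. CARD('a) ^ n - CARD('a) ^ i)"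
  unfolding GL_eq_inj_mats by (rule card_inj_mats)

text \<open>In a factorization the columns of \<open>A\<close> form a basis of the range of
  \<open>T\<close>, and \<open>B\<close> is then forced, being the coordinates of \<open>T\<close>
  in that basis. Hence the number is that of the ordered bases of an m-dimensional space, which is
  the order of GL(m,q).\<close>

lemma card_rank_factorizations:
  fixes T :: "'a::{field,finite} mat"
  assumes T: "T \<in> carrier_mat n n" and ker: "card (mat_kernel T) = CARD('a) ^ r" and n: "n = m + r"
  shows "card {(A, B). A \<in> carrier_mat n m \<and> inj_mat A \<and> B \<in> carrier_mat m n \<and> surj_mat B \<and> A * B = T}
    = (\<Prod>i<m. CARD('a) ^ m - CARD('a) ^ i)"
proof -
  let ?P = "{(A, B). A \<in> carrier_mat n m \<and> inj_mat A \<and> B \<in> carrier_mat m n \<and> surj_mat B \<and> A * B = T}"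
  let ?S = "{A \<in> carrier_mat n m. inj_mat A \<and> mat_range A \<subseteq> mat_range T}"
  have "card (mat_range T) * CARD('a) ^ r = CARD('a) ^ m * CARD('a) ^ r"
    using card_range_kernel[OF T] ker n by (simp add: power_add)
  then have cT: "card (mat_range T) = CARD('a) ^ m" by simp
  have fT: "finite (mat_range T)" using finite_vec_subset[OF mat_range_subset[OF T]] .
  have mem: "A \<in> ?S \<longleftrightarrow> (\<exists>B. (A, B) \<in> ?P)" for A
  proof
    assume "A \<in> ?S"
    then have A: "A \<in> carrier_mat n m" "inj_mat A" "mat_range A \<subseteq> mat_range T" by auto
    have eq: "mat_range A = mat_range T"
      using card_range_inj_mat[OF A(1,2)] cT by (intro card_subset_eq[OF fT A(3)]) simp
    have "\<exists>B\<in>carrier_mat m n. A * B = T" by (rule matrix_solve[OF A(1) T]) (simp add: eq)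
    then obtain B where B: "B \<in> carrier_mat m n" "A * B = T" by blast
    \<comment> \<open>Each A w lies in the range of T = A B, and the injective \<open>A\<close> can
      be cancelled.\<close>
    have "surj_mat B"
      unfolding surj_mat_def
    proof (intro subset_antisym subsetI)
      fix w :: "'a vec" assume "w \<in> carrier_vec (dim_row B)"
      then have w: "w \<in> carrier_vec m" using B by simp
      have "A *\<^sub>v w \<in> mat_range T" using mat_rangeI[OF A(1) w] unfolding eq .
      then obtain v where v: "v \<in> carrier_vec n" "A *\<^sub>v w = T *\<^sub>v v" using T by (rule mat_rangeE)
      have Bv: "B *\<^sub>v v \<in> carrier_vec m" using B(1) v(1) by (rule mult_mat_vec_carrier)
      have "A *\<^sub>v w = A *\<^sub>v (B *\<^sub>v v)" using v(2) B(2) assoc_mult_mat_vec[OF A(1) B(1) v(1)] by simp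
      then have "w = B *\<^sub>v v" using inj_mat_inj[OF A(2,1) w Bv] by blast
      then show "w \<in> mat_range B" using mat_rangeI[OF B(1) v(1)] by simp
    qed (use B(1) mat_range_subset[OF B(1)] in auto)
    then have "(A, B) \<in> ?P" using A B by simp
    then show "\<exists>B. (A, B) \<in> ?P" by (rule exI)
  next
    assume "\<exists>B. (A, B) \<in> ?P"
    then obtain B where A: "A \<in> carrier_mat n m" "inj_mat A" and B: "B \<in> carrier_mat m n" "surj_mat B" "A * B = T"
      by blast
    show "A \<in> ?S"
    proof -
      have "mat_range T \<subseteq> mat_range A" using mat_range_mult_subset[OF A(1) B(1)] B(3) by simp
      moreover have "finite (mat_range A)" using finite_vec_subset[OF mat_range_subset[OF A(1)]] .
      ultimately have "mat_range T = mat_range A"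
        using card_range_inj_mat[OF A] cT by (intro card_subset_eq) simp_all
      then show ?thesis using A by simp
    qed
  qed
  have "bij_betw fst ?P ?S"
    unfolding bij_betw_def
  proof (intro conjI inj_onI subset_antisym subsetI)
    fix x y assume x: "x \<in> ?P" and y: "y \<in> ?P" and eq: "fst x = fst y"
    obtain A B where xy: "x = (A, B)" by (cases x)
    with eq obtain B' where yy: "y = (A, B')" by (cases y) simp
    have 1: "A \<in> carrier_mat n m" "inj_mat A" "B \<in> carrier_mat m n" "A * B = T"
      using x unfolding xy mem_Collect_eq prod.case by blast+
    have 2: "B' \<in> carrier_mat m n" "A * B' = T"
      using y unfolding yy mem_Collect_eq prod.case by blast+
    have "B = B'"
    proof (rule mat_col_eqI)
      fix j assume "j < dim_col B'"
      then have j: "j < n" using 2(1) by simp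
      have "col T j = A *\<^sub>v col B j" "col T j = A *\<^sub>v col B' j"
        using col_mult2[OF 1(1,3) j] col_mult2[OF 1(1) 2(1) j] unfolding 1(4) 2(2) .
      then have "A *\<^sub>v col B j = A *\<^sub>v col B' j" by (rule trans[OF sym])
      moreover have "col B j \<in> carrier_vec m" "col B' j \<in> carrier_vec m"
        using col_dim[of B j] col_dim[of B' j] unfolding carrier_matD(1)[OF 1(3)] carrier_matD(1)[OF 2(1)] .
      ultimately show "col B j = col B' j" using inj_mat_inj[OF 1(2,1)] by blast
    qed (use 1(3) 2(1) in simp_all)
    then show "x = y" using xy yy by simp
  next
    fix A assume "A \<in> fst ` ?P"
    then obtain p where p: "A = fst p" "p \<in> ?P" by (rule imageE)
    have "(A, snd p) \<in> ?P" unfolding p(1) prod.collapse by (rule p(2))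
    then have "\<exists>B. (A, B) \<in> ?P" by (rule exI)
    then show "A \<in> ?S" by (rule mem[THEN iffD2])
  next
    fix A assume "A \<in> ?S"
    then have "\<exists>B. (A, B) \<in> ?P" by (rule mem[THEN iffD1])
    then obtain B where B: "(A, B) \<in> ?P" by (rule exE)
    show "A \<in> fst ` ?P" by (rule image_eqI[OF _ B]) simp
  qed
  then have "card ?P = card ?S" by (rule bij_betw_same_card)
  also have "\<dots> = (\<Prod>i<m. card (mat_range T) - CARD('a) ^ i)"
    by (rule card_inj_mats_into[OF lin_subspace_mat_range[OF T]])
  finally show ?thesis unfolding cT .
qed

section \<open>Counting matrices of given type\<close>

lemma mult_eq_zero_iff_range_subset_kernel:
  fixes A :: "'a::field mat"
  assumes B: "B \<in> carrier_mat m n" and A: "A \<in> carrier_mat n k"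
  shows "B * A = 0\<^sub>m m k \<longleftrightarrow> mat_range A \<subseteq> mat_kernel B"
proof
  assume BA: "B * A = 0\<^sub>m m k"
  show "mat_range A \<subseteq> mat_kernel B"
  proof
    fix x assume "x \<in> mat_range A"
    then obtain v where v: "v \<in> carrier_vec k" "x = A *\<^sub>v v" using A by (rule mat_rangeE)
    have "B *\<^sub>v x = (B * A) *\<^sub>v v" using assoc_mult_mat_vec[OF B A v(1)] v(2) by simp
    also have "\<dots> = 0\<^sub>v m" unfolding BA using v(1) by (intro eq_vecI) simp_all
    finally show "x \<in> mat_kernel B"
      unfolding mat_kernel[OF B] using mult_mat_vec_carrier[OF A v(1)] v(2) by simp
  qed
next
  assume r: "mat_range A \<subseteq> mat_kernel B"
  show "B * A = 0\<^sub>m m k"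
  proof (rule mat_col_eqI)
    fix j assume "j < dim_col (0\<^sub>m m k)"
    then have j: "j < k" by simp
    have "col A j \<in> mat_kernel B" using col_in_mat_range[OF A j] r by (rule rev_subsetD)
    then have "B *\<^sub>v col A j = 0\<^sub>v m" unfolding mat_kernel[OF B] by simp
    then show "col (B * A) j = col (0\<^sub>m m k) j" using col_mult2[OF B A j] j by simp
  qed (use A B in simp_all)
qed

lemma inj_mat_mult:
  fixes A :: "'a::field mat"
  assumes A: "A \<in> carrier_mat n m" "inj_mat A" and B: "B \<in> carrier_mat m k" "inj_mat B"
  shows "inj_mat (A * B)"
proof (rule inj_matI)
  show "A * B \<in> carrier_mat n k" using A(1) B(1) by (rule mult_carrier_mat)
  fix v assume v: "v \<in> carrier_vec k" "(A * B) *\<^sub>v v = 0\<^sub>v n"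
  have Bv: "B *\<^sub>v v \<in> carrier_vec m" using B(1) v(1) by (rule mult_mat_vec_carrier)
  have "A *\<^sub>v (B *\<^sub>v v) = 0\<^sub>v n" using assoc_mult_mat_vec[OF A(1) B(1) v(1)] v(2) by simp
  from inj_matD[OF A(2,1) Bv this] show "v = 0\<^sub>v k" by (rule inj_matD[OF B(2,1) v(1)])
qed

lemma basis_exists:
  fixes W :: "'a::{field,finite} vec set"
  assumes W: "lin_subspace n W" and card: "card W = CARD('a) ^ s"
  shows "\<exists>B\<in>carrier_mat n s. inj_mat B \<and> mat_range B = W"
proof -
  have Z: "0\<^sub>m n 0 \<in> carrier_mat n 0" by (rule zero_carrier_mat)
  obtain l B where B: "B \<in> carrier_mat n l" "inj_mat (hcat (0\<^sub>m n 0) B)" "mat_range (hcat (0\<^sub>m n 0) B) = W"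
    using basis_extension[OF W Z inj_mat_no_cols mat_range_no_cols[OF W]] by blast
  have "CARD('a) ^ l = CARD('a) ^ s"
    using card_range_inj_mat[OF B(1)] B(2,3) card unfolding hcat_empty_left[OF B(1)] by simp
  then have "l = s" using card_field_gt_1[where 'a='a] by (simp add: power_inject_exp)
  then show ?thesis using B unfolding hcat_empty_left[OF B(1)] by blast
qed

lemma card_kernel_surj:
  fixes B :: "'a::{field,finite} mat"
  assumes B: "B \<in> carrier_mat m n" "surj_mat B" and n: "n = m + r"
  shows "card (mat_kernel B) = CARD('a) ^ r"
proof -
  have "card (mat_range B) = CARD('a) ^ m"
    using B carrier_matD(1)[OF B(1)] card_carrier_vec[of m, where 'a='a] by (simp add: surj_mat_def)
  then have "CARD('a) ^ m * card (mat_kernel B) = CARD('a) ^ m * CARD('a) ^ r"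
    using card_range_kernel[OF B(1)] n by (simp add: power_add)
  then show ?thesis by simp
qed

text \<open>The columns of \<open>A\<close> are independent unknowns; each ranges over a fibre of
  \<open>B\<close>, a coset of a kernel of dimension r.\<close>

lemma card_mult_eq:
  fixes B :: "'a::{field,finite} mat"
  assumes B: "B \<in> carrier_mat m n" "surj_mat B" and n: "n = m + r" and D: "D \<in> carrier_mat m k"
  shows "card {A \<in> carrier_mat n k. B * A = D} = CARD('a) ^ (r * k)"
proof -
  have "B * A = D \<longleftrightarrow> (\<forall>j<k. col A j \<in> {v \<in> carrier_vec n. B *\<^sub>v v = col D j})" if A: "A \<in> carrier_mat n k" for A
  proof -
    have BA: "B * A \<in> carrier_mat m k" using B(1) A by (rule mult_carrier_mat)
    have "B * A = D \<longleftrightarrow> (\<forall>j<k. col (B * A) j = col D j)"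
    proof
      assume r: "\<forall>j<k. col (B * A) j = col D j"
      show "B * A = D" by (rule mat_col_eqI) (use r D BA in auto)
    qed simp
    moreover have "col A j \<in> carrier_vec n" for j
      using col_dim[of A j] unfolding carrier_matD(1)[OF A] .
    ultimately show ?thesis using col_mult2[OF B(1) A] by simp
  qed
  then have "{A \<in> carrier_mat n k. B * A = D} =
      {A \<in> carrier_mat n k. \<forall>j<k. col A j \<in> {v \<in> carrier_vec n. B *\<^sub>v v = col D j}}"
    by (intro Collect_cong conj_cong refl)
  also have "card \<dots> = (\<Prod>j<k. card {v \<in> carrier_vec n. B *\<^sub>v v = col D j})"
    by (intro card_mats_with_cols) simp
  also have "\<dots> = (\<Prod>j<k. CARD('a) ^ r)"
  proof (intro prod.cong refl)
    fix j assume "j \<in> {..<k}"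
    have "col D j \<in> mat_range B"
      using col_dim[of D j] B(2) unfolding carrier_matD(1)[OF D] surj_mat_def carrier_matD(1)[OF B(1)] by simp
    then show "card {v \<in> carrier_vec n. B *\<^sub>v v = col D j} = CARD('a) ^ r"
      using card_fibre[OF B(1)] card_kernel_surj[OF B n] by simp
  qed
  also have "\<dots> = CARD('a) ^ (r * k)" by (simp add: power_mult)
  finally show ?thesis .
qed

text \<open>In a basis of the domain adapted to the kernel of \<open>C\<close>, the columns of \<open>A\<close> belonging to the
  complement are arbitrary lifts, and those belonging to the kernel are independent vectors of the
  kernel of \<open>B\<close>.\<close>

lemma card_inj_lifts:
  fixes B :: "'a::{field,finite} mat"
  assumes B: "B \<in> carrier_mat m n" "surj_mat B" and n: "n = m + r"
    and C: "C \<in> carrier_mat m m" "card (mat_kernel C) = CARD('a) ^ s"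
  shows "card {A \<in> carrier_mat n m. inj_mat A \<and> B * A = C} =
    CARD('a) ^ (r * (m - s)) * (\<Prod>i<s. CARD('a) ^ r - CARD('a) ^ i)"
proof -
  obtain Q2 where Q2: "Q2 \<in> carrier_mat m s" "inj_mat Q2" "mat_range Q2 = mat_kernel C"
    using basis_exists[OF lin_subspace_mat_kernel[OF C(1)] C(2)] by blast
  obtain k Q1 where Q1: "Q1 \<in> carrier_mat m k" and Qi: "inj_mat (hcat Q2 Q1)"
    and Qr: "mat_range (hcat Q2 Q1) = carrier_vec m"
    using basis_extension[OF lin_subspace_carrier Q2(1,2) mat_range_subset[OF Q2(1)]] by blast
  define Q where "Q = hcat Q2 Q1"
  have Qc: "Q \<in> carrier_mat m (s + k)" unfolding Q_def using Q2(1) Q1 by (rule hcat_carrier)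
  have "CARD('a) ^ (s + k) = CARD('a) ^ m"
    using card_range_inj_mat[OF Qc] Qi Qr card_carrier_vec[of m, where 'a='a] unfolding Q_def by simp
  then have sk: "s + k = m" using card_field_gt_1[where 'a='a] by (simp add: power_inject_exp)
  have Qm: "Q \<in> carrier_mat m m" using Qc unfolding sk .
  obtain P where P: "P \<in> carrier_mat m m" "Q * P = 1\<^sub>m m" "P * Q = 1\<^sub>m m"
    using inj_square_inverse[OF Qm] Qi unfolding Q_def by blast
  define D where "D = C * Q1"
  have D: "D \<in> carrier_mat m k" unfolding D_def using C(1) Q1 by (rule mult_carrier_mat)
  have CQ2: "C * Q2 = 0\<^sub>m m s"
    using mult_eq_zero_iff_range_subset_kernel[OF C(1) Q2(1)] Q2(3) by blast
  have CQ: "C * Q = hcat (0\<^sub>m m s) D"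
    unfolding Q_def D_def mult_hcat[OF Q2(1) Q1 C(1)] CQ2 by (rule refl)
  \<comment> \<open>The columns of \<open>Q1\<close> span a complement of the kernel of
    \<open>C\<close>, so \<open>C\<close> is injective there.\<close>
  have injD: "inj_mat D"
  proof (rule inj_matI[OF D])
    fix w assume w: "w \<in> carrier_vec k" "D *\<^sub>v w = 0\<^sub>v m"
    have Q1w: "Q1 *\<^sub>v w \<in> carrier_vec m" using Q1 w(1) by (rule mult_mat_vec_carrier)
    have "C *\<^sub>v (Q1 *\<^sub>v w) = 0\<^sub>v m"
      using w(2) assoc_mult_mat_vec[OF C(1) Q1 w(1)] unfolding D_def by simp
    then have "Q1 *\<^sub>v w \<in> mat_range Q2"
      unfolding Q2(3) mat_kernel[OF C(1)] using Q1w by simp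
    then obtain v where v: "v \<in> carrier_vec s" "Q1 *\<^sub>v w = Q2 *\<^sub>v v" using Q2(1) by (rule mat_rangeE)
    have mv: "- v \<in> carrier_vec s" using v(1) by simp
    have Q2v: "Q2 *\<^sub>v v \<in> carrier_vec m" using Q2(1) v(1) by (rule mult_mat_vec_carrier)
    have "Q2 *\<^sub>v (- v) = - (Q2 *\<^sub>v v)"
      using mult_minus_distrib_mat_vec[OF Q2(1) zero_carrier_vec v(1)] v(1) Q2v Q2(1)
        mult_mat_vec[OF Q2(1) v(1), of "-1"]
      by (simp add: uminus_vec_def smult_vec_def)
    then have "hcat Q2 Q1 *\<^sub>v (- v @\<^sub>v w) = - (Q2 *\<^sub>v v) + Q2 *\<^sub>v v"
      unfolding hcat_mult_vec[OF Q2(1) Q1 mv w(1)] v(2) by simp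
    also have "\<dots> = 0\<^sub>v m" using Q2v by simp
    finally have "- v @\<^sub>v w = 0\<^sub>v (s + k)"
      using inj_matD[OF Qi hcat_carrier[OF Q2(1) Q1] append_carrier_vec[OF mv w(1)]] by blast
    then have "- v @\<^sub>v w = 0\<^sub>v s @\<^sub>v 0\<^sub>v k" unfolding zero_append_vec .
    then show "w = 0\<^sub>v k" using append_vec_eq[OF mv zero_carrier_vec] by blast
  qed
  define S where "S = {A \<in> carrier_mat n m. inj_mat A \<and> B * A = C}"
  define S2 where "S2 = {A \<in> carrier_mat n s. inj_mat A \<and> mat_range A \<subseteq> mat_kernel B}"
  define S1 where "S1 = {A \<in> carrier_mat n k. B * A = D}"
  have injP: "inj_mat P" by (rule inj_mat_left_inverseI[OF P(1) Qm P(2)])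
  have injQ: "inj_mat Q" using Qi unfolding Q_def .
  have A2: "A \<in> carrier_mat n s" "inj_mat A" "B * A = 0\<^sub>m m s" if "A \<in> S2" for A
    using that mult_eq_zero_iff_range_subset_kernel[OF B(1), of A s] unfolding S2_def by blast+
  have A1: "A \<in> carrier_mat n k" "B * A = D" if "A \<in> S1" for A
    using that unfolding S1_def by blast+
  have hc: "hcat X Y \<in> carrier_mat n m" if "X \<in> S2" "Y \<in> S1" for X Y
    using hcat_carrier[OF A2(1)[OF that(1)] A1(1)[OF that(2)]] unfolding sk .
  \<comment> \<open>With \<open>A * Q = hcat X Y\<close> the equation B A = C splits into B X = 0
    and B Y = D, and \<open>P\<close> undoes the change of basis.\<close>
  have "bij_betw (\<lambda>(X,Y). hcat X Y * P) (S2 \<times> S1) S"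
    unfolding bij_betw_def
  proof (intro conjI inj_onI subset_antisym subsetI)
    fix x y assume x: "x \<in> S2 \<times> S1" and y: "y \<in> S2 \<times> S1"
      and eq: "(case x of (X, Y) \<Rightarrow> hcat X Y * P) = (case y of (X, Y) \<Rightarrow> hcat X Y * P)"
    obtain X Y where xe: "x = (X, Y)" "X \<in> S2" "Y \<in> S1" using x by (rule SigmaE)
    obtain X' Y' where ye: "y = (X', Y')" "X' \<in> S2" "Y' \<in> S1" using y by (rule SigmaE)
    have cancel: "hcat X Y * P * Q = hcat X Y" if "X \<in> S2" "Y \<in> S1" for X Y
      using assoc_mult_mat[OF hc[OF that] P(1) Qm] right_mult_one_mat[OF hc[OF that]] unfolding P(3) by (rule trans)
    have "hcat X Y * P = hcat X' Y' * P" using eq xe(1) ye(1) by simp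
    then have "hcat X Y * P * Q = hcat X' Y' * P * Q" by (rule arg_cong)
    then have "hcat X Y = hcat X' Y'" unfolding cancel[OF xe(2,3)] cancel[OF ye(2,3)] .
    then show "x = y"
      using hcat_inj[OF A2(1)[OF xe(2)] A1(1)[OF xe(3)] A2(1)[OF ye(2)] A1(1)[OF ye(3)]] xe(1) ye(1) by simp
  next
    fix A assume "A \<in> (\<lambda>(X,Y). hcat X Y * P) ` (S2 \<times> S1)"
    then obtain x where x: "A = (\<lambda>(X,Y). hcat X Y * P) x" "x \<in> S2 \<times> S1" by (rule imageE)
    obtain X Y where xe: "x = (X, Y)" "X \<in> S2" "Y \<in> S1" using x(2) by (rule SigmaE)
    have A: "A = hcat X Y * P" using x(1) xe(1) by simp
    have Ac: "A \<in> carrier_mat n m" unfolding A using hc[OF xe(2,3)] P(1) by (rule mult_carrier_mat)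
    have BH: "B * hcat X Y = C * Q"
      unfolding mult_hcat[OF A2(1)[OF xe(2)] A1(1)[OF xe(3)] B(1)] A2(3)[OF xe(2)] A1(2)[OF xe(3)] CQ by (rule refl)
    have "B * A = C * Q * P" unfolding A BH[symmetric] by (rule assoc_mult_mat[symmetric, OF B(1) hc[OF xe(2,3)] P(1)])
    also have "\<dots> = C" unfolding assoc_mult_mat[OF C(1) Qm P(1)] P(2) by (rule right_mult_one_mat[OF C(1)])
    finally have BA: "B * A = C" .
    \<comment> \<open>Applying \<open>B\<close> to a dependency kills the part in X and leaves D w =
      0. So w vanishes because \<open>D\<close> is injective, and then v vanishes because X
      is.\<close>
    have "inj_mat (hcat X Y)"
    proof (rule inj_matI[OF hc[OF xe(2,3)]])
      fix u assume u: "u \<in> carrier_vec m" "hcat X Y *\<^sub>v u = 0\<^sub>v n"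
      from u(1) have "u \<in> carrier_vec (s + k)" unfolding sk .
      then obtain v w where vw: "v \<in> carrier_vec s" "w \<in> carrier_vec k" "u = v @\<^sub>v w" by (rule append_vec_cases)
      have "hcat (0\<^sub>m m s) D *\<^sub>v u = B *\<^sub>v (hcat X Y *\<^sub>v u)"
        using assoc_mult_mat_vec[OF B(1) hc[OF xe(2,3)] u(1)] unfolding BH CQ .
      also have "\<dots> = 0\<^sub>v m" unfolding u(2) using B(1) by (intro eq_vecI) simp_all
      finally have "0\<^sub>m m s *\<^sub>v v + D *\<^sub>v w = 0\<^sub>v m"
        unfolding vw(3) hcat_mult_vec[OF zero_carrier_mat D vw(1,2)] .
      moreover have "0\<^sub>m m s *\<^sub>v v = 0\<^sub>v m" using vw(1) by (intro eq_vecI) simp_all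
      moreover have "D *\<^sub>v w \<in> carrier_vec m" using D vw(2) by (rule mult_mat_vec_carrier)
      ultimately have "D *\<^sub>v w = 0\<^sub>v m" by simp
      then have w0: "w = 0\<^sub>v k" by (rule inj_matD[OF injD D vw(2)])
      have "X *\<^sub>v v + Y *\<^sub>v w = 0\<^sub>v n"
        using u(2) unfolding vw(3) hcat_mult_vec[OF A2(1)[OF xe(2)] A1(1)[OF xe(3)] vw(1,2)] .
      moreover have "Y *\<^sub>v w = 0\<^sub>v n" unfolding w0 using A1(1)[OF xe(3)] by (intro eq_vecI) simp_all
      moreover have "X *\<^sub>v v \<in> carrier_vec n" using A2(1)[OF xe(2)] vw(1) by (rule mult_mat_vec_carrier)
      ultimately have "X *\<^sub>v v = 0\<^sub>v n" by simp
      then have "v = 0\<^sub>v s" by (rule inj_matD[OF A2(2,1)[OF xe(2)] vw(1)])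
      then show "u = 0\<^sub>v m" unfolding vw(3) w0 using zero_append_vec[of s k, where 'a='a] sk by simp
    qed
    then have "inj_mat A" unfolding A by (rule inj_mat_mult[OF hc[OF xe(2,3)] _ P(1) injP])
    then show "A \<in> S" unfolding S_def using Ac BA by simp
  next
    fix A assume "A \<in> S"
    then have A: "A \<in> carrier_mat n m" "inj_mat A" "B * A = C" unfolding S_def by simp_all
    have "A * Q \<in> carrier_mat n (s + k)" using A(1) Qc by (rule mult_carrier_mat)
    then obtain X Y where XY: "X \<in> carrier_mat n s" "Y \<in> carrier_mat n k" "A * Q = hcat X Y" by (rule hcat_cases)
    have "hcat (B * X) (B * Y) = B * (A * Q)" unfolding XY(3) mult_hcat[OF XY(1,2) B(1)] by (rule refl)
    also have "\<dots> = hcat (0\<^sub>m m s) D" using assoc_mult_mat[OF B(1) A(1) Qm] A(3) CQ by simp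
    finally have BX: "B * X = 0\<^sub>m m s" "B * Y = D"
      using hcat_inj[OF mult_carrier_mat[OF B(1) XY(1)] mult_carrier_mat[OF B(1) XY(2)] zero_carrier_mat D] by blast+
    have "inj_mat (hcat X Y)" unfolding XY(3)[symmetric] by (rule inj_mat_mult[OF A(1,2) Qm injQ])
    then have "inj_mat X" by (rule inj_mat_hcat_left[OF XY(1,2)])
    then have X: "X \<in> S2" unfolding S2_def using XY(1) BX(1) mult_eq_zero_iff_range_subset_kernel[OF B(1) XY(1)] by simp
    have Y: "Y \<in> S1" unfolding S1_def using XY(2) BX(2) by simp
    have "hcat X Y * P = A"
      unfolding XY(3)[symmetric] assoc_mult_mat[OF A(1) Qm P(1)] P(2) by (rule right_mult_one_mat[OF A(1)])
    then have "A = (\<lambda>(X,Y). hcat X Y * P) (X, Y)" by simp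
    then show "A \<in> (\<lambda>(X,Y). hcat X Y * P) ` (S2 \<times> S1)" by (rule image_eqI) (rule SigmaI[OF X Y])
  qed
  then have "card (S2 \<times> S1) = card S" by (rule bij_betw_same_card)
  moreover have "card S2 = (\<Prod>i<s. CARD('a) ^ r - CARD('a) ^ i)"
    unfolding S2_def card_inj_mats_into[OF lin_subspace_mat_kernel[OF B(1)]] card_kernel_surj[OF B n] by (rule refl)
  moreover have "card S1 = CARD('a) ^ (r * k)"
    unfolding S1_def by (rule card_mult_eq[OF B n D])
  moreover have "k = m - s" using sk by simp
  ultimately show ?thesis unfolding S_def[symmetric] by (simp add: card_cartesian_product mult.commute)
qed

section \<open>Kernel types, and exchanging the factors of A B\<close>

definition min_sum :: "nat multiset \<Rightarrow> nat \<Rightarrow> nat" where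
  "min_sum \<mu> i = (\<Sum>j\<in>#\<mu>. min j i)"

text \<open>The exponent \<open>min_sum \<mu> i\<close> is the dimension of ker T^i when the
  nilpotent part of T has Jordan blocks of sizes \<open>\<mu>\<close>. As no module appears, the
  type can be followed through products of rectangular matrices.\<close>

definition mat_type :: "'a::{field,finite} mat \<Rightarrow> nat multiset \<Rightarrow> bool" where
  "mat_type T \<mu> \<longleftrightarrow> (\<forall>i. card (mat_kernel (T ^\<^sub>m i)) = CARD('a) ^ min_sum \<mu> i)"

text \<open>Deletes the first column of the Young diagram, equivalently the first part of the
  conjugate partition.\<close>

definition shrink :: "nat multiset \<Rightarrow> nat multiset" where
  "shrink \<mu> = filter_mset (\<lambda>j. 0 < j) (image_mset (\<lambda>j. j - 1) \<mu>)"

lemma add_mset_partitions_iff: "add_mset x \<mu> \<in> partitions \<longleftrightarrow> x > 0 \<and> \<mu> \<in> partitions"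
  by (auto simp: partitions_def)

lemma min_sum_Suc: "\<mu> \<in> partitions \<Longrightarrow> min_sum \<mu> (Suc i) = size \<mu> + min_sum (shrink \<mu>) i"
  by (induction \<mu>) (auto simp: min_sum_def shrink_def add_mset_partitions_iff)

lemma min_sum_0 [simp]: "min_sum \<mu> 0 = 0"
  by (simp add: min_sum_def)

lemma pow_mult_swap:
  fixes A :: "'a::field mat"
  assumes A: "A \<in> carrier_mat n m" and B: "B \<in> carrier_mat m n"
  shows "(A * B) ^\<^sub>m Suc i = A * ((B * A) ^\<^sub>m i * B)"
proof (induction i)
  case 0
  have "B * A \<in> carrier_mat m m" using B A by (rule mult_carrier_mat)
  then show ?case using A B left_mult_one_mat[OF mult_carrier_mat[OF A B]] by simp
next
  case (Suc i)
  have BA: "B * A \<in> carrier_mat m m" using B A by (rule mult_carrier_mat)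
  have AB: "A * B \<in> carrier_mat n n" using A B by (rule mult_carrier_mat)
  let ?M = "(B * A) ^\<^sub>m i"
  have M: "?M \<in> carrier_mat m m" using BA by (rule pow_carrier_mat)
  have MB: "?M * B \<in> carrier_mat m n" using M B by (rule mult_carrier_mat)
  have "(A * B) ^\<^sub>m Suc (Suc i) = A * (?M * B) * (A * B)" using Suc by simp
  also have "\<dots> = A * (?M * B * (A * B))" by (rule assoc_mult_mat[OF A MB AB])
  also have "?M * B * (A * B) = ?M * (B * (A * B))" by (rule assoc_mult_mat[OF M B AB])
  also have "B * (A * B) = B * A * B" by (rule assoc_mult_mat[symmetric, OF B A B])
  also have "?M * (B * A * B) = ?M * (B * A) * B" by (rule assoc_mult_mat[symmetric, OF M BA B])
  finally show ?case by simp
qed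

lemma card_kernel_pow_swap:
  fixes A :: "'a::{field,finite} mat"
  assumes A: "A \<in> carrier_mat n m" "inj_mat A" and B: "B \<in> carrier_mat m n" "surj_mat B" and n: "n = m + r"
  shows "card (mat_kernel ((A * B) ^\<^sub>m Suc i)) = CARD('a) ^ r * card (mat_kernel ((B * A) ^\<^sub>m i))"
proof -
  have BA: "B * A \<in> carrier_mat m m" using B(1) A(1) by (rule mult_carrier_mat)
  have AB: "A * B \<in> carrier_mat n n" using A(1) B(1) by (rule mult_carrier_mat)
  let ?M = "(B * A) ^\<^sub>m i"
  have M: "?M \<in> carrier_mat m m" using BA by (rule pow_carrier_mat)
  have MB: "?M * B \<in> carrier_mat m n" using M B(1) by (rule mult_carrier_mat)
  have ABp: "(A * B) ^\<^sub>m Suc i \<in> carrier_mat n n" using AB by (rule pow_carrier_mat)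
  have "(A * B) ^\<^sub>m Suc i *\<^sub>v v = 0\<^sub>v n \<longleftrightarrow> B *\<^sub>v v \<in> mat_kernel ?M" if v: "v \<in> carrier_vec n" for v
  proof -
    have Bv: "B *\<^sub>v v \<in> carrier_vec m" using B(1) v by (rule mult_mat_vec_carrier)
    have MBv: "?M *\<^sub>v (B *\<^sub>v v) \<in> carrier_vec m" using M Bv by (rule mult_mat_vec_carrier)
    have "(A * B) ^\<^sub>m Suc i *\<^sub>v v = A *\<^sub>v (?M *\<^sub>v (B *\<^sub>v v))"
      unfolding pow_mult_swap[OF A(1) B(1)] assoc_mult_mat_vec[OF A(1) MB v] assoc_mult_mat_vec[OF M B(1) v] by (rule refl)
    moreover have "A *\<^sub>v 0\<^sub>v m = 0\<^sub>v n" using A(1) by (intro eq_vecI) simp_all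
    moreover have "A *\<^sub>v (?M *\<^sub>v (B *\<^sub>v v)) = 0\<^sub>v n \<Longrightarrow> ?M *\<^sub>v (B *\<^sub>v v) = 0\<^sub>v m"
      by (rule inj_matD[OF A(2,1) MBv])
    ultimately have "(A * B) ^\<^sub>m Suc i *\<^sub>v v = 0\<^sub>v n \<longleftrightarrow> ?M *\<^sub>v (B *\<^sub>v v) = 0\<^sub>v m"
      by (metis (no_types))
    moreover have "B *\<^sub>v v \<in> mat_kernel ?M \<longleftrightarrow> ?M *\<^sub>v (B *\<^sub>v v) = 0\<^sub>v m"
      unfolding mat_kernel[OF M] mem_Collect_eq using Bv by blast
    ultimately show ?thesis by (rule trans[OF _ sym])
  qed
  then have eq: "mat_kernel ((A * B) ^\<^sub>m Suc i) = {v \<in> carrier_vec n. B *\<^sub>v v \<in> mat_kernel ?M}"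
    unfolding mat_kernel[OF ABp] by (intro Collect_cong conj_cong refl)
  have "mat_range B = carrier_vec m" using B(2) unfolding surj_mat_def carrier_matD(1)[OF B(1)] .
  then have "mat_kernel ?M \<subseteq> mat_range B" using mat_kernel_subset[OF M] by blast
  from card_preimage[OF B(1) this] show ?thesis
    unfolding eq card_kernel_surj[OF B n] by (simp only: mult.commute)
qed

lemma mat_kernel_one: "mat_kernel (1\<^sub>m n :: 'a::field mat) = {0\<^sub>v n}"
  unfolding mat_kernel[OF one_carrier_mat] by auto

lemma mat_type_swap:
  fixes A :: "'a::{field,finite} mat"
  assumes A: "A \<in> carrier_mat n m" "inj_mat A" and B: "B \<in> carrier_mat m n" "surj_mat B"
    and n: "n = m + size \<mu>" and mu: "\<mu> \<in> partitions"
  shows "mat_type (A * B) \<mu> \<longleftrightarrow> mat_type (B * A) (shrink \<mu>)"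
proof -
  have "card (mat_kernel ((A * B) ^\<^sub>m 0)) = CARD('a) ^ min_sum \<mu> 0"
    using A(1) B(1) by (simp add: mat_kernel_one)
  then have "mat_type (A * B) \<mu> \<longleftrightarrow> (\<forall>i. card (mat_kernel ((A * B) ^\<^sub>m Suc i)) = CARD('a) ^ min_sum \<mu> (Suc i))"
    unfolding mat_type_def by (metis not0_implies_Suc)
  also have "\<dots> \<longleftrightarrow> mat_type (B * A) (shrink \<mu>)"
    unfolding mat_type_def card_kernel_pow_swap[OF A B n] min_sum_Suc[OF mu] power_add by simp
  finally show ?thesis .
qed

text \<open>The excluded eigenvalue is -1 because T stands for g - 1 and g has to be
  invertible.\<close>

definition without_eig :: "bool \<Rightarrow> 'a::field mat \<Rightarrow> bool" where
  "without_eig e T \<longleftrightarrow> (e \<longrightarrow> (\<forall>v\<in>carrier_vec (dim_row T). T *\<^sub>v v = - v \<longrightarrow> v = 0\<^sub>v (dim_row T)))"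

text \<open>\<open>B\<close> carries an eigenvector v of A B to one of B A for the same eigenvalue
  -1, unless B v = 0; but then v = - A (B v) is 0 as well.\<close>

lemma without_eig_swap_imp:
  fixes A :: "'a::field mat"
  assumes A: "A \<in> carrier_mat n m" and B: "B \<in> carrier_mat m n" and w: "without_eig e (B * A)"
  shows "without_eig e (A * B)"
  unfolding without_eig_def
proof (intro impI ballI)
  fix v assume e and "v \<in> carrier_vec (dim_row (A * B))" and eig: "A * B *\<^sub>v v = - v"
  then have v: "v \<in> carrier_vec n" using A by simp
  have Bv: "B *\<^sub>v v \<in> carrier_vec m" using B v by (rule mult_mat_vec_carrier)
  have ABv: "A *\<^sub>v (B *\<^sub>v v) = - v" using eig assoc_mult_mat_vec[OF A B v] by simp
  have "(B * A) *\<^sub>v (B *\<^sub>v v) = B *\<^sub>v (- v)" unfolding assoc_mult_mat_vec[OF B A Bv] ABv by (rule refl)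
  also have "\<dots> = - (B *\<^sub>v v)"
  proof -
    have "- v = (-1) \<cdot>\<^sub>v v" by (intro eq_vecI) simp_all
    then have "B *\<^sub>v (- v) = (-1) \<cdot>\<^sub>v (B *\<^sub>v v)" using mult_mat_vec[OF B v] by simp
    also have "\<dots> = - (B *\<^sub>v v)" by (intro eq_vecI) simp_all
    finally show ?thesis .
  qed
  finally have "B *\<^sub>v v = 0\<^sub>v m"
    using w \<open>e\<close> Bv carrier_matD(1)[OF B] unfolding without_eig_def by simp
  then have "- v = A *\<^sub>v 0\<^sub>v m" using ABv by simp
  also have "\<dots> = 0\<^sub>v n" using A by (intro eq_vecI) simp_all
  finally have "- v = 0\<^sub>v n" .
  then have "- (- v) = - 0\<^sub>v n" by simp
  then show "v = 0\<^sub>v (dim_row (A * B))" using v A by simp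
qed

lemma without_eig_swap:
  fixes A :: "'a::field mat"
  assumes A: "A \<in> carrier_mat n m" and B: "B \<in> carrier_mat m n"
  shows "without_eig e (A * B) \<longleftrightarrow> without_eig e (B * A)"
  using without_eig_swap_imp[OF A B] without_eig_swap_imp[OF B A] by blast

definition type_mats :: "bool \<Rightarrow> nat \<Rightarrow> nat multiset \<Rightarrow> 'a::{field,finite} mat set" where
  "type_mats e n \<mu> = {T \<in> carrier_mat n n. mat_type T \<mu> \<and> without_eig e T}"

lemma mat_type_card_kernel:
  fixes T :: "'a::{field,finite} mat"
  assumes "mat_type T \<mu>" "\<mu> \<in> partitions" "T \<in> carrier_mat n n"
  shows "card (mat_kernel T) = CARD('a) ^ size \<mu>"
proof -
  have "T ^\<^sub>m 1 = T" using assms(3) by simp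
  moreover have "min_sum \<mu> 1 = size \<mu>" using min_sum_Suc[OF assms(2), of 0] by simp
  ultimately show ?thesis using assms(1) unfolding mat_type_def by metis
qed

lemma card_type_mats_step:
  assumes mu: "\<mu> \<in> partitions" and n: "n = m + size \<mu>" and s: "s = size (shrink \<mu>)"
  shows "card (type_mats e n \<mu> :: 'a::{field,finite} mat set) * (\<Prod>i<m. CARD('a) ^ m - CARD('a) ^ i) =
    (\<Prod>i<m. CARD('a) ^ n - CARD('a) ^ i) * (card (type_mats e m (shrink \<mu>) :: 'a mat set) *
    (CARD('a) ^ (size \<mu> * (m - s)) * (\<Prod>i<s. CARD('a) ^ size \<mu> - CARD('a) ^ i)))"
proof -
  let ?X = "type_mats e n \<mu> :: 'a mat set" and ?Y = "type_mats e m (shrink \<mu>) :: 'a mat set"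
  let ?Sj = "{B \<in> carrier_mat m n. surj_mat (B :: 'a mat)}"
  let ?In = "{A \<in> carrier_mat n m. inj_mat (A :: 'a mat)}"
  let ?R = "{(A, B). A \<in> ?In \<and> B \<in> ?Sj \<and> A * B \<in> ?X}"
  let ?F = "\<lambda>T. {(A, B). A \<in> carrier_mat n m \<and> inj_mat A \<and> B \<in> carrier_mat m n \<and> surj_mat B \<and> A * B = (T :: 'a mat)}"
  let ?c = "CARD('a) ^ (size \<mu> * (m - s)) * (\<Prod>i<s. CARD('a) ^ size \<mu> - CARD('a) ^ i)"
  let ?L = "\<lambda>(B :: 'a mat, C). {A \<in> carrier_mat n m. inj_mat A \<and> B * A = C}"
  let ?G = "\<lambda>p. (\<lambda>A. (A, fst p)) ` ?L p"
  have shr: "shrink \<mu> \<in> partitions" by (simp add: shrink_def partitions_def)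
  have fin: "finite (?In \<times> ?Sj)"
    using finite_mat_subset[of ?In n m] finite_mat_subset[of ?Sj m n] by (intro finite_cartesian_product) simp_all
  have finX: "finite ?X" and finY: "finite ?Y"
    unfolding type_mats_def by (rule finite_mat_subset[of _ n n], simp, rule finite_mat_subset[of _ m m], simp)
  have finF: "finite (?F T)" for T by (rule finite_subset[OF _ fin]) clarsimp
  \<comment> \<open>First count: grouped by T = A B, where every T of the given type has as many
    factorizations as GL(m,q) has elements.\<close>
  have R1: "?R = (\<Union>T\<in>?X. ?F T)"
    by (intro subset_antisym subsetI) (clarsimp, clarsimp)
  have "card ?R = (\<Sum>T\<in>?X. card (?F T))"
    unfolding R1 using finX finF by (intro card_UN_disjoint) auto
  also have "\<dots> = (\<Sum>T\<in>?X. \<Prod>i<m. CARD('a) ^ m - CARD('a) ^ i)"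
  proof (intro sum.cong refl)
    fix T assume "T \<in> ?X"
    then have T: "T \<in> carrier_mat n n" "mat_type T \<mu>" by (simp_all add: type_mats_def)
    show "card (?F T) = (\<Prod>i<m. CARD('a) ^ m - CARD('a) ^ i)"
      by (rule card_rank_factorizations[OF T(1) mat_type_card_kernel[OF T(2) mu T(1)] n])
  qed
  finally have c1: "card ?R = card ?X * (\<Prod>i<m. CARD('a) ^ m - CARD('a) ^ i)" by simp
  have swap: "A * B \<in> ?X \<longleftrightarrow> B * A \<in> ?Y" if "A \<in> ?In" "B \<in> ?Sj" for A B
  proof -
    have AB: "A \<in> carrier_mat n m" "inj_mat A" "B \<in> carrier_mat m n" "surj_mat B" using that by simp_all
    have "A * B \<in> carrier_mat n n" "B * A \<in> carrier_mat m m"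
      using mult_carrier_mat[OF AB(1,3)] mult_carrier_mat[OF AB(3,1)] .
    then show ?thesis
      using mat_type_swap[OF AB n mu] without_eig_swap[OF AB(1,3)] by (simp add: type_mats_def)
  qed
  \<comment> \<open>Second count: grouped by B and C = B A. The number of A above (B, C) depends on
    C only through the size of its kernel, which the type \<open>shrink \<mu>\<close> fixes.\<close>
  have R2: "?R = (\<Union>p\<in>?Sj \<times> ?Y. ?G p)"
  proof (intro subset_antisym subsetI)
    fix x assume x: "x \<in> ?R"
    obtain A B where xe: "x = (A, B)" by (cases x)
    have AB: "A \<in> ?In" "B \<in> ?Sj" "A * B \<in> ?X" using x unfolding xe by simp_all
    have "(B, B * A) \<in> ?Sj \<times> ?Y" using AB(2) swap[OF AB(1,2)] AB(3) by (intro SigmaI) simp_all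
    moreover have "x \<in> ?G (B, B * A)" unfolding xe using AB(1) by (intro image_eqI[of _ _ A]) simp_all
    ultimately show "x \<in> (\<Union>p\<in>?Sj \<times> ?Y. ?G p)" by (rule UN_I)
  next
    fix x assume "x \<in> (\<Union>p\<in>?Sj \<times> ?Y. ?G p)"
    then obtain p where p: "p \<in> ?Sj \<times> ?Y" "x \<in> ?G p" by (rule UN_E)
    obtain B C where pe: "p = (B, C)" "B \<in> ?Sj" "C \<in> ?Y" using p(1) by (rule SigmaE)
    obtain A where A: "x = (A, B)" "A \<in> ?In" "B * A = C" using p(2) unfolding pe(1) by auto
    show "x \<in> ?R" unfolding A(1) using A(2,3) pe(2,3) swap[OF A(2) pe(2)] by simp
  qed
  have "card ?R = (\<Sum>p\<in>?Sj \<times> ?Y. card (?G p))"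
    unfolding R2
  proof (rule card_UN_disjoint)
    show "finite (?Sj \<times> ?Y)" using finite_mat_subset[of ?Sj m n] finY by (intro finite_cartesian_product) simp_all
    show "\<forall>p\<in>?Sj \<times> ?Y. finite (?G p)"
    proof
      fix p :: "'a mat \<times> 'a mat"
      have "finite (?L p)" by (rule finite_mat_subset[of _ n m]) (auto split: prod.splits)
      then show "finite (?G p)" by (rule finite_imageI)
    qed
    show "\<forall>p\<in>?Sj \<times> ?Y. \<forall>p'\<in>?Sj \<times> ?Y. p \<noteq> p' \<longrightarrow> ?G p \<inter> ?G p' = {}" by auto
  qed
  also have "\<dots> = (\<Sum>p\<in>?Sj \<times> ?Y. ?c)"
  proof (intro sum.cong refl)
    fix p assume "p \<in> ?Sj \<times> ?Y"
    then obtain B C where pe: "p = (B, C)" "B \<in> ?Sj" "C \<in> ?Y" by (rule SigmaE)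
    have B: "B \<in> carrier_mat m n" "surj_mat B" using pe(2) by simp_all
    have C: "C \<in> carrier_mat m m" "mat_type C (shrink \<mu>)" using pe(3) by (simp_all add: type_mats_def)
    have "card (mat_kernel C) = CARD('a) ^ s" unfolding s by (rule mat_type_card_kernel[OF C(2) shr C(1)])
    then have "card (?L (B, C)) = ?c"
      using card_inj_lifts[OF B n C(1)] by simp
    moreover have "card (?G p) = card (?L p)" by (rule card_image) (simp add: inj_on_def)
    ultimately show "card (?G p) = ?c" unfolding pe(1) by simp
  qed
  finally have "card ?R = card ?Sj * card ?Y * ?c" by (simp add: card_cartesian_product)
  then show ?thesis using c1 card_surj_mats[of m n, where 'a='a] by (simp add: mult.assoc)
qed

text \<open>The size of \<open>\<mu>\<close> is the dimension of the kernel. This settles the case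
  in which \<open>card_type_mats_step\<close> has no \<open>m\<close> to offer.\<close>

lemma type_mats_empty:
  assumes mu: "\<mu> \<in> partitions" and n: "n < size \<mu>"
  shows "(type_mats e n \<mu> :: 'a::{field,finite} mat set) = {}"
proof (rule ccontr)
  assume "(type_mats e n \<mu> :: 'a mat set) \<noteq> {}"
  then obtain T :: "'a mat" where "T \<in> type_mats e n \<mu>" by blast
  then have T: "T \<in> carrier_mat n n" "mat_type T \<mu>" unfolding type_mats_def by simp_all
  have "card (mat_kernel T) \<le> card (carrier_vec n :: 'a vec set)"
    using mat_kernel_subset[OF T(1)] by (intro card_mono) simp_all
  then have "CARD('a) ^ size \<mu> \<le> CARD('a) ^ n"
    using mat_type_card_kernel[OF T(2) mu T(1)] card_carrier_vec[of n, where 'a='a] by simp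
  then have "size \<mu> \<le> n" by (rule power_le_imp_le_exp[OF card_field_gt_1])
  then show False using n by simp
qed

section \<open>Euler products\<close>

text \<open>The q-Pochhammer symbol (x;x)_k.\<close>

definition qpoch :: "real \<Rightarrow> nat \<Rightarrow> real" where
  "qpoch x k = (\<Prod>i<k. 1 - x ^ Suc i)"

lemma qpoch_0 [simp]: "qpoch x 0 = 1"
  by (simp add: qpoch_def)

lemma qpoch_Suc: "qpoch x (Suc k) = qpoch x k * (1 - x ^ Suc k)"
  by (simp add: qpoch_def)

text \<open>Equals x^(j(j+1)/2) / (x;x)_j, the absolute value of the coefficient of u^j in Euler's
  expansion of prod_i (1 - u x^i).\<close>

definition euler_abs :: "real \<Rightarrow> nat \<Rightarrow> real" where
  "euler_abs x j = (\<Prod>i<j. x ^ Suc i / (1 - x ^ Suc i))"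

text \<open>The coefficient of u^k in prod_i 1 / (1 - u x^i);
  \<open>sum_inverse_aut_card_size\<close> identifies it with the sum of 1/|Aut lambda| over
  |lambda| = k.\<close>

definition size_mass :: "real \<Rightarrow> nat \<Rightarrow> real" where
  "size_mass x k = x ^ k / qpoch x k"

locale small_base =
  fixes x :: real
  assumes x_pos: "0 < x" and x_le: "x \<le> 1/2"
begin

lemma x_lt_1: "x < 1"
  using x_le by simp

lemma pow_lt_1: "x ^ Suc i < 1"
  using x_pos x_lt_1 by (intro power_Suc_less_one) auto

lemma pow_pos: "0 < x ^ i"
  using x_pos by simp

lemma pow_le_half_pow: "x ^ i \<le> (1/2) ^ i"
  using x_pos x_le by (intro power_mono) auto

lemma qpoch_pos: "0 < qpoch x k"
  unfolding qpoch_def using pow_lt_1 by (intro prod_pos) simp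

text \<open>The bound 1/4 alone would not survive multiplication by a factor below 1. The excess
  (1/2)^(k+2) pays for the next factor; at k = 0 there is equality.\<close>

lemma qpoch_half: "qpoch (1/2) (Suc k) \<ge> 1/4 + (1/2) ^ (k + 2)"
proof (induction k)
  case 0
  show ?case by (simp add: qpoch_def)
next
  case (Suc k)
  \<comment> \<open>The next factor is 1 - y, and (1/4 + y)(1 - y) \<ge> 1/4 + y/2 amounts to y
    \<le> 1/4.\<close>
  define y :: real where "y = (1/2) ^ (k + 2)"
  have y: "0 < y" "y \<le> 1/4"
    unfolding y_def using power_decreasing[of 2 "k + 2" "1/2 :: real"] by (simp_all add: power2_eq_square)
  have "y * y \<le> (1/4) * y" using y by (intro mult_right_mono) auto
  then have "1/4 + y/2 \<le> (1/4 + y) * (1 - y)" by (simp add: field_simps)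
  also have "\<dots> \<le> qpoch (1/2) (Suc k) * (1 - y)"
    using Suc y unfolding y_def[symmetric] by (intro mult_right_mono) auto
  also have "\<dots> = qpoch (1/2) (Suc (Suc k))"
    by (subst (2) qpoch_Suc) (simp add: y_def)
  finally show ?case by (simp add: y_def)
qed

text \<open>Every factor decreases in x, so x = 1/2 is the worst case.\<close>

lemma qpoch_ge: "1/4 \<le> qpoch x k"
proof (cases k)
  case (Suc j)
  have "1/4 \<le> 1/4 + (1/2 :: real) ^ (j + 2)" by simp
  also have "\<dots> \<le> qpoch (1/2) k" using qpoch_half[of j] Suc by simp
  also have "\<dots> \<le> qpoch x k"
    unfolding qpoch_def
  proof (intro prod_mono conjI)
    fix i
    show "0 \<le> 1 - (1/2 :: real) ^ Suc i" using power_le_one[of "1/2 :: real" "Suc i"] by (simp del: power_Suc)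
    show "1 - (1/2 :: real) ^ Suc i \<le> 1 - x ^ Suc i" using pow_le_half_pow[of "Suc i"] by simp
  qed
  finally show ?thesis .
qed simp

lemma euler_abs_0 [simp]: "euler_abs x 0 = 1"
  by (simp add: euler_abs_def)

lemma euler_abs_Suc: "euler_abs x (Suc j) = euler_abs x j * (x ^ Suc j / (1 - x ^ Suc j))"
  by (simp add: euler_abs_def)

lemma euler_abs_pos: "0 < euler_abs x j"
  unfolding euler_abs_def
proof (intro prod_pos)
  show "0 < x ^ Suc i / (1 - x ^ Suc i)" for i
    using pow_lt_1[of i] pow_pos[of "Suc i"] by (intro divide_pos_pos) (simp_all del: power_Suc)
qed

lemma size_mass_pos: "0 < size_mass x k"
  unfolding size_mass_def using pow_pos qpoch_pos by simp

lemma size_mass_0 [simp]: "size_mass x 0 = 1"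
  by (simp add: size_mass_def)

lemma size_mass_Suc: "size_mass x (Suc k) * (1 - x ^ Suc k) = x * size_mass x k"
proof -
  have "1 - x ^ Suc k \<noteq> 0" using pow_lt_1[of k] by simp
  then show ?thesis
    unfolding size_mass_def qpoch_Suc by (simp del: power_Suc)
qed

text \<open>The numerator of the difference is 1 - (1 - x^(k+1)); this makes the sums of
  \<open>size_mass\<close> telescope.\<close>

lemma size_mass_diff: "1 / qpoch x (Suc k) - 1 / qpoch x k = size_mass x (Suc k)"
proof -
  have "1 - x ^ Suc k \<noteq> 0" "qpoch x k \<noteq> 0" using pow_lt_1[of k] qpoch_pos[of k] by simp_all
  then show ?thesis
    unfolding size_mass_def qpoch_Suc by (simp add: field_simps del: power_Suc)
qed

lemma sum_size_mass: "(\<Sum>k\<le>n. size_mass x k) = 1 / qpoch x n"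
proof (induction n)
  case (Suc n)
  then show ?case using size_mass_diff[of n] by simp
qed simp

lemma size_mass_le: "size_mass x k \<le> 4 * x ^ k"
proof -
  have "x ^ k * 1 \<le> x ^ k * (4 * qpoch x k)" using qpoch_ge[of k] pow_pos[of k] by (intro mult_left_mono) auto
  then show ?thesis
    unfolding size_mass_def using qpoch_pos[of k] by (simp add: pos_divide_le_eq mult_ac)
qed

lemma summable_size_mass: "summable (size_mass x)"
proof (rule summable_comparison_test'[of "\<lambda>k. 4 * x ^ k" 0])
  show "summable (\<lambda>k. 4 * x ^ k)" using x_pos x_lt_1 by (intro summable_mult summable_geometric) auto
  show "norm (size_mass x k) \<le> 4 * x ^ k" for k using size_mass_le[of k] size_mass_pos[of k] by simp
qed

text \<open>A crude comparison whose purpose is the absolute convergence of Euler's series.\<close>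

lemma euler_abs_le_size_mass: "euler_abs x j \<le> size_mass x j"
proof (induction j)
  case (Suc j)
  have d: "0 < 1 - x ^ Suc j" using pow_lt_1[of j] by simp
  have "x ^ Suc j \<le> x" using x_pos x_lt_1 power_decreasing[of 1 "Suc j" x] by simp
  then have "euler_abs x (Suc j) \<le> size_mass x j * (x / (1 - x ^ Suc j))"
    unfolding euler_abs_Suc using Suc euler_abs_pos[of j] size_mass_pos[of j] d pow_pos[of "Suc j"]
    by (intro mult_mono divide_right_mono divide_nonneg_pos) (simp_all del: power_Suc add: less_imp_le)
  also have "\<dots> = size_mass x (Suc j)"
    using size_mass_Suc[of j] d by (simp add: field_simps del: power_Suc)
  finally show ?case .
qed simp

lemma summable_euler_abs: "summable (euler_abs x)"
proof (rule summable_comparison_test'[OF summable_size_mass, of 0])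
  show "norm (euler_abs x k) \<le> size_mass x k" for k
    using euler_abs_le_size_mass[of k] euler_abs_pos[of k] by simp
qed

text \<open>Monotonicity for the Leibniz criterion. It depends on x \<le> 1/2, since y / (1 - y)
  \<le> 1 means y \<le> 1/2.\<close>

lemma euler_abs_Suc_le: "euler_abs x (Suc j) \<le> euler_abs x j"
proof -
  have "x ^ Suc j \<le> x" using x_pos x_lt_1 power_decreasing[of 1 "Suc j" x] by simp
  then have "x ^ Suc j \<le> 1/2" using x_le by (rule order_trans)
  then have "x ^ Suc j / (1 - x ^ Suc j) \<le> 1" by (subst divide_le_eq_1_pos) linarith+
  then show ?thesis unfolding euler_abs_Suc using euler_abs_pos[of j] by (intro mult_left_le) auto
qed

text \<open>One numerator is x, and the m others are at most x^2. The exponent 2 m + 1 instead of m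
  + 1 leaves a spare x^m, whose geometric sum keeps the convolution in
  \<open>sum_mass_euler_le\<close> within a constant multiple of x^(n+1).\<close>

lemma euler_abs_Suc_bound: "euler_abs x (Suc m) \<le> x ^ (2 * m + 1) / qpoch x (Suc m)"
proof (induction m)
  case 0
  show ?case by (simp add: euler_abs_def qpoch_def)
next
  case (Suc m)
  have d: "0 < 1 - x ^ Suc (Suc m)" using pow_lt_1[of "Suc m"] by simp
  have "x ^ Suc (Suc m) \<le> x ^ 2" using x_pos x_lt_1 by (intro power_decreasing) auto
  then have "euler_abs x (Suc (Suc m)) \<le> (x ^ (2 * m + 1) / qpoch x (Suc m)) * (x ^ 2 / (1 - x ^ Suc (Suc m)))"
    unfolding euler_abs_Suc[of "Suc m"]
    using Suc euler_abs_pos[of "Suc m"] qpoch_pos[of "Suc m"] d pow_pos[of "2 * m + 1"] pow_pos[of "Suc (Suc m)"]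
    by (intro mult_mono divide_right_mono divide_nonneg_pos) (simp_all only: less_imp_le)
  also have "\<dots> = x ^ (2 * Suc m + 1) / qpoch x (Suc (Suc m))"
    unfolding qpoch_Suc[of x "Suc m"] by (simp add: power_add power2_eq_square mult_ac)
  finally show ?case .
qed

section \<open>Generating series and Euler's expansion\<close>

definition euler_fps :: "real fps" where
  "euler_fps = Abs_fps (\<lambda>j. (-1) ^ j * euler_abs x j)"

definition mass_fps :: "real fps" where
  "mass_fps = Abs_fps (size_mass x)"

text \<open>\<open>mass_fps\<close> is \<open>\<Prod>i\<ge>1. 1 / (1 - u x\<^sup>i)\<close>, and \<open>euler_fps\<close> is its inverse, both characterised by
  their behaviour under \<open>u \<mapsto> x u\<close>.\<close>

lemma euler_fps_mult_mass_fps: "euler_fps * mass_fps = 1"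
proof -
  let ?L = "fps_const x * fps_X :: real fps"
  let ?l = "1 - fps_const x * fps_X :: real fps"
  have comp: "fps_nth (fps_compose f ?L) k = x ^ k * fps_nth f k" for f k
    by (simp only: fps_compose_linear fps_nth_Abs_fps)
  have lin: "fps_nth (?l * f) k = fps_nth f k - x * (if k = 0 then 0 else fps_nth f (k - 1))" for f k
    by (simp add: left_diff_distrib mult.assoc)
  \<comment> \<open>Writing M(u) and E(u) for the two series: M(x u) = (1 - x u) M(u).\<close>
  have S: "fps_compose mass_fps ?L = ?l * mass_fps"
  proof (rule fps_ext)
    fix n
    show "fps_nth (fps_compose mass_fps ?L) n = fps_nth (?l * mass_fps) n"
      unfolding comp lin using size_mass_Suc[of "n - 1"]
      by (cases n) (simp_all add: mass_fps_def algebra_simps)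
  qed
  \<comment> \<open>Correspondingly, E(u) = (1 - x u) E(x u).\<close>
  have E: "euler_fps = ?l * fps_compose euler_fps ?L"
  proof (rule fps_ext)
    fix n
    have "euler_abs x (Suc j) * (1 - x ^ Suc j) = x ^ Suc j * euler_abs x j" for j
      using pow_lt_1[of j] unfolding euler_abs_Suc by simp
    from arg_cong[OF this[of "n - 1"], of "\<lambda>t. (-1) ^ (n - 1) * t"] show "fps_nth euler_fps n = fps_nth (?l * fps_compose euler_fps ?L) n"
      unfolding comp lin
      by (cases n) (simp_all add: euler_fps_def algebra_simps)
  qed
  let ?F = "euler_fps * mass_fps"
  \<comment> \<open>Passing the factor 1 - x u from M to E shows that F = E M is invariant under u
    \<mapsto> x u. So x^n F_n = F_n, and only the constant coefficient survives.\<close>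
  have "fps_compose ?F ?L = fps_compose euler_fps ?L * (?l * mass_fps)"
    using S by (subst fps_compose_mult_distrib) simp_all
  also have "\<dots> = ?F" by (subst (2) E) (simp add: mult_ac)
  finally have F: "fps_compose ?F ?L = ?F" .
  show ?thesis
  proof (rule fps_ext)
    fix n
    show "fps_nth ?F n = fps_nth 1 n"
    proof (cases n)
      case 0
      then show ?thesis by (simp add: euler_fps_def mass_fps_def)
    next
      case (Suc k)
      have "x ^ n * fps_nth ?F n = fps_nth ?F n" using arg_cong[OF F, of "\<lambda>f. fps_nth f n"] by (simp add: comp)
      moreover have "x ^ n \<noteq> 1" using pow_lt_1[of k] Suc by simp
      ultimately have "fps_nth ?F n = 0" by (metis mult_cancel_right1)
      then show ?thesis using Suc by simp
    qed
  qed
qed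

text \<open>Multiplying the generating series of the hypothesis by \<open>euler_fps\<close> isolates
  that of \<open>d\<close>; the remaining factor \<open>?one\<close> is 1 / (1 - u), which turns
  coefficients into partial sums.\<close>

lemma convolution_solution_eq_euler_sum:
  assumes d: "\<And>n. (\<Sum>k\<le>n. size_mass x k * d (n - k)) = 1"
  shows "d m = (\<Sum>j\<le>m. (-1) ^ j * euler_abs x j)"
proof -
  let ?D = "Abs_fps d" and ?one = "Abs_fps (\<lambda>_. 1 :: real)"
  have "mass_fps * ?D = ?one"
    by (rule fps_ext) (simp add: fps_mult_nth mass_fps_def d atLeast0AtMost)
  then have "euler_fps * mass_fps * ?D = euler_fps * ?one" by (simp add: mult.assoc)
  then have "?D = euler_fps * ?one" unfolding euler_fps_mult_mass_fps by simp
  from arg_cong[OF this, of "\<lambda>f. fps_nth f m"] show ?thesis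
    by (simp add: fps_mult_nth euler_fps_def atLeast0AtMost)
qed

section \<open>The infinite product and the numerical estimates\<close>

lemma convergent_prod_factors: "convergent_prod (\<lambda>i. 1 - x ^ Suc i)"
proof -
  have "summable (\<lambda>i. norm (- (x ^ Suc i)))"
    using x_pos x_lt_1 by (simp add: summable_mult summable_geometric)
  moreover have "1 + - (x ^ Suc i) \<noteq> 0" for i using pow_lt_1[of i] by simp
  ultimately have "abs_convergent_prod (\<lambda>i. 1 + - (x ^ Suc i))"
    by (intro summable_imp_abs_convergent_prod) simp
  then show ?thesis using abs_convergent_prod_imp_convergent_prod by fastforce
qed

definition qpoch_inf :: real where
  "qpoch_inf = (\<Prod>i. 1 - x ^ Suc i)"

lemma qpoch_tendsto: "qpoch x \<longlonglongrightarrow> qpoch_inf"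
proof -
  have "(\<lambda>n. \<Prod>i\<le>n. 1 - x ^ Suc i) \<longlonglongrightarrow> qpoch_inf"
    unfolding qpoch_inf_def by (rule convergent_prod_LIMSEQ[OF convergent_prod_factors])
  then have "(\<lambda>n. qpoch x (Suc n)) \<longlonglongrightarrow> qpoch_inf"
    unfolding qpoch_def lessThan_Suc_atMost .
  then show ?thesis by (rule LIMSEQ_imp_Suc)
qed

lemma qpoch_inf_ge: "1/4 \<le> qpoch_inf"
  by (rule LIMSEQ_le_const[OF qpoch_tendsto]) (use qpoch_ge in blast)

lemma qpoch_inf_pos: "0 < qpoch_inf"
  using qpoch_inf_ge by simp

lemma qpoch_Suc_le: "qpoch x (Suc k) \<le> qpoch x k"
  unfolding qpoch_Suc using qpoch_pos[of k] pow_pos[of "Suc k"] pow_lt_1[of k]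
  by (intro mult_left_le) (simp_all del: power_Suc)

lemma qpoch_inf_le: "qpoch_inf \<le> qpoch x k"
proof -
  have "decseq (qpoch x)" using qpoch_Suc_le by (rule decseq_SucI)
  then show ?thesis using qpoch_tendsto by (rule decseq_ge)
qed

lemma size_mass_sums: "size_mass x sums (1 / qpoch_inf)"
proof -
  have "(\<lambda>n. 1 / qpoch x n) \<longlonglongrightarrow> 1 / qpoch_inf"
    using qpoch_tendsto qpoch_inf_pos by (intro tendsto_divide tendsto_const) auto
  then show ?thesis unfolding sums_def_le sum_size_mass .
qed

text \<open>The inverse relation of the two series is evaluated at u = 1, which the Cauchy product
  justifies by absolute convergence. The value of the other factor is known from
  \<open>size_mass_sums\<close>.\<close>

lemma euler_sum: "(\<Sum>j. (-1) ^ j * euler_abs x j) = qpoch_inf"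
proof -
  let ?e = "\<lambda>j. (-1) ^ j * euler_abs x j"
  have ne: "summable (\<lambda>j. norm (?e j))"
    using summable_euler_abs euler_abs_pos by (simp add: abs_mult power_abs abs_of_pos)
  have ns: "summable (\<lambda>j. norm (size_mass x j))"
    using summable_size_mass size_mass_pos by (simp add: abs_of_pos)
  have "(\<lambda>k. \<Sum>i\<le>k. ?e i * size_mass x (k - i)) sums ((\<Sum>k. ?e k) * (\<Sum>k. size_mass x k))"
    by (rule Cauchy_product_sums[OF ne ns])
  moreover have "(\<Sum>i\<le>k. ?e i * size_mass x (k - i)) = (if k = 0 then 1 else 0)" for k
    using arg_cong[OF euler_fps_mult_mass_fps, of "\<lambda>f. fps_nth f k"]
    by (simp add: fps_mult_nth euler_fps_def mass_fps_def atLeast0AtMost)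
  moreover have "(\<lambda>k. if k = 0 then 1 else 0 :: real) sums 1" using sums_single[of 0 "\<lambda>_. 1 :: real"] by simp
  ultimately have "(\<Sum>k. ?e k) * (\<Sum>k. size_mass x k) = 1" using sums_unique2 by fastforce
  then have "(\<Sum>k. ?e k) * (1 / qpoch_inf) = 1" using sums_unique[OF size_mass_sums] by simp
  then show ?thesis using qpoch_inf_pos by simp
qed

lemma euler_partial_sum_error:
  "\<bar>(\<Sum>j\<le>m. (-1) ^ j * euler_abs x j) - qpoch_inf\<bar> \<le> euler_abs x (Suc m)"
proof -
  let ?e = "\<lambda>j. (-1) ^ j * euler_abs x j"
  let ?s = "\<lambda>n. \<Sum>j<n. ?e j"
  have a0: "euler_abs x \<longlonglongrightarrow> 0" using summable_euler_abs by (rule summable_LIMSEQ_zero)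
  have nn: "0 \<le> euler_abs x n" for n using euler_abs_pos[of n] by simp
  note L = summable_Leibniz'[OF a0 nn euler_abs_Suc_le]
  \<comment> \<open>Partial sums with an even number of terms lie below the limit, those with an odd
    number above it, and neighbours differ by a single term.\<close>
  have lo: "?s (2 * n) \<le> qpoch_inf" and hi: "qpoch_inf \<le> ?s (2 * n + 1)" for n
    using L(2)[of n] L(4)[of n] unfolding euler_sum .
  have eq: "(\<Sum>j\<le>m. ?e j) = ?s (Suc m)" by (simp only: lessThan_Suc_atMost)
  show ?thesis
  proof (cases "even (Suc m)")
    case True
    then obtain n where n: "Suc m = 2 * n" by (rule evenE)
    have "?s (2 * n + 1) = ?s (2 * n) + euler_abs x (2 * n)" by simp
    then show ?thesis unfolding eq n using lo[of n] hi[of n] by simp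
  next
    case False
    then obtain n where n: "Suc m = 2 * n + 1" by (rule oddE)
    have "?s (2 * Suc n) = ?s (2 * n + 1) - euler_abs x (2 * n + 1)" by simp
    then show ?thesis unfolding eq n using lo[of "Suc n"] hi[of n] by simp
  qed
qed

text \<open>The quotient is the product of 1 - x^i over i > n, and x^(n+1) + x^(n+2) + ... \<le> 2
  x^(n+1).\<close>

lemma tail_ratio_upper: "1 - qpoch_inf / qpoch x n \<le> 2 * x ^ Suc n"
proof -
  let ?y = "x ^ Suc n"
  \<comment> \<open>The induction needs the partial sum y + y/2 + ... of the dominating geometric
    series, which is 2 y (1 - (1/2)^N) after N terms; the last factor is dropped afterwards.\<close>
  have step: "qpoch x n * (1 - 2 * ?y * (1 - (1/2) ^ N)) \<le> qpoch x (n + N)" for N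
  proof (induction N)
    case (Suc N)
    define h :: real where "h = (1/2) ^ N"
    have h: "0 < h" "h \<le> 1" unfolding h_def by (simp_all add: power_le_one)
    have "?y \<le> x" using power_decreasing[of 1 "Suc n" x] x_pos x_lt_1 by simp
    then have y: "0 < ?y" "?y \<le> 1/2" using pow_pos[of "Suc n"] x_le by linarith+
    have xy: "x ^ Suc (n + N) \<le> ?y * h"
      using mult_left_mono[OF pow_le_half_pow[of N], of ?y] y(1) unfolding h_def by (simp add: power_add)
    have z: "0 \<le> 1 - ?y * h" using mult_mono[OF y(2) h(2)] y h by simp
    have "0 \<le> 2 * ?y * (1 - h) * (?y * h)" using y(1) h by (intro mult_nonneg_nonneg) (simp_all del: power_Suc)
    then have "1 - 2 * ?y * (1 - h / 2) \<le> (1 - 2 * ?y * (1 - h)) * (1 - ?y * h)"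
      by (simp add: algebra_simps del: power_Suc)
    then have "qpoch x n * (1 - 2 * ?y * (1 - h / 2)) \<le> qpoch x n * ((1 - 2 * ?y * (1 - h)) * (1 - ?y * h))"
      using qpoch_pos[of n] by (intro mult_left_mono) (simp_all del: power_Suc)
    also have "\<dots> = (qpoch x n * (1 - 2 * ?y * (1 - h))) * (1 - ?y * h)" by (simp del: power_Suc)
    also have "\<dots> \<le> qpoch x (n + N) * (1 - ?y * h)"
      using Suc z unfolding h_def[symmetric] by (intro mult_right_mono)
    also have "\<dots> \<le> qpoch x (n + N) * (1 - x ^ Suc (n + N))"
      using xy qpoch_pos[of "n + N"] by (intro mult_left_mono) (simp_all del: power_Suc)
    finally show ?case unfolding h_def by (simp add: qpoch_Suc)
  qed simp
  have "qpoch x n * (1 - 2 * ?y) \<le> qpoch x (n + N)" for N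
  proof -
    have "0 \<le> qpoch x n * (2 * ?y * (1/2) ^ N)"
      using qpoch_pos[of n] pow_pos[of "Suc n"] by (intro mult_nonneg_nonneg) (simp_all del: power_Suc)
    then show ?thesis using step[of N] by (simp add: algebra_simps del: power_Suc)
  qed
  then have "qpoch x n * (1 - 2 * ?y) \<le> qpoch_inf"
    using LIMSEQ_ignore_initial_segment[OF qpoch_tendsto, of n]
    by (intro LIMSEQ_le_const[of "\<lambda>N. qpoch x (N + n)"]) (auto simp: add.commute)
  then show ?thesis using qpoch_pos[of n] by (simp add: field_simps del: power_Suc)
qed

text \<open>Only the first factor of the remaining product is kept.\<close>

lemma tail_ratio_lower: "x ^ Suc n \<le> 1 - qpoch_inf / qpoch x n"
proof -
  have "qpoch_inf \<le> qpoch x n * (1 - x ^ Suc n)" using qpoch_inf_le[of "Suc n"] unfolding qpoch_Suc .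
  then show ?thesis using qpoch_pos[of n] by (simp add: field_simps del: power_Suc)
qed

lemma sum_mass_euler_le: "(\<Sum>k\<le>n. size_mass x k * euler_abs x (Suc (n - k))) \<le> 24 * x ^ Suc n"
proof -
  \<comment> \<open>The case m = 0 is treated apart: x / (1 - x) \<le> 2 x gives 2 where the general
    estimate gives 4. With 4 the final upper constant would be 17.\<close>
  have b: "euler_abs x (Suc m) \<le> x ^ Suc m * (if m = 0 then 2 else 4 * (1/2) ^ m)" for m
  proof (cases m)
    case 0
    have "x / (1 - x) \<le> x / (1/2)" using x_pos x_le by (intro divide_left_mono) auto
    then show ?thesis using 0 by (simp add: euler_abs_def)
  next
    case (Suc i)
    have "euler_abs x (Suc m) \<le> x ^ (2 * m + 1) / qpoch x (Suc m)" by (rule euler_abs_Suc_bound)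
    also have "\<dots> \<le> x ^ (2 * m + 1) / (1/4)"
      using qpoch_ge[of "Suc m"] qpoch_pos[of "Suc m"] pow_pos[of "2 * m + 1"]
      by (intro divide_left_mono mult_pos_pos) (simp_all del: power_Suc add: less_imp_le)
    also have "\<dots> = x ^ Suc m * (4 * x ^ m)" by (simp add: mult_2 power_add)
    also have "\<dots> \<le> x ^ Suc m * (4 * (1/2) ^ m)"
      using pow_le_half_pow[of m] pow_pos[of "Suc m"] by (intro mult_left_mono) (simp_all del: power_Suc add: less_imp_le)
    finally show ?thesis using Suc by simp
  qed
  \<comment> \<open>The sum stays below 2 + 4 (1/2 + 1/4 + ...) = 6; the constant 24 is 6 times the
    4 of \<open>size_mass_le\<close>.\<close>
  have s: "(\<Sum>m\<le>n. if m = 0 then 2 else 4 * (1/2) ^ m) = (6 - 4 * (1/2) ^ n :: real)" for n :: nat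
    by (induction n) (simp_all add: field_simps)
  have "(\<Sum>k\<le>n. size_mass x k * euler_abs x (Suc (n - k))) \<le>
      (\<Sum>k\<le>n. 4 * x ^ Suc n * (if n - k = 0 then 2 else 4 * (1/2) ^ (n - k)))"
  proof (rule sum_mono)
    fix k assume "k \<in> {..n}"
    then have k: "k + Suc (n - k) = Suc n" by simp
    have "size_mass x k * euler_abs x (Suc (n - k)) \<le>
        (4 * x ^ k) * (x ^ Suc (n - k) * (if n - k = 0 then 2 else 4 * (1/2) ^ (n - k)))"
      using size_mass_le[of k] b[of "n - k"] pow_pos[of k] euler_abs_pos[of "Suc (n - k)"]
      by (intro mult_mono) (simp_all del: power_Suc add: less_imp_le)
    also have "\<dots> = 4 * x ^ (k + Suc (n - k)) * (if n - k = 0 then 2 else 4 * (1/2) ^ (n - k))"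
      by (simp only: power_add mult_ac)
    finally show "size_mass x k * euler_abs x (Suc (n - k)) \<le> 4 * x ^ Suc n * (if n - k = 0 then 2 else 4 * (1/2) ^ (n - k))"
      unfolding k .
  qed
  also have "\<dots> = 4 * x ^ Suc n * (\<Sum>m\<le>n. if m = 0 then 2 else 4 * (1/2) ^ m)"
    unfolding sum_distrib_left[symmetric]
    by (intro arg_cong2[of _ _ _ _ "(*)"] refl sum.reindex_bij_witness[of _ "\<lambda>m. n - m" "\<lambda>k. n - k"]) auto
  also have "\<dots> \<le> 4 * x ^ Suc n * 6"
    unfolding s using pow_pos[of "Suc n"] by (intro mult_left_mono) (simp_all del: power_Suc)
  finally show ?thesis by simp
qed

end

section \<open>Partitions attached to modules\<close>

abbreviation zm1 :: "'a::field poly" where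
  "zm1 \<equiv> [:-1, 1:]"

text \<open>An element of the quotient ring in explicit form, for which equality is
  divisibility.\<close>

definition pcoset :: "nat \<Rightarrow> 'a::field poly \<Rightarrow> 'a poly set" where
  "pcoset k p = {s. zm1 ^ k dvd s - p}"

lemma pcoset_eq_iff: "pcoset k p = pcoset k q \<longleftrightarrow> zm1 ^ k dvd p - q"
proof
  assume eq: "pcoset k p = pcoset k q"
  have "p \<in> pcoset k p" by (simp add: pcoset_def)
  then show "zm1 ^ k dvd p - q" unfolding eq by (simp add: pcoset_def)
next
  assume d: "zm1 ^ k dvd p - q"
  have "zm1 ^ k dvd s - p \<longleftrightarrow> zm1 ^ k dvd s - q" for s
    using dvd_add_left_iff[OF d, of "s - p"] by (simp add: dvd_add_right_iff)
  then show "pcoset k p = pcoset k q" by (simp add: pcoset_def)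
qed

lemma a_r_coset_eq_pcoset:
  "(PIdl\<^bsub>class_ring\<^esub> (zm1 ^ k)) +>\<^bsub>class_ring\<^esub> p = pcoset k (p :: 'a::field poly)"
proof -
  have "(\<exists>r. s = r * zm1 ^ k + p) \<longleftrightarrow> zm1 ^ k dvd s - p" for s
    by (auto simp: dvd_def algebra_simps)
  then show ?thesis
    by (auto simp: a_r_coset_def r_coset_def cgenideal_def pcoset_def)
qed

lemma PIdl_eq_pcoset: "PIdl\<^bsub>class_ring\<^esub> (zm1 ^ k) = pcoset k (0 :: 'a::field poly)"
  by (auto simp: cgenideal_def pcoset_def dvd_def mult.commute)

lemma quot_module_carrier:
  "carrier (quot_module class_ring (PIdl\<^bsub>class_ring\<^esub> (zm1 ^ k))) = range (pcoset k :: 'a::field poly \<Rightarrow> _)"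
  unfolding quot_module_def FactRing_simps by (auto simp: a_r_coset_eq_pcoset)

lemma quot_module_zero:
  "\<zero>\<^bsub>quot_module class_ring (PIdl\<^bsub>class_ring\<^esub> (zm1 ^ k))\<^esub> = pcoset k (0 :: 'a::field poly)"
  unfolding quot_module_def FactRing_def by (simp add: PIdl_eq_pcoset)

lemma quot_module_add:
  "pcoset k p \<oplus>\<^bsub>quot_module class_ring (PIdl\<^bsub>class_ring\<^esub> (zm1 ^ k))\<^esub> pcoset k q = pcoset k (p + q :: 'a::field poly)"
proof -
  have "(\<exists>a. zm1 ^ k dvd a - p \<and> (\<exists>b. zm1 ^ k dvd b - q \<and> s = a + b)) \<longleftrightarrow> zm1 ^ k dvd s - (p + q)" for s
  proof
    assume "\<exists>a. zm1 ^ k dvd a - p \<and> (\<exists>b. zm1 ^ k dvd b - q \<and> s = a + b)"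
    then obtain a b where "zm1 ^ k dvd a - p" "zm1 ^ k dvd b - q" "s = a + b" by blast
    then show "zm1 ^ k dvd s - (p + q)" using dvd_add[of "zm1 ^ k" "a - p" "b - q"] by (simp add: algebra_simps)
  next
    assume "zm1 ^ k dvd s - (p + q)"
    then show "\<exists>a. zm1 ^ k dvd a - p \<and> (\<exists>b. zm1 ^ k dvd b - q \<and> s = a + b)"
      by (intro exI[of _ "s - q"] conjI exI[of _ q]) (simp_all add: algebra_simps)
  qed
  then show ?thesis
    unfolding quot_module_def FactRing_def pcoset_def by (auto simp: set_add_def set_mult_def)
qed

text \<open>The quotient ring multiplies two cosets by uniting the cosets of all products of
  representatives; these all coincide.\<close>

lemma quot_module_smult:
  "r \<odot>\<^bsub>quot_module class_ring (PIdl\<^bsub>class_ring\<^esub> (zm1 ^ k))\<^esub> pcoset k p = pcoset k (r * p :: 'a::field poly)"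
proof -
  have "pcoset k (a * b) = pcoset k (r * p)" if "a \<in> pcoset k r" "b \<in> pcoset k p" for a b
  proof -
    have "a * b - r * p = (a - r) * b + r * (b - p)" by (simp add: algebra_simps)
    then show ?thesis using that unfolding pcoset_eq_iff by (simp add: pcoset_def)
  qed
  moreover have "r \<in> pcoset k r" "p \<in> pcoset k p" by (simp_all add: pcoset_def)
  ultimately have "(\<Union>a\<in>pcoset k r. \<Union>b\<in>pcoset k p. pcoset k (a * b)) = pcoset k (r * p)" by blast
  then show ?thesis
    unfolding quot_module_def FactRing_def by (simp add: rcoset_mult_def a_r_coset_eq_pcoset)
qed

text \<open>Replaces the construction of induced maps between quotients. Both images are projections
  of the set of pairs (f x, g x), and both projections are injective on it.\<close>

lemma card_image_cong_kernel:
  assumes "\<And>x y. x \<in> S \<Longrightarrow> y \<in> S \<Longrightarrow> f x = f y \<longleftrightarrow> g x = g y"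
  shows "card (f ` S) = card (g ` S)"
proof -
  let ?h = "\<lambda>x. (f x, g x)"
  have "f ` S = fst ` ?h ` S" "g ` S = snd ` ?h ` S" by (simp_all add: image_image)
  moreover have "card (fst ` ?h ` S) = card (?h ` S)" "card (snd ` ?h ` S) = card (?h ` S)"
    using assms by (auto intro!: card_image simp: inj_on_def)
  ultimately show ?thesis by simp
qed

lemma zm1_dvd_iff: "zm1 dvd p \<longleftrightarrow> poly p 1 = (0 :: 'a::field)"
  using poly_eq_0_iff_dvd[of p 1] by simp

lemma poly_decompose: "p = [:poly p 1:] + zm1 * synthetic_div p (1 :: 'a::field)"
  using synthetic_div_correct'[of 1 p] by (simp add: add.commute)

text \<open>Modulo (z - 1)^(k+1) a polynomial p is determined by p(1) together with its quotient on
  division by z - 1, taken modulo (z - 1)^k.\<close>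

lemma card_range_pcoset: "card (range (pcoset k :: 'a::{field,finite} poly \<Rightarrow> _)) = CARD('a) ^ k"
proof (induction k)
  case 0
  have "range (pcoset 0 :: 'a poly \<Rightarrow> _) = {UNIV}" by (auto simp: pcoset_def)
  then show ?case by simp
next
  case (Suc k)
  let ?g = "\<lambda>p :: 'a poly. (poly p 1, pcoset k (synthetic_div p 1))"
  have "card (range (pcoset (Suc k) :: 'a poly \<Rightarrow> _)) = card (range ?g)"
  proof (rule card_image_cong_kernel)
    fix p q :: "'a poly"
    have pq: "p - q = [:poly p 1 - poly q 1:] + zm1 * (synthetic_div p 1 - synthetic_div q 1)"
      by (subst poly_decompose[of p], subst poly_decompose[of q]) (simp add: algebra_simps)
    show "pcoset (Suc k) p = pcoset (Suc k) q \<longleftrightarrow> ?g p = ?g q"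
    proof
      assume "pcoset (Suc k) p = pcoset (Suc k) q"
      then have d: "zm1 ^ Suc k dvd p - q" unfolding pcoset_eq_iff .
      then have "zm1 dvd p - q" by (metis dvd_mult_left power_Suc)
      then have e: "poly p 1 = poly q 1" unfolding zm1_dvd_iff by simp
      have "zm1 * zm1 ^ k dvd zm1 * (synthetic_div p 1 - synthetic_div q 1)"
        using d unfolding pq e power_Suc by simp
      then have "zm1 ^ k dvd synthetic_div p 1 - synthetic_div q 1"
        by (subst (asm) dvd_mult_cancel_left) simp
      then show "?g p = ?g q" using e by (simp add: pcoset_eq_iff)
    next
      assume g: "?g p = ?g q"
      then have "zm1 ^ k dvd synthetic_div p 1 - synthetic_div q 1" by (simp add: pcoset_eq_iff)
      then have "zm1 * zm1 ^ k dvd zm1 * (synthetic_div p 1 - synthetic_div q 1)" by (rule mult_dvd_mono[OF dvd_refl])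
      then show "pcoset (Suc k) p = pcoset (Suc k) q" using g unfolding pcoset_eq_iff pq power_Suc by simp
    qed
  qed
  also have "range ?g = UNIV \<times> range (pcoset k)"
  proof (intro subset_antisym subsetI)
    fix x :: "'a \<times> 'a poly set" assume "x \<in> UNIV \<times> range (pcoset k)"
    then obtain a r where x: "x = (a, pcoset k r)" by auto
    let ?p = "[:a:] + zm1 * r"
    have a: "poly ?p 1 = a" by simp
    have "zm1 * synthetic_div ?p 1 = zm1 * r" using poly_decompose[of ?p] unfolding a by simp
    then have "synthetic_div ?p 1 = r" by (subst (asm) mult_cancel_left) simp
    then have "x = ?g ?p" unfolding x using a by (simp only:)
    then show "x \<in> range ?g" by (rule range_eqI)
  qed auto
  finally show ?case using Suc by (simp add: card_cartesian_product)
qed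

text \<open>The classes killed by (z - 1)^i are the multiples of (z - 1)^(k - m) with m = min k i;
  division by that power identifies them with the classes modulo (z - 1)^m.\<close>

lemma card_pcoset_torsion:
  "card (pcoset k ` {p :: 'a::{field,finite} poly. zm1 ^ k dvd zm1 ^ i * p}) = CARD('a) ^ min k i"
proof -
  define m where "m = min k i"
  let ?c = "zm1 ^ (k - m) :: 'a poly"
  have km: "k = (k - m) + m" by (simp add: m_def)
  have c0: "zm1 ^ j \<noteq> (0 :: 'a poly)" for j by simp
  have "{p :: 'a poly. zm1 ^ k dvd zm1 ^ i * p} = range (\<lambda>r. ?c * r)"
  proof (cases "i \<le> k")
    case True
    have "zm1 ^ k dvd zm1 ^ i * p \<longleftrightarrow> ?c dvd p" for p :: "'a poly"
    proof -
      have "zm1 ^ k = zm1 ^ i * ?c" using True by (simp add: m_def flip: power_add)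
      then show ?thesis using c0[of i] by (simp only: dvd_mult_cancel_left) simp
    qed
    then show ?thesis by (auto simp: dvd_def)
  next
    case False
    then have "zm1 ^ k dvd zm1 ^ i * (p :: 'a poly)" for p
      by (intro dvd_mult2 le_imp_power_dvd) simp
    moreover have "?c = 1" using False by (simp add: m_def)
    ultimately show ?thesis by auto
  qed
  then have "card (pcoset k ` {p :: 'a poly. zm1 ^ k dvd zm1 ^ i * p}) = card (range (\<lambda>r. pcoset k (?c * r)))"
    by (simp add: image_image)
  also have "\<dots> = card (range (pcoset m :: 'a poly \<Rightarrow> _))"
  proof (rule card_image_cong_kernel)
    fix p r :: "'a poly"
    have "zm1 ^ k = ?c * zm1 ^ m" by (subst (1) km) (rule power_add)
    then show "pcoset k (?c * p) = pcoset k (?c * r) \<longleftrightarrow> pcoset m p = pcoset m r"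
      unfolding pcoset_eq_iff right_diff_distrib[symmetric] using c0[of "k - m"]
      by (simp only: dvd_mult_cancel_left) simp
  qed
  finally show ?thesis by (simp add: card_range_pcoset m_def)
qed

lemma length_sorted_list_of_multiset: "length (sorted_list_of_multiset \<mu>) = size \<mu>"
  by (metis mset_sorted_list_of_multiset size_mset)

lemma primary_type_carrier:
  "carrier (primary_type zm1 \<mu> :: ('a::field poly, _) module) =
    (\<Pi>\<^sub>E j\<in>{..<size \<mu>}. range (pcoset (sorted_list_of_multiset \<mu> ! j)))"
  by (simp add: primary_type_def Let_def dsum_module_def quot_module_carrier length_sorted_list_of_multiset)

text \<open>Representatives \<open>p j\<close> accompany \<open>y\<close>, so that later arguments
  calculate with polynomials rather than with cosets.\<close>

lemma primary_type_smult:
  assumes "\<And>j. j < size \<mu> \<Longrightarrow> y j = pcoset (sorted_list_of_multiset \<mu> ! j) (p j)"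
  shows "r \<odot>\<^bsub>primary_type zm1 \<mu>\<^esub> y = (\<lambda>j\<in>{..<size \<mu>}. pcoset (sorted_list_of_multiset \<mu> ! j) (r * p j :: 'a::field poly))"
  using assms
  by (auto simp: primary_type_def Let_def dsum_module_def quot_module_smult length_sorted_list_of_multiset intro!: restrict_ext)

lemma primary_type_add:
  assumes "\<And>j. j < size \<mu> \<Longrightarrow> y j = pcoset (sorted_list_of_multiset \<mu> ! j) (p j)"
    and "\<And>j. j < size \<mu> \<Longrightarrow> y' j = pcoset (sorted_list_of_multiset \<mu> ! j) (p' j)"
  shows "y \<oplus>\<^bsub>primary_type zm1 \<mu>\<^esub> y' = (\<lambda>j\<in>{..<size \<mu>}. pcoset (sorted_list_of_multiset \<mu> ! j) (p j + p' j :: 'a::field poly))"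
  using assms
  by (auto simp: primary_type_def Let_def dsum_module_def quot_module_add length_sorted_list_of_multiset intro!: restrict_ext)

lemma primary_type_zero:
  "\<zero>\<^bsub>primary_type zm1 \<mu>\<^esub> = (\<lambda>j\<in>{..<size \<mu>}. pcoset (sorted_list_of_multiset \<mu> ! j) (0 :: 'a::field poly))"
  by (simp add: primary_type_def Let_def dsum_module_def quot_module_zero length_sorted_list_of_multiset)

text \<open>Torsion in a direct sum is taken summand by summand, so the counts multiply. This number
  is the link between \<open>primary_type\<close> and \<open>mat_type\<close>.\<close>

lemma card_primary_type_torsion:
  "card {y \<in> carrier (primary_type zm1 \<mu>). (zm1 ^ i :: 'a::{field,finite} poly) \<odot>\<^bsub>primary_type zm1 \<mu>\<^esub> y = \<zero>\<^bsub>primary_type zm1 \<mu>\<^esub>}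
    = CARD('a) ^ min_sum \<mu> i"
proof -
  let ?N = "primary_type zm1 \<mu> :: ('a poly, _) module"
  let ?xs = "sorted_list_of_multiset \<mu>"
  let ?T = "\<lambda>k. pcoset k ` {p :: 'a poly. zm1 ^ k dvd zm1 ^ i * p}"
  note len = length_sorted_list_of_multiset[of \<mu>]
  have "{y \<in> carrier ?N. zm1 ^ i \<odot>\<^bsub>?N\<^esub> y = \<zero>\<^bsub>?N\<^esub>} = (\<Pi>\<^sub>E j\<in>{..<size \<mu>}. ?T (?xs ! j))"
  proof (intro subset_antisym subsetI)
    fix y assume "y \<in> {y \<in> carrier ?N. zm1 ^ i \<odot>\<^bsub>?N\<^esub> y = \<zero>\<^bsub>?N\<^esub>}"
    then have y: "y \<in> (\<Pi>\<^sub>E j\<in>{..<size \<mu>}. range (pcoset (?xs ! j)))" "zm1 ^ i \<odot>\<^bsub>?N\<^esub> y = \<zero>\<^bsub>?N\<^esub>"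
      unfolding primary_type_carrier by simp_all
    have "\<exists>p. j < size \<mu> \<longrightarrow> y j = pcoset (?xs ! j) p" for j using PiE_mem[OF y(1), of j] by auto
    then obtain p where p: "\<And>j. j < size \<mu> \<Longrightarrow> y j = pcoset (?xs ! j) (p j)" by metis
    have "y j \<in> ?T (?xs ! j)" if j: "j < size \<mu>" for j
    proof -
      have "pcoset (?xs ! j) (zm1 ^ i * p j) = pcoset (?xs ! j) 0"
        using fun_cong[OF y(2), of j] primary_type_smult[OF p, of "zm1 ^ i"] j
        unfolding primary_type_zero by simp
      then show ?thesis unfolding p[OF j] by (intro imageI) (simp add: pcoset_eq_iff)
    qed
    then show "y \<in> (\<Pi>\<^sub>E j\<in>{..<size \<mu>}. ?T (?xs ! j))" using y(1) by (simp add: PiE_iff)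
  next
    fix y assume y: "y \<in> (\<Pi>\<^sub>E j\<in>{..<size \<mu>}. ?T (?xs ! j))"
    have "\<exists>p. j < size \<mu> \<longrightarrow> y j = pcoset (?xs ! j) p \<and> zm1 ^ (?xs ! j) dvd zm1 ^ i * p" for j
      using PiE_mem[OF y, of j] by auto
    then obtain p where p: "\<And>j. j < size \<mu> \<Longrightarrow> y j = pcoset (?xs ! j) (p j)"
      "\<And>j. j < size \<mu> \<Longrightarrow> zm1 ^ (?xs ! j) dvd zm1 ^ i * p j" by metis
    have "zm1 ^ i \<odot>\<^bsub>?N\<^esub> y = \<zero>\<^bsub>?N\<^esub>"
      unfolding primary_type_zero using p
      by (subst primary_type_smult[of \<mu> y p]) (auto intro!: restrict_ext pcoset_eq_iff[THEN iffD2])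
    moreover have "y \<in> carrier ?N"
      unfolding primary_type_carrier using y p(1) by (simp add: PiE_iff)
    ultimately show "y \<in> {y \<in> carrier ?N. zm1 ^ i \<odot>\<^bsub>?N\<^esub> y = \<zero>\<^bsub>?N\<^esub>}" by simp
  qed
  then have "card {y \<in> carrier ?N. zm1 ^ i \<odot>\<^bsub>?N\<^esub> y = \<zero>\<^bsub>?N\<^esub>} = (\<Prod>j<size \<mu>. CARD('a) ^ min (?xs ! j) i)"
    by (simp add: card_PiE card_pcoset_torsion)
  also have "\<dots> = CARD('a) ^ (\<Sum>j<size \<mu>. min (?xs ! j) i)" by (rule power_sum[symmetric])
  also have "(\<Sum>j<size \<mu>. min (?xs ! j) i) = sum_list (map (\<lambda>k. min k i) ?xs)"
    unfolding len[symmetric] by (simp add: sum_list_sum_nth atLeast0LessThan)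
  also have "\<dots> = min_sum \<mu> i"
    unfolding min_sum_def by (metis mset_map mset_sorted_list_of_multiset sum_mset_sum_list)
  finally show ?thesis .
qed

section \<open>Recovering a partition from its kernel dimensions\<close>

lemma min_sum_Suc_conj: "min_sum \<mu> (Suc i) = min_sum \<mu> i + conj_part \<mu> (Suc i)"
  by (induction \<mu>) (auto simp: min_sum_def conj_part_def)

lemma conj_part_Suc: "conj_part \<mu> i = count \<mu> i + conj_part \<mu> (Suc i)"
  by (induction \<mu>) (auto simp: conj_part_def)

text \<open>The differences of \<open>min_sum\<close> are the conjugate parts, and their differences
  in turn are the multiplicities of the positive parts. Membership in \<open>partitions\<close>
  settles the multiplicity of 0.\<close>

lemma min_sum_inject:
  assumes "\<mu> \<in> partitions" "\<nu> \<in> partitions" "\<And>i. min_sum \<mu> i = min_sum \<nu> i"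
  shows "\<mu> = \<nu>"
proof (rule multiset_eqI)
  fix i
  have c: "conj_part \<mu> (Suc j) = conj_part \<nu> (Suc j)" for j
    using assms(3)[of j] assms(3)[of "Suc j"] by (simp add: min_sum_Suc_conj)
  show "count \<mu> i = count \<nu> i"
  proof (cases i)
    case 0
    then show ?thesis using assms(1,2) by (simp add: partitions_def not_in_iff)
  next
    case (Suc j)
    then show ?thesis using c[of j] c[of "Suc j"] conj_part_Suc[of \<mu> i] conj_part_Suc[of \<nu> i] by simp
  qed
qed

lemma mat_type_unique:
  fixes T :: "'a::{field,finite} mat"
  assumes "mat_type T \<mu>" "mat_type T \<nu>" "\<mu> \<in> partitions" "\<nu> \<in> partitions"
  shows "\<mu> = \<nu>"
proof (rule min_sum_inject[OF assms(3,4)])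
  fix i
  have "CARD('a) ^ min_sum \<mu> i = CARD('a) ^ min_sum \<nu> i"
    using assms(1,2) unfolding mat_type_def by simp
  then show "min_sum \<mu> i = min_sum \<nu> i" using card_field_gt_1[where 'a='a] by (simp add: power_inject_exp)
qed

lemma part_le_sum_mset: "j \<in># \<mu> \<Longrightarrow> j \<le> \<Sum>\<^sub># (\<mu> :: nat multiset)"
  by (metis le_add1 multi_member_split sum_mset.add_mset)

lemma min_sum_max: "min_sum \<mu> (\<Sum>\<^sub># \<mu>) = \<Sum>\<^sub># \<mu>"
proof -
  have "image_mset (\<lambda>j. min j (\<Sum>\<^sub># \<mu>)) \<mu> = image_mset (\<lambda>j. j) \<mu>"
    by (intro image_mset_cong) (simp add: part_le_sum_mset)
  then show ?thesis by (simp add: min_sum_def)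
qed

text \<open>At the exponent \<open>\<Sum>\<^sub># \<mu>\<close> no part is cut off by the minimum,
  so the kernel has the whole sum as its dimension.\<close>

lemma mat_type_sum_le:
  fixes T :: "'a::{field,finite} mat"
  assumes "T \<in> carrier_mat n n" "mat_type T \<mu>"
  shows "\<Sum>\<^sub># \<mu> \<le> n"
proof -
  let ?P = "T ^\<^sub>m (\<Sum>\<^sub># \<mu>)"
  have "card (mat_kernel ?P) \<le> card (carrier_vec n :: 'a vec set)"
    using mat_kernel_subset[OF pow_carrier_mat[OF assms(1)]] by (intro card_mono) simp_all
  moreover have "card (mat_kernel ?P) = CARD('a) ^ \<Sum>\<^sub># \<mu>"
    using assms(2) unfolding mat_type_def by (simp add: min_sum_max)
  ultimately have "CARD('a) ^ \<Sum>\<^sub># \<mu> \<le> CARD('a) ^ n"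
    using card_carrier_vec[of n, where 'a='a] by simp
  then show ?thesis by (rule power_le_imp_le_exp[OF card_field_gt_1])
qed

section \<open>The polynomial action of a square matrix\<close>

locale square_matrix =
  fixes g :: "'a::{field,finite} mat" and n :: nat
  assumes g: "g \<in> carrier_mat n n"
begin

abbreviation act where
  "act \<equiv> poly_act g"

abbreviation V where
  "V \<equiv> carrier_vec n :: 'a vec set"

lemma dim_g [simp]: "dim_row g = n"
  using g by simp

lemma g_carrier [simp]: "v \<in> V \<Longrightarrow> g *\<^sub>v v \<in> V"
  using g by (rule mult_mat_vec_carrier)

lemma g_zero: "g *\<^sub>v 0\<^sub>v n = 0\<^sub>v n"
  using g by (intro eq_vecI) simp_all

lemma act_0 [simp]: "act 0 v = 0\<^sub>v n"
  by (simp add: poly_act_def)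

lemma act_pCons:
  assumes "v \<in> V"
  shows "act (pCons a p) v = a \<cdot>\<^sub>v v + g *\<^sub>v act p v"
\<comment> \<open>In the exceptional case \<open>pCons a p\<close> is the zero polynomial, for which
  \<open>fold_coeffs\<close> has no step to unfold.\<close>
proof (cases "a = 0 \<and> p = 0")
  case True
  have "0 \<cdot>\<^sub>v v = 0\<^sub>v n" using assms by (intro eq_vecI) simp_all
  then show ?thesis using True g_zero by simp
next
  case False
  then show ?thesis by (auto simp: poly_act_def)
qed

lemma act_carrier [simp]: "v \<in> V \<Longrightarrow> act p v \<in> V"
  by (induction p) (simp_all add: act_pCons)

lemma act_add_poly:
  assumes v: "v \<in> V"
  shows "act (p + q) v = act p v + act q v"
proof (induction p arbitrary: q)
  case 0
  show ?case using act_carrier[OF v, of q] by simp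
next
  case (pCons a p)
  obtain b r where q: "q = pCons b r" by (cases q)
  have c: "act p v \<in> V" "act r v \<in> V" using v by simp_all
  note gc = g_carrier[OF c(1)] g_carrier[OF c(2)]
  have "(a + b) \<cdot>\<^sub>v v + (g *\<^sub>v act p v + g *\<^sub>v act r v) =
      (a \<cdot>\<^sub>v v + g *\<^sub>v act p v) + (b \<cdot>\<^sub>v v + g *\<^sub>v act r v)"
    using v gc by (intro eq_vecI) (simp_all add: algebra_simps del: index_mult_mat_vec)
  then show ?case
    unfolding q add_pCons act_pCons[OF v] pCons.IH mult_add_distrib_mat_vec[OF g c] .
qed

lemma act_add_vec:
  assumes v: "v \<in> V" and w: "w \<in> V"
  shows "act p (v + w) = act p v + act p w"
proof (induction p)
  case 0
  show ?case by simp
next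
  case (pCons a p)
  have c: "act p v \<in> V" "act p w \<in> V" using v w by simp_all
  note gc = g_carrier[OF c(1)] g_carrier[OF c(2)]
  have vw: "v + w \<in> V" using v w by simp
  have "a \<cdot>\<^sub>v (v + w) + (g *\<^sub>v act p v + g *\<^sub>v act p w) =
      (a \<cdot>\<^sub>v v + g *\<^sub>v act p v) + (a \<cdot>\<^sub>v w + g *\<^sub>v act p w)"
    using v w gc by (intro eq_vecI) (simp_all add: algebra_simps del: index_mult_mat_vec)
  then show ?case
    unfolding act_pCons[OF v] act_pCons[OF w] act_pCons[OF vw] pCons.IH mult_add_distrib_mat_vec[OF g c] .
qed

lemma act_zero_vec: "act p (0\<^sub>v n) = 0\<^sub>v n"
proof (induction p)
  case (pCons a p)
  have "a \<cdot>\<^sub>v 0\<^sub>v n = (0\<^sub>v n :: 'a vec)" by (intro eq_vecI) simp_all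
  then show ?case unfolding act_pCons[OF zero_carrier_vec] pCons.IH g_zero by simp
qed simp

lemma act_const: "v \<in> V \<Longrightarrow> act [:a:] v = a \<cdot>\<^sub>v v"
  using g_zero by (simp add: act_pCons)

lemma act_smult:
  assumes v: "v \<in> V"
  shows "act (Polynomial.smult c p) v = c \<cdot>\<^sub>v act p v"
proof (induction p)
  case 0
  have "c \<cdot>\<^sub>v 0\<^sub>v n = (0\<^sub>v n :: 'a vec)" by (intro eq_vecI) simp_all
  then show ?case by simp
next
  case (pCons a p)
  have c: "act p v \<in> V" using v by simp
  note gc = g_carrier[OF c]
  have "(c * a) \<cdot>\<^sub>v v + c \<cdot>\<^sub>v (g *\<^sub>v act p v) = c \<cdot>\<^sub>v (a \<cdot>\<^sub>v v + g *\<^sub>v act p v)"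
    using v gc by (intro eq_vecI) (simp_all add: algebra_simps del: index_mult_mat_vec)
  then show ?case
    unfolding smult_pCons act_pCons[OF v] pCons.IH mult_mat_vec[OF g c] .
qed

lemma act_mult:
  assumes v: "v \<in> V"
  shows "act (p * q) v = act p (act q v)"
proof (induction p)
  case 0
  show ?case by simp
next
  case (pCons a p)
  have z: "0 \<cdot>\<^sub>v v = 0\<^sub>v n" using v by (intro eq_vecI) simp_all
  have c: "g *\<^sub>v act p (act q v) \<in> V" using v by simp
  show ?case
    unfolding mult_pCons_left act_add_poly[OF v] act_smult[OF v] act_pCons[OF v] pCons.IH
      act_pCons[OF act_carrier[OF v]] z using c by simp
qed

lemma act_one: "v \<in> V \<Longrightarrow> act 1 v = v"
  unfolding one_pCons by (simp add: act_const)

definition T :: "'a mat" where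
  "T = g - 1\<^sub>m n"

lemma T_carrier: "T \<in> carrier_mat n n"
  using g by (simp add: T_def minus_carrier_mat)

lemma act_zm1:
  assumes v: "v \<in> V"
  shows "act zm1 v = T *\<^sub>v v"
proof -
  have gv: "g *\<^sub>v v \<in> V" using v by simp
  have "act zm1 v = (-1) \<cdot>\<^sub>v v + g *\<^sub>v v"
    using act_pCons[OF v, of "-1" "[:1:]"] act_const[OF v, of 1] by simp
  also have "\<dots> = g *\<^sub>v v - v"
    using v gv by (intro eq_vecI) (simp_all del: index_mult_mat_vec)
  also have "\<dots> = T *\<^sub>v v"
    unfolding T_def minus_mult_distrib_mat_vec[OF g one_carrier_mat v] using v by simp
  finally show ?thesis .
qed

lemma act_zm1_power:
  assumes v: "v \<in> V"
  shows "act (zm1 ^ i) v = T ^\<^sub>m i *\<^sub>v v"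
  using v
proof (induction i arbitrary: v)
  case 0
  then show ?case using T_carrier act_one by simp
next
  case (Suc i)
  have Tv: "T *\<^sub>v v \<in> V" using T_carrier Suc.prems by (rule mult_mat_vec_carrier)
  have "act (zm1 ^ Suc i) v = act (zm1 ^ i) (T *\<^sub>v v)"
    unfolding power_Suc2 act_mult[OF Suc.prems] act_zm1[OF Suc.prems] by (rule refl)
  also have "\<dots> = T ^\<^sub>m i *\<^sub>v (T *\<^sub>v v)" by (rule Suc.IH[OF Tv])
  also have "\<dots> = T ^\<^sub>m Suc i *\<^sub>v v"
    using assoc_mult_mat_vec[OF pow_carrier_mat[OF T_carrier] T_carrier Suc.prems, of i] by simp
  finally show ?case .
qed

lemma mat_kernel_T_power: "mat_kernel (T ^\<^sub>m i) = {v \<in> V. act (zm1 ^ i) v = 0\<^sub>v n}"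
  unfolding mat_kernel[OF pow_carrier_mat[OF T_carrier]] using act_zm1_power by auto

section \<open>Chains of generators for the primary component\<close>

fun cmb :: "'a vec list \<Rightarrow> (nat \<Rightarrow> 'a poly) \<Rightarrow> 'a vec" where
  "cmb [] p = 0\<^sub>v n"
| "cmb (v # vs) p = act (p 0) v + cmb vs (\<lambda>j. p (Suc j))"

lemma cmb_carrier [simp]: "set vs \<subseteq> V \<Longrightarrow> cmb vs p \<in> V"
  by (induction vs arbitrary: p) simp_all

lemma cmb_cong:
  "(\<And>j. j < length vs \<Longrightarrow> act (p j) (vs ! j) = act (q j) (vs ! j)) \<Longrightarrow> cmb vs p = cmb vs q"
proof (induction vs arbitrary: p q)
  case (Cons v vs)
  have "cmb vs (\<lambda>j. p (Suc j)) = cmb vs (\<lambda>j. q (Suc j))"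
    by (rule Cons.IH) (use Cons.prems[of "Suc _"] in simp)
  then show ?case using Cons.prems[of 0] by simp
qed simp

lemma cmb_zero: "set vs \<subseteq> V \<Longrightarrow> cmb vs (\<lambda>_. 0) = 0\<^sub>v n"
  by (induction vs) simp_all

lemma cmb_add:
  "set vs \<subseteq> V \<Longrightarrow> cmb vs (\<lambda>j. p j + q j) = cmb vs p + cmb vs q"
proof (induction vs arbitrary: p q)
  case (Cons v vs)
  then have v: "v \<in> V" and vs: "set vs \<subseteq> V" by simp_all
  show ?case
    using Cons.IH[OF vs, of "\<lambda>j. p (Suc j)" "\<lambda>j. q (Suc j)"] act_carrier[OF v, of "p 0"] act_carrier[OF v, of "q 0"]
      cmb_carrier[OF vs, of "\<lambda>j. p (Suc j)"] cmb_carrier[OF vs, of "\<lambda>j. q (Suc j)"]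
    by (simp add: act_add_poly[OF v]) (intro eq_vecI, simp_all)
qed simp

lemma cmb_act:
  "set vs \<subseteq> V \<Longrightarrow> act r (cmb vs p) = cmb vs (\<lambda>j. r * p j)"
proof (induction vs arbitrary: p)
  case Nil
  show ?case by (simp add: act_zero_vec)
next
  case (Cons v vs)
  then have v: "v \<in> V" and vs: "set vs \<subseteq> V" by simp_all
  show ?case
    using Cons.IH[OF vs] act_add_vec[OF act_carrier[OF v] cmb_carrier[OF vs]] act_mult[OF v] by simp
qed

lemma cmb_diff:
  assumes "set vs \<subseteq> V"
  shows "cmb vs (\<lambda>j. p j - q j) = cmb vs p - cmb vs q"
proof -
  have "cmb vs (\<lambda>j. p j - q j) + cmb vs q = cmb vs p"
    using cmb_add[OF assms, of "\<lambda>j. p j - q j" q] by simp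
  then have "cmb vs p - cmb vs q = (cmb vs (\<lambda>j. p j - q j) + cmb vs q) - cmb vs q" by simp
  also have "\<dots> = cmb vs (\<lambda>j. p j - q j)"
    using cmb_carrier[OF assms, of "\<lambda>j. p j - q j"] cmb_carrier[OF assms, of q] by (intro eq_vecI) simp_all
  finally show ?thesis by simp
qed

text \<open>Independence of the tops \<open>T\<^sup>k\<^sup>-\<^sup>1 v\<close> makes the sum of the cyclic modules generated by the \<open>v\<close> direct,
  because a nonzero kernel would meet the socle.\<close>

definition jordan_system :: "'a vec list \<Rightarrow> nat list \<Rightarrow> bool" where
  "jordan_system vs ks \<longleftrightarrow> length vs = length ks \<and> set vs \<subseteq> V \<and> 0 \<notin> set ks \<and>
     (\<forall>j<length vs. act (zm1 ^ (ks ! j)) (vs ! j) = 0\<^sub>v n) \<and>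
     (\<forall>c. cmb vs (\<lambda>j. [:c j:] * zm1 ^ (ks ! j - 1)) = 0\<^sub>v n \<longrightarrow> (\<forall>j<length vs. c j = 0))"

lemma act_eq_of_dvd:
  assumes v: "v \<in> V" and z: "act d v = 0\<^sub>v n" and d: "d dvd p - q"
  shows "act p v = act q v"
proof -
  obtain r where r: "p - q = d * r" using d by (rule dvdE)
  have p: "p = r * d + q" using diff_add_cancel[of p q] unfolding r by (simp only: mult.commute)
  show ?thesis
    unfolding p act_add_poly[OF v] act_mult[OF v] z act_zero_vec by (rule left_zero_vec[OF act_carrier[OF v]])
qed

text \<open>The divisibility holds after multiplication by a high power of z - 1. The extra factors
  are then removed one at a time, each removal using the independence of the tops.\<close>

lemma jordan_system_inj:
  assumes J: "jordan_system vs ks" and c: "cmb vs p = 0\<^sub>v n" and j: "j < length vs"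
  shows "zm1 ^ (ks ! j) dvd p j"
proof -
  have len: "length vs = length ks" and vs: "set vs \<subseteq> V" and k0: "0 \<notin> set ks"
    and ann: "\<And>j. j < length vs \<Longrightarrow> act (zm1 ^ (ks ! j)) (vs ! j) = 0\<^sub>v n"
    and ind: "\<And>c. cmb vs (\<lambda>j. [:c j:] * zm1 ^ (ks ! j - 1)) = 0\<^sub>v n \<Longrightarrow> \<forall>j<length vs. c j = 0"
    using J unfolding jordan_system_def by blast+
  have kp: "ks ! j \<noteq> 0" if "j < length vs" for j
    using nth_mem[of j ks] k0 that len by (intro notI) simp
  \<comment> \<open>Removal of one factor: every p j is (z - 1)^(k - 1) times some r j, with k the
    length of the chain. Modulo the annihilator only the value of r j at 1 matters, so the relation
    is one among the tops and these values vanish.\<close>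
  have step: "\<forall>j<length vs. zm1 ^ (ks ! j) dvd p j"
    if d: "\<forall>j<length vs. zm1 ^ (ks ! j) dvd zm1 * p j" and c: "cmb vs p = 0\<^sub>v n" for p
  proof -
    define r where "r j = p j div zm1 ^ (ks ! j - 1)" for j
    have zk: "zm1 ^ (ks ! j) = zm1 * (zm1 ^ (ks ! j - 1) :: 'a poly)" if "j < length vs" for j
      using kp[OF that] by (cases "ks ! j") simp_all
    have r: "p j = zm1 ^ (ks ! j - 1) * r j" if j: "j < length vs" for j
    proof -
      have "zm1 * zm1 ^ (ks ! j - 1) dvd zm1 * p j" using d j unfolding zk[OF j, symmetric] by blast
      then have "zm1 ^ (ks ! j - 1) dvd p j" by (subst (asm) dvd_mult_cancel_left) simp
      then show ?thesis unfolding r_def by simp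
    qed
    have split: "zm1 ^ (ks ! j - 1) * r j = [:poly (r j) 1:] * zm1 ^ (ks ! j - 1) + zm1 ^ (ks ! j) * synthetic_div (r j) 1"
      if "j < length vs" for j
      unfolding zk[OF that] by (subst (1) poly_decompose[of "r j"]) (simp only: distrib_left mult_ac)
    have "cmb vs p = cmb vs (\<lambda>j. [:poly (r j) 1:] * zm1 ^ (ks ! j - 1))"
    proof (rule cmb_cong)
      fix j assume j: "j < length vs"
      show "act (p j) (vs ! j) = act ([:poly (r j) 1:] * zm1 ^ (ks ! j - 1)) (vs ! j)"
      proof (rule act_eq_of_dvd)
        show "vs ! j \<in> V" using vs j nth_mem by blast
        show "act (zm1 ^ (ks ! j)) (vs ! j) = 0\<^sub>v n" by (rule ann[OF j])
        show "zm1 ^ (ks ! j) dvd p j - [:poly (r j) 1:] * zm1 ^ (ks ! j - 1)"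
          unfolding r[OF j] split[OF j] by simp
      qed
    qed
    then have "cmb vs (\<lambda>j. [:poly (r j) 1:] * zm1 ^ (ks ! j - 1)) = 0\<^sub>v n" unfolding c by (rule sym)
    then have r0: "\<forall>j<length vs. poly (r j) 1 = 0" by (rule ind)
    show ?thesis
    proof (intro allI impI)
      fix j assume j: "j < length vs"
      have "p j = zm1 ^ (ks ! j) * synthetic_div (r j) 1" unfolding r[OF j] split[OF j] using r0 j by simp
      then show "zm1 ^ (ks ! j) dvd p j" by (rule dvdI)
    qed
  qed
  have descent: "\<forall>j<length vs. zm1 ^ (ks ! j) dvd p j"
    if "\<forall>j<length vs. zm1 ^ (ks ! j) dvd zm1 ^ m * p j" "cmb vs p = 0\<^sub>v n" for m p
    using that
  proof (induction m)
    case (Suc m)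
    have z: "cmb vs (\<lambda>j. zm1 ^ m * p j) = 0\<^sub>v n"
      unfolding cmb_act[OF vs, symmetric] Suc.prems(2) by (rule act_zero_vec)
    have "\<forall>j<length vs. zm1 ^ (ks ! j) dvd zm1 * (zm1 ^ m * p j)"
      using Suc.prems(1) unfolding power_Suc mult.assoc .
    then have "\<forall>j<length vs. zm1 ^ (ks ! j) dvd zm1 ^ m * p j" using z by (rule step)
    then show ?case using Suc.prems(2) by (rule Suc.IH)
  qed simp
  \<comment> \<open>The exponent \<open>sum_list ks\<close> bounds all chain lengths at
    once.\<close>
  have "\<forall>j<length vs. zm1 ^ (ks ! j) dvd zm1 ^ (sum_list ks) * p j"
    using len by (intro allI impI dvd_mult2 le_imp_power_dvd) (simp add: elem_le_sum_list)
  from descent[OF this c] j show ?thesis by simp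
qed

text \<open>The intersection of ker T with the range of T^i: the candidates for tops of chains of
  length i + 1.\<close>

definition level_socle :: "nat \<Rightarrow> 'a vec set" where
  "level_socle i = {act (zm1 ^ i) u | u. u \<in> V \<and> act (zm1 ^ Suc i) u = 0\<^sub>v n}"

text \<open>The span of the tops of the chains longer than \<open>i\<close>. Shorter chains stay in
  the combination with coefficient 0, which keeps the indexing by \<open>vs\<close>.\<close>

definition tops_span :: "'a vec list \<Rightarrow> nat list \<Rightarrow> nat \<Rightarrow> 'a vec set" where
  "tops_span vs ks i = range (\<lambda>c. cmb vs (\<lambda>j. if i < ks ! j then [:c j:] * zm1 ^ (ks ! j - 1) else 0))"

lemma tops_spanI:
  "cmb vs (\<lambda>j. if i < ks ! j then [:c j:] * zm1 ^ (ks ! j - 1) else 0) \<in> tops_span vs ks i"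
  unfolding tops_span_def by (rule rangeI)

lemma finite_level_socle: "finite (level_socle i)"
proof (rule finite_vec_subset)
  show "level_socle i \<subseteq> V" unfolding level_socle_def by auto
qed

text \<open>As all chains present are longer than \<open>i\<close>, \<open>tops_span vs ks i\<close>
  is the span of all their tops, and a new top outside it preserves independence.\<close>

lemma jordan_system_Cons:
  assumes J: "jordan_system vs ks" and ki: "\<forall>k\<in>set ks. i < k"
    and u: "u \<in> V" "act (zm1 ^ Suc i) u = 0\<^sub>v n"
    and new: "act (zm1 ^ i) u \<notin> tops_span vs ks i"
  shows "jordan_system (u # vs) (Suc i # ks)"
proof -
  have len: "length vs = length ks" and vs: "set vs \<subseteq> V" and k0: "0 \<notin> set ks"
    and ann: "\<And>j. j < length vs \<Longrightarrow> act (zm1 ^ (ks ! j)) (vs ! j) = 0\<^sub>v n"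
    and ind: "\<And>c. cmb vs (\<lambda>j. [:c j:] * zm1 ^ (ks ! j - 1)) = 0\<^sub>v n \<Longrightarrow> \<forall>j<length vs. c j = 0"
    using J unfolding jordan_system_def by blast+
  let ?w = "act (zm1 ^ i) u"
  have w: "?w \<in> V" using u(1) by simp
  have "\<forall>j<length (u # vs). c j = 0"
    if c: "cmb (u # vs) (\<lambda>j. [:c j:] * zm1 ^ ((Suc i # ks) ! j - 1)) = 0\<^sub>v n" for c
  proof -
    let ?S = "cmb vs (\<lambda>j. [:c (Suc j):] * zm1 ^ (ks ! j - 1))"
    have S: "?S \<in> V" using vs by simp
    have eq: "c 0 \<cdot>\<^sub>v ?w + ?S = 0\<^sub>v n"
      using c act_mult[OF u(1), of "[:c 0:]" "zm1 ^ i"] act_const[OF w, of "c 0"] by simp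
    have c0: "c 0 = 0"
    proof (rule ccontr)
      assume nz: "c 0 \<noteq> 0"
      have "?w = (- inverse (c 0)) \<cdot>\<^sub>v ?S"
      proof (rule eq_vecI)
        fix l assume "l < dim_vec ((- inverse (c 0)) \<cdot>\<^sub>v ?S)"
        then have l: "l < n" using S by simp
        have "c 0 * ?w $ l + ?S $ l = 0" using arg_cong[OF eq, of "\<lambda>x. x $ l"] l w S by simp
        then have "?S $ l = - (c 0 * ?w $ l)" by (simp add: eq_neg_iff_add_eq_0 add.commute)
        then show "?w $ l = ((- inverse (c 0)) \<cdot>\<^sub>v ?S) $ l" using nz l S by simp
      qed (use w S in simp)
      also have "\<dots> = cmb vs (\<lambda>j. [:- inverse (c 0):] * ([:c (Suc j):] * zm1 ^ (ks ! j - 1)))"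
        unfolding cmb_act[OF vs, symmetric] act_const[OF S] by (rule refl)
      also have "\<dots> = cmb vs (\<lambda>j. if i < ks ! j then [:- inverse (c 0) * c (Suc j):] * zm1 ^ (ks ! j - 1) else 0)"
        using ki len by (intro cmb_cong) (simp add: mult.commute[of "inverse (c 0)"])
      finally have "?w \<in> tops_span vs ks i" using tops_spanI[of vs i ks "\<lambda>j. - inverse (c 0) * c (Suc j)"] by (simp only:)
      then show False using new by simp
    qed
    have "0 \<cdot>\<^sub>v ?w = 0\<^sub>v n" using w by (intro eq_vecI) simp_all
    then have "?S = 0\<^sub>v n" using eq S c0 by simp
    then have "\<forall>j<length vs. c (Suc j) = 0" by (rule ind)
    then show ?thesis using c0 by (simp add: All_less_Suc2)
  qed
  moreover have "\<forall>j<length (u # vs). act (zm1 ^ ((Suc i # ks) ! j)) ((u # vs) ! j) = 0\<^sub>v n"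
    using ann u(2) by (simp add: All_less_Suc2)
  moreover have "length (u # vs) = length (Suc i # ks)" "set (u # vs) \<subseteq> V" "0 \<notin> set (Suc i # ks)"
    using len vs k0 u(1) by simp_all
  ultimately show ?thesis
    unfolding jordan_system_def by blast
qed

lemma tops_span_Cons:
  assumes u: "u \<in> V" and vs: "set vs \<subseteq> V"
  shows "tops_span vs ks i \<subseteq> tops_span (u # vs) (k # ks) i"
    and "i < k \<Longrightarrow> act (zm1 ^ (k - 1)) u \<in> tops_span (u # vs) (k # ks) i"
proof -
  show "tops_span vs ks i \<subseteq> tops_span (u # vs) (k # ks) i"
  proof
    fix x assume "x \<in> tops_span vs ks i"
    then obtain c where x: "x = cmb vs (\<lambda>j. if i < ks ! j then [:c j:] * zm1 ^ (ks ! j - 1) else 0)"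
      unfolding tops_span_def by blast
    let ?c = "\<lambda>j. case j of 0 \<Rightarrow> 0 | Suc j \<Rightarrow> c j"
    have "x \<in> V" unfolding x using vs by simp
    then have "x = cmb (u # vs) (\<lambda>j. if i < (k # ks) ! j then [:?c j:] * zm1 ^ ((k # ks) ! j - 1) else 0)"
      using x by (simp cong: if_cong)
    then show "x \<in> tops_span (u # vs) (k # ks) i"
      using tops_spanI[of "u # vs" i "k # ks" ?c] by (simp only:)
  qed
  show "act (zm1 ^ (k - 1)) u \<in> tops_span (u # vs) (k # ks) i" if k: "i < k"
  proof -
    let ?c = "\<lambda>j. case j of 0 \<Rightarrow> 1 | Suc j \<Rightarrow> (0 :: 'a)"
    have z: "cmb vs (\<lambda>j. if i < ks ! j then [:0:] * zm1 ^ (ks ! j - 1) else 0) = 0\<^sub>v n"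
      using cmb_zero[OF vs] by (simp cong: if_cong)
    have "act (zm1 ^ (k - 1)) u = cmb (u # vs) (\<lambda>j. if i < (k # ks) ! j then [:?c j:] * zm1 ^ ((k # ks) ! j - 1) else 0)"
      using z k act_carrier[OF u, of "zm1 ^ (k - 1)"] by (simp cong: if_cong)
    then show ?thesis using tops_spanI[of "u # vs" i "k # ks" ?c] by (simp only:)
  qed
qed

text \<open>Chains of length exactly i + 1 are added until the finite set of uncovered elements is
  exhausted. They are the shortest so far and go to the front, which keeps \<open>ks\<close>
  sorted.\<close>

lemma jordan_system_fill_level:
  assumes "jordan_system vs ks" "\<forall>k\<in>set ks. i < k" "sorted ks" "\<forall>i'>i. level_socle i' \<subseteq> tops_span vs ks i'"
  shows "\<exists>vs ks. jordan_system vs ks \<and> (\<forall>k\<in>set ks. i < k) \<and> sorted ks \<and> (\<forall>i'\<ge>i. level_socle i' \<subseteq> tops_span vs ks i')"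
  using assms
proof (induction "card (level_socle i - tops_span vs ks i)" arbitrary: vs ks rule: less_induct)
  case less
  show ?case
  proof (cases "level_socle i \<subseteq> tops_span vs ks i")
    case True
    then have "\<forall>i'\<ge>i. level_socle i' \<subseteq> tops_span vs ks i'" using less.prems(4) le_neq_implies_less by blast
    then show ?thesis using less.prems by blast
  next
    case False
    then obtain u where u: "u \<in> V" "act (zm1 ^ Suc i) u = 0\<^sub>v n"
      "act (zm1 ^ i) u \<notin> tops_span vs ks i"
      unfolding level_socle_def by auto
    have vs: "set vs \<subseteq> V" using less.prems(1) unfolding jordan_system_def by blast
    let ?vs = "u # vs" and ?ks = "Suc i # ks"
    have mem: "act (zm1 ^ i) u \<in> level_socle i" unfolding level_socle_def using u by blast
    have "act (zm1 ^ i) u \<in> tops_span ?vs ?ks i" using tops_span_Cons(2)[OF u(1) vs, of i "Suc i"] by simp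
    then have "level_socle i - tops_span ?vs ?ks i \<subset> level_socle i - tops_span vs ks i"
      using tops_span_Cons(1)[OF u(1) vs, of ks i "Suc i"] mem u(3) by blast
    then have "card (level_socle i - tops_span ?vs ?ks i) < card (level_socle i - tops_span vs ks i)"
      using finite_level_socle by (intro psubset_card_mono finite_Diff)
    moreover have "jordan_system ?vs ?ks" by (rule jordan_system_Cons[OF less.prems(1,2) u])
    moreover have "\<forall>k\<in>set ?ks. i < k" using less.prems(2) by simp
    moreover have "sorted ?ks" using less.prems(2,3) by (simp add: Suc_le_eq)
    moreover have "\<forall>i'>i. level_socle i' \<subseteq> tops_span ?vs ?ks i'"
      using less.prems(4) tops_span_Cons(1)[OF u(1) vs] by blast
    ultimately show ?thesis using less.hyps by blast
  qed
qed

definition primary :: "'a vec set" where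
  "primary = {v \<in> V. \<exists>k. act (zm1 ^ k) v = 0\<^sub>v n}"

lemma act_zm1_power_mono:
  assumes "v \<in> V" "act (zm1 ^ k) v = 0\<^sub>v n" "k \<le> l"
  shows "act (zm1 ^ l) v = 0\<^sub>v n"
proof -
  have "zm1 ^ l = zm1 ^ (l - k) * (zm1 ^ k :: 'a poly)" using assms(3) by (simp flip: power_add)
  then show ?thesis using act_mult[OF assms(1)] assms(2) act_zero_vec by simp
qed

text \<open>The primary component is a finite set, so the sum of the individual exponents kills all
  of it.\<close>

lemma nilpotency_bound: "\<exists>N. \<forall>v\<in>primary. act (zm1 ^ N) v = 0\<^sub>v n"
proof -
  have fin: "finite primary" by (rule finite_vec_subset[of _ n]) (auto simp: primary_def)
  define k where "k v = (SOME k. act (zm1 ^ k) v = 0\<^sub>v n)" for v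
  have k: "act (zm1 ^ k v) v = 0\<^sub>v n" if "v \<in> primary" for v
    using that unfolding k_def primary_def by (intro someI_ex[of "\<lambda>k. act (zm1 ^ k) v = 0\<^sub>v n"]) simp
  show ?thesis
  proof (intro exI ballI)
    fix v assume v: "v \<in> primary"
    show "act (zm1 ^ (\<Sum>v\<in>primary. k v)) v = 0\<^sub>v n"
    proof (rule act_zm1_power_mono[OF _ k[OF v]])
      show "v \<in> V" using v by (simp add: primary_def)
      show "k v \<le> (\<Sum>v\<in>primary. k v)" using fin v by (intro member_le_sum) simp_all
    qed
  qed
qed

text \<open>Long chains come first, because the top of a short chain has to be new modulo the tops
  of the longer ones. From level N on the socle is zero; \<open>d\<close> counts the levels treated
  below it.\<close>

lemma jordan_system_exists:
  "\<exists>vs ks. jordan_system vs ks \<and> sorted ks \<and> (\<forall>i. level_socle i \<subseteq> tops_span vs ks i)"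
proof -
  obtain N where N: "\<And>v. v \<in> primary \<Longrightarrow> act (zm1 ^ N) v = 0\<^sub>v n" using nilpotency_bound by blast
  have "\<exists>vs ks. jordan_system vs ks \<and> (\<forall>k\<in>set ks. N - d \<le> k) \<and> sorted ks \<and> (\<forall>i\<ge>N - d. level_socle i \<subseteq> tops_span vs ks i)" for d
  proof (induction d)
    case 0
    have "jordan_system [] []" by (simp add: jordan_system_def)
    moreover have "level_socle i \<subseteq> tops_span [] [] i" if "i \<ge> N" for i
    proof
      fix x assume "x \<in> level_socle i"
      then obtain u where u: "x = act (zm1 ^ i) u" "u \<in> V" "act (zm1 ^ Suc i) u = 0\<^sub>v n"
        unfolding level_socle_def by blast
      then have "u \<in> primary" unfolding primary_def by blast
      then have "x = 0\<^sub>v n" using act_zm1_power_mono[OF u(2) N that] u(1) by simp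
      then show "x \<in> tops_span [] [] i" by (simp add: tops_span_def)
    qed
    ultimately show ?case by (intro exI[of _ "[]"] conjI) simp_all
  next
    case (Suc d)
    from Suc.IH obtain vs ks where J: "jordan_system vs ks" "\<forall>k\<in>set ks. N - d \<le> k" "sorted ks"
      "\<forall>i\<ge>N - d. level_socle i \<subseteq> tops_span vs ks i" by (elim exE conjE)
    show ?case
    proof (cases "N - Suc d < N - d")
      case True
      have a: "\<forall>k\<in>set ks. N - Suc d < k"
      proof
        fix k assume "k \<in> set ks"
        then show "N - Suc d < k" using bspec[OF J(2)] less_le_trans[OF True] by simp
      qed
      have b: "\<forall>i'>N - Suc d. level_socle i' \<subseteq> tops_span vs ks i'" using J(4) True by simp
      from jordan_system_fill_level[OF J(1) a J(3) b] obtain ws ls where "jordan_system ws ls" and l: "\<forall>k\<in>set ls. N - Suc d < k" and "sorted ls"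
        "\<forall>i\<ge>N - Suc d. level_socle i \<subseteq> tops_span ws ls i"
        by (elim exE conjE)
      moreover have "\<forall>k\<in>set ls. N - Suc d \<le> k" using l by (simp add: less_imp_le)
      ultimately show ?thesis by (intro exI[of _ ws] exI[of _ ls] conjI)
    next
      \<comment> \<open>Truncated subtraction: N - d is already 0, and no level is left to
        fill.\<close>
      case False
      then have "N - d = N - Suc d" by simp
      from J show ?thesis unfolding \<open>N - d = N - Suc d\<close> by (intro exI[of _ vs] exI[of _ ks] conjI)
    qed
  qed
  from this[of N] obtain vs ks where "jordan_system vs ks" "sorted ks" and L: "\<forall>i\<ge>0. level_socle i \<subseteq> tops_span vs ks i"
    unfolding diff_self_eq_0 by (elim exE conjE)
  moreover have "\<forall>i. level_socle i \<subseteq> tops_span vs ks i" using L by simp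
  ultimately show ?thesis by (intro exI[of _ vs] exI[of _ ks] conjI)
qed

text \<open>The last nonzero image of u lies in a socle level, hence is a combination of tops.
  Subtracting a combination with the same image lowers the exponent that kills u.\<close>

lemma jordan_system_surj:
  assumes vs: "set vs \<subseteq> V" and len: "length vs = length ks"
    and L: "\<And>i. level_socle i \<subseteq> tops_span vs ks i"
    and u: "u \<in> V" "act (zm1 ^ m) u = 0\<^sub>v n"
  shows "\<exists>p. u = cmb vs p"
  using u
proof (induction m arbitrary: u)
  case 0
  then have "u = 0\<^sub>v n" using act_one by simp
  then show ?case by (intro exI[of _ "\<lambda>_. 0"]) (simp add: cmb_zero[OF vs])
next
  case (Suc m)
  have "act (zm1 ^ m) u \<in> level_socle m" unfolding level_socle_def using Suc.prems by blast
  then obtain c where c: "act (zm1 ^ m) u = cmb vs (\<lambda>j. if m < ks ! j then [:c j:] * zm1 ^ (ks ! j - 1) else 0)"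
    using L[of m] unfolding tops_span_def by blast
  \<comment> \<open>Every chain that occurs is longer than \<open>m\<close>, so its top can be
    divided by (z - 1)^m inside the chain.\<close>
  let ?q = "\<lambda>j. if m < ks ! j then [:c j:] * zm1 ^ (ks ! j - 1 - m) else 0"
  have "zm1 ^ m * ?q j = (if m < ks ! j then [:c j:] * zm1 ^ (ks ! j - 1) else 0)" for j
  proof (cases "m < ks ! j")
    case True
    then have "zm1 ^ (ks ! j - 1) = zm1 ^ m * (zm1 ^ (ks ! j - 1 - m) :: 'a poly)" by (simp flip: power_add)
    then show ?thesis using True by (simp only: if_True mult_ac)
  qed simp
  then have q: "act (zm1 ^ m) (cmb vs ?q) = act (zm1 ^ m) u"
    unfolding cmb_act[OF vs] c by (simp only:)
  define u' where "u' = u - cmb vs ?q"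
  have cq: "cmb vs ?q \<in> V" using vs by simp
  have u': "u' \<in> V" "u = u' + cmb vs ?q"
    unfolding u'_def using Suc.prems(1) cq by (simp, intro eq_vecI) simp_all
  have "act (zm1 ^ m) u = act (zm1 ^ m) u' + act (zm1 ^ m) u"
    by (subst (1) u'(2)) (simp only: act_add_vec[OF u'(1) cq] q)
  then have e: "(act (zm1 ^ m) u) $ l = (act (zm1 ^ m) u' + act (zm1 ^ m) u) $ l" for l
    by (rule arg_cong)
  have "act (zm1 ^ m) u' = 0\<^sub>v n"
  proof (rule eq_vecI)
    fix l assume l: "l < dim_vec (0\<^sub>v n :: 'a vec)"
    then show "act (zm1 ^ m) u' $ l = 0\<^sub>v n $ l"
      using e[of l] act_carrier[OF Suc.prems(1), of "zm1 ^ m"] act_carrier[OF u'(1), of "zm1 ^ m"] by simp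
  qed (use act_carrier[OF u'(1), of "zm1 ^ m"] in simp)
  then obtain p where "u' = cmb vs p" using Suc.IH[OF u'(1)] by blast
  then have "u = cmb vs (\<lambda>j. p j + ?q j)" using cmb_add[OF vs, of p ?q] u'(2) by simp
  then show ?case by blast
qed

end

section \<open>The partition of a matrix\<close>

context square_matrix
begin

abbreviation M where
  "M \<equiv> primary_component class_ring (mat_module g) zm1"

lemma M_simps:
  "carrier M = primary" "add M = (+)" "module.smult M = act" "\<zero>\<^bsub>M\<^esub> = 0\<^sub>v n"
  by (simp_all add: primary_component_def mat_module_def primary_def class_ring_simps)

lemma primary_carrier: "v \<in> primary \<Longrightarrow> v \<in> V"
  by (simp add: primary_def)

lemma primary_act:
  assumes "v \<in> primary"
  shows "act p v \<in> primary"
proof -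
  have v: "v \<in> V" by (rule primary_carrier[OF assms])
  obtain k where k: "act (zm1 ^ k) v = 0\<^sub>v n" using assms unfolding primary_def by blast
  have "act (zm1 ^ k) (act p v) = act p (act (zm1 ^ k) v)"
    unfolding act_mult[OF v, symmetric] by (simp only: mult.commute)
  then show ?thesis unfolding primary_def using k act_zero_vec v by auto
qed

lemma zero_in_primary: "0\<^sub>v n \<in> primary"
  unfolding primary_def using act_zero_vec by auto

text \<open>An isomorphism preserves the elements killed by (z - 1)^i. On the side of M they form
  the kernel of T^i, whose vectors lie in the primary component automatically.\<close>

lemma mat_type_of_isomorphic:
  assumes iso: "mod_isomorphic class_ring M (primary_type zm1 \<mu>)"
  shows "mat_type T \<mu>"
  unfolding mat_type_def
proof
  fix i
  let ?N = "primary_type zm1 \<mu> :: ('a poly, _) module"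
  obtain f where f: "f \<in> LinearCombinations.module_hom class_ring M ?N" and bij: "bij_betw f primary (carrier ?N)"
    using iso unfolding mod_isomorphic_def M_simps by blast
  have sm: "f (act r v) = r \<odot>\<^bsub>?N\<^esub> f v" if "v \<in> primary" for r v
    using LinearCombinations.module_hom_smult[OF f, of r v] that unfolding M_simps by simp
  have fN: "f v \<in> carrier ?N" if "v \<in> primary" for v using bij_betwE[OF bij] that by blast
  have "\<exists>p. j < size \<mu> \<longrightarrow> f (0\<^sub>v n) j = pcoset (sorted_list_of_multiset \<mu> ! j) p" for j
    using fN[OF zero_in_primary] unfolding primary_type_carrier by (auto simp: PiE_iff)
  then have "\<exists>p. \<forall>j. j < size \<mu> \<longrightarrow> f (0\<^sub>v n) j = pcoset (sorted_list_of_multiset \<mu> ! j) (p j)"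
    by (intro choice allI)
  then obtain p where p: "\<And>j. j < size \<mu> \<Longrightarrow> f (0\<^sub>v n) j = pcoset (sorted_list_of_multiset \<mu> ! j) (p j)" by blast
  \<comment> \<open>\<open>module_hom\<close> speaks of sums and scalar multiples; zero is reached
    as the multiple by the zero polynomial.\<close>
  have "f (0\<^sub>v n) = 0 \<odot>\<^bsub>?N\<^esub> f (0\<^sub>v n)" using sm[OF zero_in_primary, of 0] by simp
  also have "\<dots> = \<zero>\<^bsub>?N\<^esub>"
    using primary_type_smult[of \<mu> "f (0\<^sub>v n)" p 0] p unfolding primary_type_zero by simp
  finally have f0: "f (0\<^sub>v n) = \<zero>\<^bsub>?N\<^esub>" .
  have inj: "inj_on f primary" and surj: "f ` primary = carrier ?N"
    using bij unfolding bij_betw_def by blast+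
  have eq: "act (zm1 ^ i) v = 0\<^sub>v n \<longleftrightarrow> zm1 ^ i \<odot>\<^bsub>?N\<^esub> f v = \<zero>\<^bsub>?N\<^esub>" if v: "v \<in> primary" for v
    using inj_on_eq_iff[OF inj primary_act[OF v] zero_in_primary, of "zm1 ^ i"]
    unfolding f0 sm[OF v] by (rule sym)
  have ker: "mat_kernel (T ^\<^sub>m i) = {v \<in> primary. act (zm1 ^ i) v = 0\<^sub>v n}"
    unfolding mat_kernel_T_power primary_def by blast
  have "f ` mat_kernel (T ^\<^sub>m i) = {y \<in> carrier ?N. zm1 ^ i \<odot>\<^bsub>?N\<^esub> y = \<zero>\<^bsub>?N\<^esub>}"
    unfolding ker surj[symmetric] using eq by auto
  moreover have "card (f ` mat_kernel (T ^\<^sub>m i)) = card (mat_kernel (T ^\<^sub>m i))"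
    by (rule card_image[OF inj_on_subset[OF inj]]) (auto simp: ker)
  ultimately show "card (mat_kernel (T ^\<^sub>m i)) = CARD('a) ^ min_sum \<mu> i"
    using card_primary_type_torsion[of \<mu> i, where 'a='a] by simp
qed

text \<open>The isomorphism sends a combination of the generators of a spanning Jordan system to the
  cosets of its coefficients.\<close>

lemma isomorphic_primary_type_exists:
  "\<exists>\<mu>\<in>partitions. mod_isomorphic class_ring M (primary_type zm1 \<mu>)"
proof -
  obtain vs ks where J: "jordan_system vs ks" and sorted: "sorted ks"
    and L: "\<And>i. level_socle i \<subseteq> tops_span vs ks i" using jordan_system_exists by blast
  have len: "length vs = length ks" and vs: "set vs \<subseteq> V" and k0: "0 \<notin> set ks"
    and ann: "\<And>j. j < length vs \<Longrightarrow> act (zm1 ^ (ks ! j)) (vs ! j) = 0\<^sub>v n"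
    using J unfolding jordan_system_def by blast+
  define \<mu> where "\<mu> = mset ks"
  \<comment> \<open>Here the sortedness of the chain lengths is used: the summands of
    \<open>primary_type\<close> come in the order of \<open>vs\<close>.\<close>
  have xs: "sorted_list_of_multiset \<mu> = ks"
    unfolding \<mu>_def sorted_list_of_multiset_mset using sorted by (rule sorted_sort_id)
  have sz: "size \<mu> = length vs" unfolding \<mu>_def using len by simp
  have mu: "\<mu> \<in> partitions" unfolding \<mu>_def partitions_def using k0 by simp
  let ?N = "primary_type zm1 \<mu> :: ('a poly, _) module"
  let ?c = "\<lambda>p. \<lambda>j\<in>{..<size \<mu>}. pcoset (sorted_list_of_multiset \<mu> ! j) (p j :: 'a poly)"
  have vj: "vs ! j \<in> V" if "j < length vs" for j using vs nth_mem[OF that] by blast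
  \<comment> \<open>One direction is the directness of the sum, the other the annihilation of the
    generators. It makes \<open>h\<close> below independent of the chosen coefficients as well as
    injective.\<close>
  have key: "cmb vs p = cmb vs p' \<longleftrightarrow> ?c p = ?c p'" for p p'
  proof
    assume eq: "cmb vs p = cmb vs p'"
    have "cmb vs (\<lambda>j. p j - p' j) = 0\<^sub>v n"
      unfolding cmb_diff[OF vs] eq by (rule minus_cancel_vec[OF cmb_carrier[OF vs]])
    then have "pcoset (ks ! j) (p j) = pcoset (ks ! j) (p' j)" if "j < length vs" for j
      unfolding pcoset_eq_iff using jordan_system_inj[OF J _ that] by blast
    then show "?c p = ?c p'" unfolding xs sz by (intro restrict_ext) simp
  next
    assume eq: "?c p = ?c p'"
    have "zm1 ^ (ks ! j) dvd p j - p' j" if "j < length vs" for j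
      using fun_cong[OF eq, of j] that unfolding xs sz by (simp add: pcoset_eq_iff)
    then show "cmb vs p = cmb vs p'"
      by (intro cmb_cong act_eq_of_dvd[OF vj ann])
  qed
  have surj: "\<exists>p. u = cmb vs p" if "u \<in> primary" for u
    using that jordan_system_surj[OF vs len L] unfolding primary_def by blast
  have mem: "cmb vs p \<in> primary" for p
  proof -
    have "cmb vs (\<lambda>j. zm1 ^ (sum_list ks) * p j) = cmb vs (\<lambda>_. 0)"
    proof (rule cmb_cong)
      fix j assume j: "j < length vs"
      then have "zm1 ^ (ks ! j) dvd zm1 ^ (sum_list ks) * p j"
        using len by (intro dvd_mult2 le_imp_power_dvd) (simp add: elem_le_sum_list)
      then show "act (zm1 ^ (sum_list ks) * p j) (vs ! j) = act 0 (vs ! j)"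
        by (intro act_eq_of_dvd[OF vj[OF j] ann[OF j]]) simp
    qed
    then have "act (zm1 ^ (sum_list ks)) (cmb vs p) = 0\<^sub>v n"
      unfolding cmb_act[OF vs] cmb_zero[OF vs] .
    then show ?thesis unfolding primary_def using cmb_carrier[OF vs] by blast
  qed
  define h where "h u = ?c (SOME p. u = cmb vs p)" for u
  have h: "h (cmb vs p) = ?c p" for p
  proof -
    have "cmb vs p = cmb vs (SOME p'. cmb vs p = cmb vs p')" by (rule someI[of _ p]) (rule refl)
    then have "?c p = ?c (SOME p'. cmb vs p = cmb vs p')" by (rule key[THEN iffD1])
    then show ?thesis unfolding h_def by (rule sym)
  qed
  have hN: "?c p \<in> carrier ?N" for p unfolding primary_type_carrier by simp
  have "h \<in> LinearCombinations.module_hom class_ring M ?N"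
    unfolding LinearCombinations.module_hom_def mem_Collect_eq M_simps
  proof (intro conjI funcsetI allI impI)
    fix u assume "u \<in> primary"
    then obtain p where "u = cmb vs p" using surj by blast
    then show "h u \<in> carrier ?N" using h hN by simp
  next
    fix u w assume "u \<in> primary \<and> w \<in> primary"
    then obtain p p' where uw: "u = cmb vs p" "w = cmb vs p'" using surj by blast
    have "h (u + w) = ?c (\<lambda>j. p j + p' j)" unfolding uw cmb_add[OF vs, symmetric] h by (rule refl)
    also have "\<dots> = ?c p \<oplus>\<^bsub>?N\<^esub> ?c p'" by (rule primary_type_add[symmetric]) simp_all
    finally show "h (u + w) = h u \<oplus>\<^bsub>?N\<^esub> h w" unfolding uw h .
  next
    fix r :: "'a poly" and u assume "r \<in> carrier class_ring \<and> u \<in> primary"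
    then obtain p where u: "u = cmb vs p" using surj by blast
    have "h (act r u) = ?c (\<lambda>j. r * p j)" unfolding u cmb_act[OF vs] h by (rule refl)
    also have "\<dots> = r \<odot>\<^bsub>?N\<^esub> ?c p" by (rule primary_type_smult[symmetric]) simp
    finally show "h (act r u) = r \<odot>\<^bsub>?N\<^esub> h u" unfolding u h .
  qed
  moreover have "bij_betw h (carrier M) (carrier ?N)"
    unfolding bij_betw_def M_simps
  proof (intro conjI inj_onI subset_antisym subsetI)
    fix u w assume "u \<in> primary" "w \<in> primary" and eq: "h u = h w"
    then obtain p p' where uw: "u = cmb vs p" "w = cmb vs p'" using surj by blast
    from eq show "u = w" unfolding uw h by (rule key[THEN iffD2])
  next
    fix y assume "y \<in> h ` primary"
    then obtain u where u: "y = h u" "u \<in> primary" by (rule imageE)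
    then obtain p where "u = cmb vs p" using surj by blast
    then show "y \<in> carrier ?N" using u h hN by simp
  next
    fix y assume y: "y \<in> carrier ?N"
    have "\<exists>p. j < size \<mu> \<longrightarrow> y j = pcoset (sorted_list_of_multiset \<mu> ! j) p" for j
      using y unfolding primary_type_carrier by (auto simp: PiE_iff)
    then have "\<exists>p. \<forall>j. j < size \<mu> \<longrightarrow> y j = pcoset (sorted_list_of_multiset \<mu> ! j) (p j)"
      by (intro choice allI)
    then obtain p where p: "\<And>j. j < size \<mu> \<Longrightarrow> y j = pcoset (sorted_list_of_multiset \<mu> ! j) (p j)" by blast
    have "y = ?c p"
    proof
      fix j show "y j = ?c p j"
        using p[of j] y PiE_arb[of y "{..<size \<mu>}" _ j] unfolding primary_type_carrier by (cases "j < size \<mu>") simp_all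
    qed
    then have "y = h (cmb vs p)" unfolding h .
    then show "y \<in> h ` primary" using mem by (rule image_eqI)
  qed
  ultimately show ?thesis using mu unfolding mod_isomorphic_def by blast
qed

text \<open>Uniqueness in the description of \<open>lambda_z1\<close> comes from types: the module
  determines the torsion counts, and these determine the partition.\<close>

lemma lambda_z1_type: "lambda_z1 g \<in> partitions \<and> mat_type T (lambda_z1 g)"
proof -
  obtain \<mu> where mu: "\<mu> \<in> partitions" "mod_isomorphic class_ring M (primary_type zm1 \<mu>)"
    using isomorphic_primary_type_exists by blast
  have "lambda_z1 g = \<mu>"
    unfolding lambda_z1_def
  proof (rule the_equality)
    fix \<nu> assume "\<nu> \<in> partitions \<and> mod_isomorphic class_ring M (primary_type zm1 \<nu>)"
    then show "\<nu> = \<mu>"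
      using mat_type_unique[OF mat_type_of_isomorphic mat_type_of_isomorphic] mu by blast
  qed (use mu in blast)
  then show ?thesis using mu mat_type_of_isomorphic by simp
qed

end

section \<open>Types of T = g - 1 and the fibres of \<open>lambda_z1\<close>\<close>

lemma lambda_z1_eq_iff:
  fixes g :: "'a::{field,finite} mat"
  assumes g: "g \<in> carrier_mat n n" and mu: "\<mu> \<in> partitions"
  shows "lambda_z1 g = \<mu> \<longleftrightarrow> mat_type (g - 1\<^sub>m n) \<mu>"
proof -
  interpret square_matrix g n by unfold_locales (rule g)
  show ?thesis using lambda_z1_type mat_type_unique[OF _ _ _ mu] unfolding T_def by blast
qed

text \<open>The module decomposition is applied to g = T + 1, which may be singular:
  \<open>square_matrix\<close> asks for squareness only.\<close>

lemma mat_type_exists: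
  fixes T :: "'a::{field,finite} mat"
  assumes T: "T \<in> carrier_mat n n"
  shows "\<exists>\<mu>\<in>partitions. mat_type T \<mu>"
proof -
  have g: "T + 1\<^sub>m n \<in> carrier_mat n n" using T by simp
  interpret square_matrix "T + 1\<^sub>m n" n by unfold_locales (rule g)
  have "(T + 1\<^sub>m n) - 1\<^sub>m n = T" using T by (intro eq_matI) simp_all
  then show ?thesis using lambda_z1_type unfolding T_def by auto
qed

lemma without_eig_minus_one:
  fixes g :: "'a::{field,finite} mat"
  assumes g: "g \<in> carrier_mat n n"
  shows "without_eig True (g - 1\<^sub>m n) \<longleftrightarrow> g \<in> GL n"
proof -
  have d: "dim_row (g - 1\<^sub>m n) = n" using g by simp
  have "(g - 1\<^sub>m n) *\<^sub>v v = - v \<longleftrightarrow> g *\<^sub>v v = 0\<^sub>v n" if v: "v \<in> carrier_vec n" for v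
  proof -
    have gv: "g *\<^sub>v v \<in> carrier_vec n" using g v by (rule mult_mat_vec_carrier)
    have "(g - 1\<^sub>m n) *\<^sub>v v = g *\<^sub>v v - v"
      unfolding minus_mult_distrib_mat_vec[OF g one_carrier_mat v] using v by simp
    moreover have "w - v = - v \<longleftrightarrow> w = 0\<^sub>v n" if w: "w \<in> carrier_vec n" for w
    proof
      assume eq: "w - v = - v"
      have "w $ i = 0" if "i < n" for i
        using arg_cong[OF eq, of "\<lambda>x. x $ i"] that v w by simp
      then show "w = 0\<^sub>v n" using w by (intro eq_vecI) simp_all
    next
      assume "w = 0\<^sub>v n"
      then show "w - v = - v" using v by (intro eq_vecI) simp_all
    qed
    ultimately show ?thesis using gv by simp
  qed
  then have "without_eig True (g - 1\<^sub>m n) \<longleftrightarrow> (\<forall>v\<in>carrier_vec n. g *\<^sub>v v = 0\<^sub>v n \<longrightarrow> v = 0\<^sub>v n)"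
    unfolding without_eig_def d by simp
  also have "\<dots> \<longleftrightarrow> inj_mat g" using inj_matI[OF g] inj_matD[OF _ g] by blast
  finally show ?thesis unfolding GL_eq_inj_mats using g by simp
qed

lemma bij_betw_minus_one:
  "bij_betw (\<lambda>g. g - 1\<^sub>m n) {g \<in> carrier_mat n n. P (g - 1\<^sub>m n)} {T \<in> carrier_mat n n. P (T :: 'a::{field,finite} mat)}"
proof (rule bij_betw_byWitness[where f' = "\<lambda>T. T + 1\<^sub>m n"])
  have a: "(T + 1\<^sub>m n) - 1\<^sub>m n = T" if "T \<in> carrier_mat n n" for T :: "'a mat"
    using that by (intro eq_matI) simp_all
  have b: "(T - 1\<^sub>m n) + 1\<^sub>m n = T" if "T \<in> carrier_mat n n" for T :: "'a mat"
    using that by (intro eq_matI) simp_all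
  show "\<forall>g\<in>{g \<in> carrier_mat n n. P (g - 1\<^sub>m n)}. g - 1\<^sub>m n + 1\<^sub>m n = g" using b by blast
  show "\<forall>T\<in>{T \<in> carrier_mat n n. P T}. T + 1\<^sub>m n - 1\<^sub>m n = T" using a by blast
  show "(\<lambda>g. g - 1\<^sub>m n) ` {g \<in> carrier_mat n n. P (g - 1\<^sub>m n)} \<subseteq> {T \<in> carrier_mat n n. P T}"
    by (auto intro!: minus_carrier_mat)
  show "(\<lambda>T. T + 1\<^sub>m n) ` {T \<in> carrier_mat n n. P T} \<subseteq> {g \<in> carrier_mat n n. P (g - 1\<^sub>m n)}"
    using a by (intro image_subsetI) simp
qed

lemma card_lambda_z1_fibre:
  assumes mu: "\<mu> \<in> partitions"
  shows "card {g \<in> GL n. lambda_z1 (g :: 'a::{field,finite} mat) = \<mu>} = card (type_mats True n \<mu> :: 'a mat set)"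
proof -
  let ?P = "\<lambda>T :: 'a mat. mat_type T \<mu> \<and> without_eig True T"
  have "{g \<in> GL n. lambda_z1 g = \<mu>} = {g \<in> carrier_mat n n. ?P (g - 1\<^sub>m n)}"
    using lambda_z1_eq_iff[OF _ mu] without_eig_minus_one unfolding GL_def by blast
  then show ?thesis
    using bij_betw_same_card[OF bij_betw_minus_one[of n ?P]] unfolding type_mats_def by (simp only:)
qed

lemma card_without_eig: "card {T \<in> carrier_mat n n. without_eig True (T :: 'a::{field,finite} mat)} = card (GL n :: 'a mat set)"
proof -
  have "GL n = {g \<in> carrier_mat n n. without_eig True (g - 1\<^sub>m n :: 'a mat)}"
    using without_eig_minus_one unfolding GL_def by blast
  then show ?thesis
    using bij_betw_same_card[OF bij_betw_minus_one[of n "without_eig True :: 'a mat \<Rightarrow> bool"]] by (simp only:)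
qed

lemma card_carrier_mat: "card (carrier_mat n n :: 'a::finite mat set) = CARD('a) ^ (n * n)"
proof -
  have "(carrier_mat n n :: 'a mat set) = {A \<in> carrier_mat n n. \<forall>j<n. col A j \<in> carrier_vec n}"
    using col_dim by blast
  also have "card \<dots> = (\<Prod>j<n. card (carrier_vec n :: 'a vec set))" by (rule card_mats_with_cols) simp
  finally show ?thesis by (simp add: card_carrier_vec power_mult)
qed

lemma inj_mat_power:
  fixes T :: "'a::field mat"
  assumes "T \<in> carrier_mat n n" "inj_mat T"
  shows "inj_mat (T ^\<^sub>m i)"
proof (induction i)
  case 0
  show ?case using assms(1) by (simp add: inj_mat_def mat_kernel_one)
next
  case (Suc i)
  show ?case unfolding pow_mat.simps(2) by (rule inj_mat_mult[OF pow_carrier_mat[OF assms(1)] Suc assms])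
qed

lemma mat_type_empty_iff:
  fixes T :: "'a::{field,finite} mat"
  assumes T: "T \<in> carrier_mat n n"
  shows "mat_type T {#} \<longleftrightarrow> inj_mat T"
proof
  assume "mat_type T {#}"
  then have "card (mat_kernel T) = CARD('a) ^ size ({#} :: nat multiset)"
    using T by (intro mat_type_card_kernel) (simp_all add: partitions_def)
  then have "CARD('a) ^ n = card (mat_range T)" using card_range_kernel[OF T] by simp
  from inj_mat_of_card_range[OF T this[symmetric]] show "inj_mat T" .
next
  assume inj: "inj_mat T"
  show "mat_type T {#}"
    unfolding mat_type_def
  proof
    fix i
    have "mat_kernel (T ^\<^sub>m i) = {0\<^sub>v (dim_col (T ^\<^sub>m i))}" using inj_mat_power[OF T inj] unfolding inj_mat_def .
    then show "card (mat_kernel (T ^\<^sub>m i)) = CARD('a) ^ min_sum {#} i" by (simp add: min_sum_def)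
  qed
qed

text \<open>Gives the recursion the initial value 1 when the flag is off.\<close>

lemma card_type_mats_False_empty: "card (type_mats False n {#} :: 'a::{field,finite} mat set) = card (GL n :: 'a mat set)"
proof -
  have "type_mats False n {#} = (GL n :: 'a mat set)"
    unfolding type_mats_def GL_eq_inj_mats using mat_type_empty_iff by (auto simp: without_eig_def)
  then show ?thesis by simp
qed

definition partitions_le :: "nat \<Rightarrow> nat multiset set" where
  "partitions_le n = {\<mu> \<in> partitions. \<Sum>\<^sub># \<mu> \<le> n}"

lemma sum_shrink: "\<mu> \<in> partitions \<Longrightarrow> \<Sum>\<^sub># \<mu> = size \<mu> + \<Sum>\<^sub># (shrink \<mu>)"
  by (induction \<mu>) (auto simp: shrink_def add_mset_partitions_iff)

lemma finite_partitions_le: "finite (partitions_le n)"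
proof (rule finite_subset)
  show "partitions_le n \<subseteq> mset ` {xs. set xs \<subseteq> {..n} \<and> length xs \<le> n}"
  proof
    fix \<mu> assume mu: "\<mu> \<in> partitions_le n"
    obtain xs where xs: "mset xs = \<mu>" using ex_mset by blast
    have "length xs \<le> n" using mu sum_shrink[of \<mu>] xs unfolding partitions_le_def by auto
    moreover have "j \<le> n" if "j \<in># \<mu>" for j
      using part_le_sum_mset[OF that] mu unfolding partitions_le_def by simp
    ultimately have "xs \<in> {xs. set xs \<subseteq> {..n} \<and> length xs \<le> n}" using xs by auto
    then show "\<mu> \<in> mset ` {xs. set xs \<subseteq> {..n} \<and> length xs \<le> n}" using xs[symmetric] by (rule rev_image_eqI)
  qed
  show "finite (mset ` {xs. set xs \<subseteq> {..n} \<and> length xs \<le> n})"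
    by (intro finite_imageI finite_lists_length_le) simp
qed

lemma sum_card_type_mats:
  "(\<Sum>\<mu>\<in>partitions_le n. card (type_mats e n \<mu> :: 'a::{field,finite} mat set)) =
    card {T \<in> carrier_mat n n. without_eig e (T :: 'a mat)}"
proof -
  have "{T \<in> carrier_mat n n. without_eig e (T :: 'a mat)} = (\<Union>\<mu>\<in>partitions_le n. type_mats e n \<mu>)"
  proof (intro subset_antisym subsetI)
    fix T :: "'a mat" assume "T \<in> {T \<in> carrier_mat n n. without_eig e T}"
    then have T: "T \<in> carrier_mat n n" "without_eig e T" by simp_all
    obtain \<mu> where mu: "\<mu> \<in> partitions" "mat_type T \<mu>" using mat_type_exists[OF T(1)] by blast
    have "\<mu> \<in> partitions_le n" unfolding partitions_le_def using mu(1) mat_type_sum_le[OF T(1) mu(2)] by simp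
    moreover have "T \<in> type_mats e n \<mu>" unfolding type_mats_def using T mu(2) by simp
    ultimately show "T \<in> (\<Union>\<mu>\<in>partitions_le n. type_mats e n \<mu>)" by blast
  qed (auto simp: type_mats_def)
  moreover have "card (\<Union>\<mu>\<in>partitions_le n. type_mats e n \<mu> :: 'a mat set) = (\<Sum>\<mu>\<in>partitions_le n. card (type_mats e n \<mu> :: 'a mat set))"
  proof (rule card_UN_disjoint[OF finite_partitions_le])
    show "\<forall>\<mu>\<in>partitions_le n. finite (type_mats e n \<mu> :: 'a mat set)"
      using finite_mat_subset[of "type_mats e n _" n n] unfolding type_mats_def by blast
    show "\<forall>\<mu>\<in>partitions_le n. \<forall>\<nu>\<in>partitions_le n. \<mu> \<noteq> \<nu> \<longrightarrow> type_mats e n \<mu> \<inter> type_mats e n \<nu> = ({} :: 'a mat set)"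
      using mat_type_unique unfolding type_mats_def partitions_le_def by blast
  qed
  ultimately show ?thesis by simp
qed

section \<open>Total variation distance\<close>

text \<open>The number of injective n by k matrices as a polynomial in a real Q, free of truncated
  subtraction.\<close>

definition falling_powers :: "real \<Rightarrow> nat \<Rightarrow> nat \<Rightarrow> real" where
  "falling_powers Q n k = (\<Prod>i<k. Q ^ n - Q ^ i)"

text \<open>Each of the last k factors contains Q^m.\<close>

lemma falling_powers_add:
  "falling_powers Q (m + r) (m + k) = falling_powers Q (m + r) m * Q ^ (m * k) * falling_powers Q r k"
proof (induction k)
  case 0
  show ?case by (simp add: falling_powers_def)
next
  case (Suc k)
  have "falling_powers Q (m + r) (m + Suc k) = falling_powers Q (m + r) (m + k) * (Q ^ (m + r) - Q ^ (m + k))"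
    by (simp add: falling_powers_def)
  also have "Q ^ (m + r) - Q ^ (m + k) = Q ^ m * (Q ^ r - Q ^ k)" by (simp add: power_add algebra_simps)
  finally show ?case unfolding Suc by (simp add: falling_powers_def power_add)
qed

lemma falling_powers_full:
  assumes "Q > 0"
  shows "falling_powers Q n n = Q ^ (n * n) * qpoch (1 / Q) n"
proof (induction n)
  case 0
  show ?case by (simp add: falling_powers_def)
next
  case (Suc n)
  have "falling_powers Q (Suc n) (Suc n) = (Q ^ Suc n - 1) * Q ^ n * falling_powers Q n n"
    using falling_powers_add[of Q 1 n n] by (simp add: falling_powers_def)
  also have "Q ^ Suc n - 1 = Q ^ Suc n * (1 - (1 / Q) ^ Suc n)"
    using assms by (simp add: power_one_over field_simps)
  finally show ?case unfolding Suc qpoch_Suc by (simp add: power_add mult_ac)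
qed

text \<open>The bound k \<le> n + 1 keeps the subtraction of natural numbers exact.\<close>

lemma of_nat_falling_powers:
  assumes "k \<le> Suc n" "q > 0"
  shows "real (\<Prod>i<k. q ^ n - q ^ i) = falling_powers (real q) n k"
  unfolding falling_powers_def of_nat_prod
proof (intro prod.cong refl)
  fix i assume "i \<in> {..<k}"
  then have "q ^ i \<le> q ^ n" using assms by (intro power_increasing) auto
  then show "real (q ^ n - q ^ i) = real q ^ n - real q ^ i" by (simp add: of_nat_diff)
qed

lemma falling_powers_pos:
  assumes "Q > 1" "k \<le> n"
  shows "0 < falling_powers Q n k"
  unfolding falling_powers_def using assms by (intro prod_pos) (simp add: power_strict_increasing)

section \<open>Removing the first column in \<open>aut_card\<close>\<close>

lemma conj_part_eq_0: "\<Sum>\<^sub># \<mu> < i \<Longrightarrow> conj_part \<mu> i = 0"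
proof -
  assume i: "\<Sum>\<^sub># \<mu> < i"
  have "{#j \<in># \<mu>. i \<le> j#} = {#j \<in># \<mu>. False#}" using i part_le_sum_mset by (intro filter_mset_cong) fastforce+
  then show ?thesis by (simp add: conj_part_def)
qed

text \<open>Lets \<open>\<mu>\<close> and \<open>shrink \<mu>\<close> be compared over one common
  index range.\<close>

lemma aut_card_upto:
  assumes mu: "\<mu> \<in> partitions" and K: "\<Sum>\<^sub># \<mu> \<le> K"
  shows "aut_card q \<mu> = real q ^ (\<Sum>i = 1..K. (conj_part \<mu> i)\<^sup>2) *
    (\<Prod>i = 1..K. \<Prod>k = 1..count \<mu> i. 1 - 1 / real q ^ k)"
proof -
  have "(\<Sum>i = 1..\<Sum>\<^sub># \<mu>. (conj_part \<mu> i)\<^sup>2) = (\<Sum>i = 1..K. (conj_part \<mu> i)\<^sup>2)"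
    using K by (intro sum.mono_neutral_left) (auto simp: conj_part_eq_0)
  moreover have "(\<Prod>i\<in>set_mset \<mu>. \<Prod>k = 1..count \<mu> i. 1 - 1 / real q ^ k) =
      (\<Prod>i = 1..K. \<Prod>k = 1..count \<mu> i. 1 - 1 / real q ^ k)"
  proof (intro prod.mono_neutral_left)
    show "set_mset \<mu> \<subseteq> {1..K}"
    proof
      fix j assume j: "j \<in># \<mu>"
      then have "j \<le> \<Sum>\<^sub># \<mu>" by (rule part_le_sum_mset)
      moreover have "j \<noteq> 0" using j mu unfolding partitions_def by (cases j) simp_all
      ultimately show "j \<in> {1..K}" using K by simp
    qed
  qed (auto simp: not_in_iff)
  ultimately show ?thesis unfolding aut_card_def by simp
qed

lemma conj_part_shrink: "i > 0 \<Longrightarrow> conj_part (shrink \<mu>) i = conj_part \<mu> (Suc i)"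
  by (induction \<mu>) (auto simp: conj_part_def shrink_def)

lemma count_shrink: "i > 0 \<Longrightarrow> count (shrink \<mu>) i = count \<mu> (Suc i)"
  by (induction \<mu>) (auto simp: shrink_def)

lemma conj_part_1: "\<mu> \<in> partitions \<Longrightarrow> conj_part \<mu> 1 = size \<mu>"
  by (induction \<mu>) (auto simp: conj_part_def add_mset_partitions_iff)

lemma count_1: "\<mu> \<in> partitions \<Longrightarrow> count \<mu> 1 + size (shrink \<mu>) = size \<mu>"
  by (induction \<mu>) (auto simp: shrink_def add_mset_partitions_iff)

lemma shrink_partitions: "shrink \<mu> \<in> partitions"
  by (simp add: shrink_def partitions_def)

lemma qpoch_atLeastAtMost: "qpoch (1 / Q) n = (\<Prod>k = 1..n. 1 - 1 / Q ^ k)"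
  unfolding qpoch_def by (simp add: prod.atLeast1_atMost_eq power_one_over)

text \<open>The index 1 is split off: the first conjugate part is the number of parts, and the parts
  equal to 1 are those that disappear in \<open>shrink \<mu>\<close>. All other indices shift by
  one.\<close>

lemma aut_card_shrink:
  assumes mu: "\<mu> \<in> partitions"
  shows "aut_card q \<mu> = real q ^ (size \<mu>)\<^sup>2 * qpoch (1 / real q) (size \<mu> - size (shrink \<mu>)) * aut_card q (shrink \<mu>)"
proof -
  let ?K = "\<Sum>\<^sub># \<mu>"
  have K: "\<Sum>\<^sub># (shrink \<mu>) \<le> ?K" using sum_shrink[OF mu] by simp
  have "(\<Sum>i = 1..Suc ?K. (conj_part \<mu> i)\<^sup>2) = (conj_part \<mu> 1)\<^sup>2 + (\<Sum>i = 1..?K. (conj_part \<mu> (Suc i))\<^sup>2)"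
    by (subst sum.atLeast_Suc_atMost) (simp_all add: sum.shift_bounds_cl_Suc_ivl del: sum.cl_ivl_Suc)
  also have "(\<Sum>i = 1..?K. (conj_part \<mu> (Suc i))\<^sup>2) = (\<Sum>i = 1..?K. (conj_part (shrink \<mu>) i)\<^sup>2)"
    by (intro sum.cong refl) (simp add: conj_part_shrink)
  finally have s: "(\<Sum>i = 1..Suc ?K. (conj_part \<mu> i)\<^sup>2) = (size \<mu>)\<^sup>2 + (\<Sum>i = 1..?K. (conj_part (shrink \<mu>) i)\<^sup>2)"
    unfolding conj_part_1[OF mu] .
  let ?f = "\<lambda>m. \<Prod>k = 1..m. 1 - 1 / real q ^ k"
  have "(\<Prod>i = 1..Suc ?K. ?f (count \<mu> i)) = ?f (count \<mu> 1) * (\<Prod>i = 1..?K. ?f (count \<mu> (Suc i)))"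
    by (subst prod.atLeast_Suc_atMost) (simp_all add: prod.shift_bounds_cl_Suc_ivl del: prod.cl_ivl_Suc)
  also have "(\<Prod>i = 1..?K. ?f (count \<mu> (Suc i))) = (\<Prod>i = 1..?K. ?f (count (shrink \<mu>) i))"
    by (intro prod.cong refl) (simp add: count_shrink)
  also have "count \<mu> 1 = size \<mu> - size (shrink \<mu>)" using count_1[OF mu] by simp
  finally have p: "(\<Prod>i = 1..Suc ?K. ?f (count \<mu> i)) =
      qpoch (1 / real q) (size \<mu> - size (shrink \<mu>)) * (\<Prod>i = 1..?K. ?f (count (shrink \<mu>) i))"
    unfolding qpoch_atLeastAtMost .
  have "aut_card q \<mu> = real q ^ (\<Sum>i = 1..Suc ?K. (conj_part \<mu> i)\<^sup>2) * (\<Prod>i = 1..Suc ?K. ?f (count \<mu> i))"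
    by (rule aut_card_upto[OF mu]) simp
  moreover have "aut_card q (shrink \<mu>) = real q ^ (\<Sum>i = 1..?K. (conj_part (shrink \<mu>) i)\<^sup>2) * (\<Prod>i = 1..?K. ?f (count (shrink \<mu>) i))"
    by (rule aut_card_upto[OF shrink_partitions K])
  ultimately show ?thesis unfolding s p by (simp only: power_add mult_ac)
qed

lemma aut_card_empty [simp]: "aut_card q {#} = 1"
  by (simp add: aut_card_def)

section \<open>Solving the recursion and summing over all types\<close>

definition type_ratio :: "'a::{field,finite} itself \<Rightarrow> bool \<Rightarrow> nat \<Rightarrow> nat multiset \<Rightarrow> real" where
  "type_ratio _ e n \<mu> = real (card (type_mats e n \<mu> :: 'a mat set)) / real (card (GL n :: 'a mat set))"

lemma card_GL_real: "real (card (GL n :: 'a::{field,finite} mat set)) = falling_powers (real CARD('a)) n n"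
  unfolding card_GL by (rule of_nat_falling_powers) (use card_field_gt_1[where 'a='a] in simp_all)

lemma type_ratio_shrink:
  assumes mu: "\<mu> \<in> partitions" and n: "n = m + size \<mu>"
  shows "type_ratio TYPE('a::{field,finite}) e n \<mu> = type_ratio TYPE('a) e m (shrink \<mu>) /
    (real CARD('a) ^ (size \<mu>)\<^sup>2 * qpoch (1 / real CARD('a)) (size \<mu> - size (shrink \<mu>)))"
proof -
  let ?Q = "real CARD('a)" and ?r = "size \<mu>" and ?s = "size (shrink \<mu>)"
  let ?N = "real (card (type_mats e n \<mu> :: 'a mat set))" and ?N' = "real (card (type_mats e m (shrink \<mu>) :: 'a mat set))"
  let ?G = "falling_powers ?Q"
  have Q: "?Q > 1" "CARD('a) > 0" using card_field_gt_1[where 'a='a] by simp_all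
  have sr: "?s \<le> ?r" using count_1[OF mu] by simp
  have Qp: "?Q ^ i > 0" for i using Q by simp
  have gp: "?G n k > 0" if "k \<le> n" for n k using falling_powers_pos[OF Q(1) that] .
  interpret small_base "1 / ?Q"
    by unfold_locales (use Q card_field_gt_1[where 'a='a] in \<open>simp_all add: field_simps\<close>)
  show ?thesis
  proof (cases "?s \<le> m")
    \<comment> \<open>The truncated difference \<open>m - ?s\<close> would falsify the exponents
      here, but no matrix of size m has a kernel of larger dimension, so both sides are 0.\<close>
    case False
    then have "type_mats e m (shrink \<mu>) = ({} :: 'a mat set)"
      by (intro type_mats_empty shrink_partitions) simp
    moreover from this have "?N * ?G m m = 0"
      using arg_cong[OF card_type_mats_step[OF mu n refl, of e, where 'a='a], of real]
        of_nat_falling_powers[of m m "CARD('a)"] Q by (simp add: card_GL_real del: of_nat_prod)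
    ultimately show ?thesis using gp[of m m] by (simp add: type_ratio_def)
  next
    case True
    have "real (card (type_mats e n \<mu> :: 'a mat set) * (\<Prod>i<m. CARD('a) ^ m - CARD('a) ^ i)) =
      real ((\<Prod>i<m. CARD('a) ^ n - CARD('a) ^ i) * (card (type_mats e m (shrink \<mu>) :: 'a mat set) *
      (CARD('a) ^ (?r * (m - ?s)) * (\<Prod>i<?s. CARD('a) ^ ?r - CARD('a) ^ i))))"
      by (rule arg_cong[OF card_type_mats_step[OF mu n refl]])
    then have step: "?N * ?G m m = ?G n m * (?N' * (?Q ^ (?r * (m - ?s)) * ?G ?r ?s))"
      unfolding of_nat_mult of_nat_power
      using of_nat_falling_powers[of m m "CARD('a)"] of_nat_falling_powers[of m n "CARD('a)"]
        of_nat_falling_powers[of ?s ?r "CARD('a)"] Q sr n by (simp del: of_nat_prod)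
    have e1: "?G n n = ?G n m * ?Q ^ (m * ?r) * ?G ?r ?r"
      unfolding n by (rule falling_powers_add)
    have e2: "?G ?r ?r = ?G ?r ?s * ?Q ^ (?s * (?r - ?s)) * (?Q ^ ((?r - ?s) * (?r - ?s)) * qpoch (1 / ?Q) (?r - ?s))"
      using falling_powers_add[of ?Q ?s "?r - ?s" "?r - ?s"] sr falling_powers_full[of ?Q "?r - ?s"] Q by simp
    \<comment> \<open>With r and s the sizes of \<open>\<mu>\<close> and
      \<open>shrink \<mu>\<close>: m r + s (r - s) + (r - s)^2 = r (m - s) + r^2. The r^2 is the
      square of the first conjugate part in \<open>aut_card\<close>.\<close>
    have e3: "?Q ^ (m * ?r) * ?Q ^ (?s * (?r - ?s)) * ?Q ^ ((?r - ?s) * (?r - ?s)) = ?Q ^ (?r * (m - ?s)) * ?Q ^ (?r\<^sup>2)"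
    proof -
      obtain a where a: "m = ?s + a" using True le_Suc_ex by blast
      obtain b where b: "?r = ?s + b" using sr le_Suc_ex by blast
      show ?thesis unfolding power_add[symmetric] a b
        by (intro arg_cong[of _ _ "\<lambda>k. ?Q ^ k"]) (simp add: power2_eq_square algebra_simps)
    qed
    have nz: "?G n m \<noteq> 0" "?G m m \<noteq> 0" "?G ?r ?s \<noteq> 0" "qpoch (1 / ?Q) (?r - ?s) \<noteq> 0"
      using gp[of m n] gp[of m m] gp[of ?s ?r] sr n qpoch_pos[of "?r - ?s"] by simp_all
    have "?N * (?Q ^ (?r\<^sup>2) * qpoch (1 / ?Q) (?r - ?s)) * ?G m m * (?G n m * ?G ?r ?s * ?Q ^ (?r * (m - ?s))) =
        ?N' * ?G n n * (?G n m * ?G ?r ?s * ?Q ^ (?r * (m - ?s)))"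
    proof -
      have "?N * (?Q ^ (?r\<^sup>2) * qpoch (1 / ?Q) (?r - ?s)) * ?G m m * (?G n m * ?G ?r ?s * ?Q ^ (?r * (m - ?s))) =
          (?N * ?G m m) * (?Q ^ (?r * (m - ?s)) * ?Q ^ (?r\<^sup>2)) * (qpoch (1 / ?Q) (?r - ?s) * ?G n m * ?G ?r ?s)"
        by (simp only: mult_ac)
      also have "\<dots> = ?N' * ?G n n * (?G n m * ?G ?r ?s * ?Q ^ (?r * (m - ?s)))"
        unfolding step e3[symmetric] e1 e2 by (simp only: mult_ac)
      finally show ?thesis .
    qed
    then have "?N * (?Q ^ (?r\<^sup>2) * qpoch (1 / ?Q) (?r - ?s)) * ?G m m = ?N' * ?G n n"
      using nz Qp by (subst (asm) mult_cancel_right) simp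
    then show ?thesis
      unfolding type_ratio_def card_GL_real using gp[of n n] gp[of m m] Qp nz(4)
      by (simp add: field_simps)
  qed
qed

text \<open>Columns are removed until \<open>{#}\<close> is reached; by
  \<open>aut_card_shrink\<close> the accumulated denominators multiply to
  \<open>aut_card\<close>.\<close>

lemma type_ratio_eq:
  assumes mu: "\<mu> \<in> partitions"
  shows "type_ratio TYPE('a::{field,finite}) e n \<mu> =
    (if \<Sum>\<^sub># \<mu> \<le> n then type_ratio TYPE('a) e (n - \<Sum>\<^sub># \<mu>) {#} / aut_card CARD('a) \<mu> else 0)"
  using mu
proof (induction "\<Sum>\<^sub># \<mu>" arbitrary: \<mu> n rule: less_induct)
  case less
  show ?case
  proof (cases "\<mu> = {#}")
    case False
    have sum: "\<Sum>\<^sub># \<mu> = size \<mu> + \<Sum>\<^sub># (shrink \<mu>)" by (rule sum_shrink[OF less.prems])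
    have sz: "size \<mu> > 0" using False by (simp add: nonempty_has_size)
    show ?thesis
    proof (cases "size \<mu> \<le> n")
      case True
      then obtain m where n: "n = m + size \<mu>" using le_Suc_ex[OF True] by (auto simp: add.commute)
      have IH: "type_ratio TYPE('a) e m (shrink \<mu>) = (if \<Sum>\<^sub># (shrink \<mu>) \<le> m
          then type_ratio TYPE('a) e (m - \<Sum>\<^sub># (shrink \<mu>)) {#} / aut_card CARD('a) (shrink \<mu>) else 0)"
        using sum sz by (intro less.hyps shrink_partitions) simp
      have "n - \<Sum>\<^sub># \<mu> = m - \<Sum>\<^sub># (shrink \<mu>)" "\<Sum>\<^sub># \<mu> \<le> n \<longleftrightarrow> \<Sum>\<^sub># (shrink \<mu>) \<le> m"
        using n sum by simp_all
      then show ?thesis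
        unfolding type_ratio_shrink[OF less.prems n] IH aut_card_shrink[OF less.prems] by simp
    next
      case False
      then have "type_mats e n \<mu> = ({} :: 'a mat set)" by (intro type_mats_empty less.prems) simp
      then show ?thesis using False sum by (simp add: type_ratio_def)
    qed
  qed simp
qed

lemma aut_card_pos:
  assumes "q \<ge> 2"
  shows "aut_card q \<mu> > 0"
proof -
  have "(\<Prod>k = 1..c. 1 - 1 / real q ^ k) > 0" for c
  proof (intro prod_pos)
    fix k assume "k \<in> {1..c}"
    then have "real q ^ k > 1" using assms by (intro one_less_power) simp_all
    then have "1 / real q ^ k < 1" by (subst divide_less_eq_1_pos) linarith+
    then show "1 - 1 / real q ^ k > 0" by simp
  qed
  then show ?thesis unfolding aut_card_def using assms by (intro mult_pos_pos prod_pos zero_less_power) simp_all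
qed

lemma sum_type_ratio:
  "(\<Sum>\<mu>\<in>partitions_le n. type_ratio TYPE('a::{field,finite}) e n \<mu>) =
    real (card {T \<in> carrier_mat n n. without_eig e (T :: 'a mat)}) / real (card (GL n :: 'a mat set))"
  unfolding type_ratio_def sum_divide_distrib[symmetric] sum_card_type_mats[symmetric] by simp

lemma sum_type_ratio_eq:
  "(\<Sum>\<mu>\<in>partitions_le n. type_ratio TYPE('a::{field,finite}) e (n - \<Sum>\<^sub># \<mu>) {#} / aut_card CARD('a) \<mu>) =
    real (card {T \<in> carrier_mat n n. without_eig e (T :: 'a mat)}) / real (card (GL n :: 'a mat set))"
  unfolding sum_type_ratio[symmetric]
  by (intro sum.cong refl) (simp add: type_ratio_eq partitions_le_def)

definition eig_free_prob :: "'a::{field,finite} itself \<Rightarrow> nat \<Rightarrow> real" where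
  "eig_free_prob t k = type_ratio t True k {#}"

lemma card_GL_pos: "card (GL n :: 'a::{field,finite} mat set) > 0"
proof -
  have "real (card (GL n :: 'a mat set)) > 0"
    unfolding card_GL_real using card_field_gt_1[where 'a='a] by (intro falling_powers_pos) simp_all
  then show ?thesis by simp
qed

text \<open>With the flag off, the sum is the number q^(n^2) of all matrices divided by the order
  q^(n^2) (x;x)_n of GL(n,q), where x = 1/q.\<close>

lemma sum_inverse_aut_card:
  "(\<Sum>\<mu>\<in>partitions_le n. 1 / aut_card CARD('a::{field,finite}) \<mu>) = 1 / qpoch (1 / real CARD('a)) n"
proof -
  have r: "type_ratio TYPE('a) False k {#} = 1" for k
    unfolding type_ratio_def card_type_mats_False_empty using card_GL_pos[of k, where 'a='a] by simp
  have "{T \<in> carrier_mat n n. without_eig False (T :: 'a mat)} = carrier_mat n n" by (simp add: without_eig_def)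
  then have "(\<Sum>\<mu>\<in>partitions_le n. 1 / aut_card CARD('a) \<mu>) =
      real (card (carrier_mat n n :: 'a mat set)) / real (card (GL n :: 'a mat set))"
    using sum_type_ratio_eq[of False n, where 'a='a] unfolding r by simp
  also have "\<dots> = 1 / qpoch (1 / real CARD('a)) n"
    unfolding card_GL_real card_carrier_mat using card_field_gt_1[where 'a='a]
    by (subst falling_powers_full) simp_all
  finally show ?thesis .
qed

text \<open>With the flag on, T \<mapsto> T + 1 maps the counted matrices onto GL(n,q), hence the
  total 1.\<close>

lemma sum_eig_free_prob:
  "(\<Sum>\<mu>\<in>partitions_le n. eig_free_prob TYPE('a::{field,finite}) (n - \<Sum>\<^sub># \<mu>) / aut_card CARD('a) \<mu>) = 1"
  using sum_type_ratio_eq[of True n, where 'a='a] card_GL_pos[of n, where 'a='a]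
  unfolding eig_free_prob_def card_without_eig by simp

lemma sum_partitions_le_group:
  fixes F :: "nat \<Rightarrow> real"
  shows "(\<Sum>\<mu>\<in>partitions_le n. F (\<Sum>\<^sub># \<mu>) * h \<mu>) = (\<Sum>k\<le>n. F k * (\<Sum>\<mu> | \<mu> \<in> partitions \<and> \<Sum>\<^sub># \<mu> = k. h \<mu>))"
proof -
  have "(\<Sum>\<mu>\<in>partitions_le n. F (\<Sum>\<^sub># \<mu>) * h \<mu>) =
      (\<Sum>k\<le>n. \<Sum>\<mu> | \<mu> \<in> partitions_le n \<and> \<Sum>\<^sub># \<mu> = k. F (\<Sum>\<^sub># \<mu>) * h \<mu>)"
    by (rule sum.group[symmetric]) (auto simp: finite_partitions_le, auto simp: partitions_le_def)
  also have "\<dots> = (\<Sum>k\<le>n. F k * (\<Sum>\<mu> | \<mu> \<in> partitions \<and> \<Sum>\<^sub># \<mu> = k. h \<mu>))"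
  proof (intro sum.cong refl)
    fix k assume "k \<in> {..n}"
    then have "{\<mu>. \<mu> \<in> partitions_le n \<and> \<Sum>\<^sub># \<mu> = k} = {\<mu>. \<mu> \<in> partitions \<and> \<Sum>\<^sub># \<mu> = k}"
      by (auto simp: partitions_le_def)
    then show "(\<Sum>\<mu> | \<mu> \<in> partitions_le n \<and> \<Sum>\<^sub># \<mu> = k. F (\<Sum>\<^sub># \<mu>) * h \<mu>) =
        F k * (\<Sum>\<mu> | \<mu> \<in> partitions \<and> \<Sum>\<^sub># \<mu> = k. h \<mu>)"
      unfolding sum_distrib_left by (intro sum.cong) simp_all
  qed
  finally show ?thesis .
qed

lemma small_base_card: "small_base (1 / real CARD('a::{field,finite}))"
  by unfold_locales (use card_field_gt_1[where 'a='a] in \<open>simp_all add: field_simps\<close>)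

text \<open>Both sides have the same partial sums, by \<open>sum_size_mass\<close>.\<close>

lemma sum_inverse_aut_card_size:
  "(\<Sum>\<mu> | \<mu> \<in> partitions \<and> \<Sum>\<^sub># \<mu> = k. 1 / aut_card CARD('a::{field,finite}) \<mu>) = size_mass (1 / real CARD('a)) k"
proof -
  interpret small_base "1 / real CARD('a)" by (rule small_base_card)
  let ?S = "\<lambda>k. \<Sum>\<mu> | \<mu> \<in> partitions \<and> \<Sum>\<^sub># \<mu> = k. 1 / aut_card CARD('a) \<mu>"
  have S: "(\<Sum>k\<le>n. ?S k) = (\<Sum>k\<le>n. size_mass (1 / real CARD('a)) k)" for n
    using sum_partitions_le_group[where F = "\<lambda>_. 1" and h = "\<lambda>\<mu>. 1 / aut_card CARD('a) \<mu>" and n = n]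
      sum_inverse_aut_card[of n, where 'a='a] by (simp add: sum_size_mass)
  show ?thesis
  proof (cases k)
    case 0
    then show ?thesis using S[of 0] by simp
  next
    case (Suc j)
    then show ?thesis using S[of j] S[of k] by simp
  qed
qed

lemma sum_partitions_le_aut:
  "(\<Sum>\<mu>\<in>partitions_le n. F (\<Sum>\<^sub># \<mu>) / aut_card CARD('a::{field,finite}) \<mu>) = (\<Sum>k\<le>n. size_mass (1 / real CARD('a)) k * F k)"
  using sum_partitions_le_group[where F = F and h = "\<lambda>\<mu>. 1 / aut_card CARD('a) \<mu>" and n = n]
  unfolding sum_inverse_aut_card_size by (simp add: mult.commute)

section \<open>The random partition and infinite sums over partitions\<close>

lemma pmf_Lambda_GL:
  assumes mu: "\<mu> \<in> partitions"
  shows "pmf (Lambda_GL TYPE('a::{field,finite}) n) \<mu> =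
    (if \<Sum>\<^sub># \<mu> \<le> n then eig_free_prob TYPE('a) (n - \<Sum>\<^sub># \<mu>) / aut_card CARD('a) \<mu> else 0)"
proof -
  have fin: "finite (GL n :: 'a mat set)" by (rule finite_mat_subset[of _ n n]) (auto simp: GL_def)
  have ne: "(GL n :: 'a mat set) \<noteq> {}" using card_GL_pos[of n, where 'a='a] by auto
  have "pmf (Lambda_GL TYPE('a) n) \<mu> = real (card (GL n \<inter> lambda_z1 -` {\<mu>} :: 'a mat set)) / real (card (GL n :: 'a mat set))"
    unfolding Lambda_GL_def pmf_map measure_pmf_of_set[OF ne fin] by (rule refl)
  also have "GL n \<inter> lambda_z1 -` {\<mu>} = {g \<in> (GL n :: 'a mat set). lambda_z1 g = \<mu>}" by auto
  also have "real (card \<dots>) / real (card (GL n :: 'a mat set)) = type_ratio TYPE('a) True n \<mu>"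
    unfolding card_lambda_z1_fibre[OF mu] type_ratio_def by (rule refl)
  finally show ?thesis unfolding type_ratio_eq[OF mu] eig_free_prob_def .
qed

text \<open>As the terms are nonnegative, the sum over a large finite set is squeezed between the
  sums over two members of the exhausting sequence.\<close>

lemma has_sum_exhaustion:
  fixes f :: "'b \<Rightarrow> real"
  assumes nonneg: "\<And>x. x \<in> A \<Longrightarrow> 0 \<le> f x"
    and fin: "\<And>n. finite (F n)" and sub: "\<And>n. F n \<subseteq> A"
    and ex: "\<And>Y. finite Y \<Longrightarrow> Y \<subseteq> A \<Longrightarrow> \<exists>n. Y \<subseteq> F n"
    and le: "\<And>n. sum f (F n) \<le> L" and lim: "(\<lambda>n. sum f (F n)) \<longlonglongrightarrow> L"
  shows "(f has_sum L) A"
  unfolding has_sum_def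
proof (rule tendstoI)
  fix e :: real assume "e > 0"
  then obtain n where n: "dist (sum f (F n)) L < e"
    using tendstoD[OF lim] eventually_happens'[OF sequentially_bot] by blast
  show "\<forall>\<^sub>F Y in finite_subsets_at_top A. dist (sum f Y) L < e"
    unfolding eventually_finite_subsets_at_top
  proof (intro exI conjI allI impI)
    show "finite (F n)" "F n \<subseteq> A" by (rule fin, rule sub)
    fix Y assume Y: "finite Y \<and> F n \<subseteq> Y \<and> Y \<subseteq> A"
    then obtain m where m: "Y \<subseteq> F m" using ex by blast
    have "sum f (F n) \<le> sum f Y" using Y nonneg by (intro sum_mono2) auto
    moreover have "sum f Y \<le> sum f (F m)" using m fin sub nonneg by (intro sum_mono2) blast+
    ultimately show "dist (sum f Y) L < e" using n le[of m] le[of n] by (simp add: dist_real_def)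
  qed
qed

lemma has_sum_inverse_aut_card:
  "((\<lambda>\<mu>. 1 / aut_card CARD('a::{field,finite}) \<mu>) has_sum (1 / small_base.qpoch_inf (1 / real CARD('a)))) partitions"
proof -
  interpret small_base "1 / real CARD('a)" by (rule small_base_card)
  have q2: "CARD('a) \<ge> 2" using card_field_gt_1[where 'a='a] by simp
  show ?thesis
  proof (rule has_sum_exhaustion[where F = partitions_le])
    show "0 \<le> 1 / aut_card CARD('a) \<mu>" for \<mu> using aut_card_pos[OF q2, of \<mu>] by simp
    show "partitions_le n \<subseteq> partitions" for n by (auto simp: partitions_le_def)
    \<comment> \<open>The sum of the sizes of all members of Y bounds each of them.\<close>
    show "\<exists>n. Y \<subseteq> partitions_le n" if "finite Y" "Y \<subseteq> partitions" for Y
      using that by (intro exI[of _ "\<Sum>\<mu>\<in>Y. \<Sum>\<^sub># \<mu>"]) (auto simp: partitions_le_def intro: member_le_sum)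
    show "(\<Sum>\<mu>\<in>partitions_le n. 1 / aut_card CARD('a) \<mu>) \<le> 1 / qpoch_inf" for n
      unfolding sum_inverse_aut_card using qpoch_inf_le[of n] qpoch_inf_pos by (intro divide_left_mono) simp_all
    show "(\<lambda>n. \<Sum>\<mu>\<in>partitions_le n. 1 / aut_card CARD('a) \<mu>) \<longlonglongrightarrow> 1 / qpoch_inf"
      unfolding sum_inverse_aut_card using qpoch_tendsto qpoch_inf_pos by (intro tendsto_divide tendsto_const) auto
  qed (rule finite_partitions_le)
qed

lemma tv_dist_P_GL_Lambda_GL:
  fixes q n :: nat
  assumes q: "q = CARD('a::{field,finite})"
  defines "Pinf \<equiv> small_base.qpoch_inf (1 / real q)"
  shows "tv_dist partitions (P_GL q) (pmf (Lambda_GL TYPE('a) n)) =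
    1 / 2 * ((\<Sum>k\<le>n. size_mass (1 / real q) k * \<bar>Pinf - eig_free_prob TYPE('a) (n - k)\<bar>) +
      (1 - Pinf / qpoch (1 / real q) n))"
proof -
  interpret small_base "1 / real q" unfolding q by (rule small_base_card)
  have q2: "q \<ge> 2" using card_field_gt_1[where 'a='a] q by simp
  note ap = aut_card_pos[OF q2]
  let ?f = "\<lambda>\<mu>. \<bar>P_GL q \<mu> - pmf (Lambda_GL TYPE('a) n) \<mu>\<bar>"
  let ?A = "partitions_le n" and ?B = "partitions - partitions_le n"
  have Pinf: "Pinf = qpoch_inf" unfolding Pinf_def ..
  have P: "P_GL q \<mu> = qpoch_inf * (1 / aut_card q \<mu>)" for \<mu>
    unfolding P_GL_def qpoch_inf_def by (simp add: power_one_over)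
  have subA: "?A \<subseteq> partitions" by (auto simp: partitions_le_def)
  have "(?f has_sum (\<Sum>\<mu>\<in>?A. ?f \<mu>)) ?A" by (rule has_sum_finite[OF finite_partitions_le])
  also have "(\<Sum>\<mu>\<in>?A. ?f \<mu>) = (\<Sum>\<mu>\<in>?A. \<bar>qpoch_inf - eig_free_prob TYPE('a) (n - \<Sum>\<^sub># \<mu>)\<bar> / aut_card q \<mu>)"
  proof (intro sum.cong refl)
    fix \<mu> assume "\<mu> \<in> ?A"
    then have mu: "\<mu> \<in> partitions" "\<Sum>\<^sub># \<mu> \<le> n" by (simp_all add: partitions_le_def)
    have "P_GL q \<mu> - pmf (Lambda_GL TYPE('a) n) \<mu> = (qpoch_inf - eig_free_prob TYPE('a) (n - \<Sum>\<^sub># \<mu>)) / aut_card q \<mu>"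
      unfolding P pmf_Lambda_GL[OF mu(1)] using mu(2) q by (simp add: diff_divide_distrib)
    then show "?f \<mu> = \<bar>qpoch_inf - eig_free_prob TYPE('a) (n - \<Sum>\<^sub># \<mu>)\<bar> / aut_card q \<mu>"
      using ap[of \<mu>] by (simp add: abs_divide)
  qed
  also have "\<dots> = (\<Sum>k\<le>n. size_mass (1 / real q) k * \<bar>qpoch_inf - eig_free_prob TYPE('a) (n - k)\<bar>)"
    unfolding q by (rule sum_partitions_le_aut)
  finally have A: "(?f has_sum (\<Sum>k\<le>n. size_mass (1 / real q) k * \<bar>qpoch_inf - eig_free_prob TYPE('a) (n - k)\<bar>)) ?A" .
  \<comment> \<open>Beyond size n the distribution \<open>Lambda_GL\<close> vanishes, so only the
    tail of \<open>P_GL\<close> remains: the full sum minus its part up to n.\<close>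
  have "((\<lambda>\<mu>. 1 / aut_card q \<mu>) has_sum (1 / qpoch_inf - 1 / qpoch (1 / real q) n)) ?B"
    using has_sum_Diff[OF has_sum_inverse_aut_card[where 'a='a] has_sum_finite[OF finite_partitions_le] subA]
    unfolding sum_inverse_aut_card q .
  from has_sum_cmult_right[OF this, of qpoch_inf]
  have "((\<lambda>\<mu>. qpoch_inf * (1 / aut_card q \<mu>)) has_sum (1 - qpoch_inf / qpoch (1 / real q) n)) ?B"
    using qpoch_inf_pos by (simp add: right_diff_distrib)
  moreover have "?f \<mu> = qpoch_inf * (1 / aut_card q \<mu>)" if "\<mu> \<in> ?B" for \<mu>
    using that ap[of \<mu>] qpoch_inf_pos pmf_Lambda_GL[of \<mu> n, where 'a='a] unfolding P by (simp add: partitions_le_def)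
  ultimately have B: "(?f has_sum (1 - qpoch_inf / qpoch (1 / real q) n)) ?B"
    by (subst has_sum_cong) auto
  have "partitions = ?A \<union> ?B" using subA by auto
  then have "(?f has_sum ((\<Sum>k\<le>n. size_mass (1 / real q) k * \<bar>qpoch_inf - eig_free_prob TYPE('a) (n - k)\<bar>) +
      (1 - qpoch_inf / qpoch (1 / real q) n))) partitions"
    using has_sum_Un_disjoint[OF A B] by (metis Diff_disjoint)
  from infsumI[OF this] show ?thesis unfolding tv_dist_def Pinf by simp
qed

theorem theorem2p4:
  fixes n q :: nat
  assumes "q = CARD('a::{field,finite})" and "n \<ge> 1"
  shows "0.38 / real q ^ (n + 1) \<le> tv_dist partitions (P_GL q) (pmf (Lambda_GL TYPE('a) n)) \<and>
         tv_dist partitions (P_GL q) (pmf (Lambda_GL TYPE('a) n)) \<le> 14 / real q ^ (n + 1)"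
proof -
  let ?x = "1 / real q"
  interpret small_base ?x unfolding assms(1) by (rule small_base_card)
  let ?d = "eig_free_prob TYPE('a)"
  let ?S = "\<Sum>k\<le>n. size_mass ?x k * \<bar>qpoch_inf - ?d (n - k)\<bar>"
  let ?R = "1 - qpoch_inf / qpoch ?x n"
  have tv: "tv_dist partitions (P_GL q) (pmf (Lambda_GL TYPE('a) n)) = 1 / 2 * (?S + ?R)"
    by (rule tv_dist_P_GL_Lambda_GL[OF assms(1)])
  have sd: "(\<Sum>k\<le>m. size_mass ?x k * ?d (m - k)) = 1" for m
    using sum_eig_free_prob[of m, where 'a='a] unfolding assms(1)
    by (subst (asm) sum_partitions_le_aut[where F = "\<lambda>k. eig_free_prob TYPE('a) (m - k)"]) simp
  have err: "\<bar>qpoch_inf - ?d m\<bar> \<le> euler_abs ?x (Suc m)" for m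
    using euler_partial_sum_error[of m] convolution_solution_eq_euler_sum[OF sd, of m] by simp
  have x: "?x ^ Suc n = 1 / real q ^ (n + 1)" by (simp add: power_one_over)
  have "?S \<le> (\<Sum>k\<le>n. size_mass ?x k * euler_abs ?x (Suc (n - k)))"
    using err size_mass_pos by (intro sum_mono mult_left_mono) (simp_all add: less_imp_le)
  then have Su: "?S \<le> 24 * ?x ^ Suc n" using sum_mass_euler_le[of n] by simp
  have Ru: "?R \<le> 2 * ?x ^ Suc n" and Rl: "?x ^ Suc n \<le> ?R" by (rule tail_ratio_upper, rule tail_ratio_lower)
  \<comment> \<open>Both measures have total mass 1, so the signed excess on the sizes up to n
    equals the mass of \<open>P_GL\<close> beyond n. Taking absolute values gives R \<le> S.\<close>
  have "(\<Sum>k\<le>n. size_mass ?x k * (?d (n - k) - qpoch_inf)) = ?R"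
    unfolding right_diff_distrib sum_subtractf sd sum_distrib_right[symmetric] sum_size_mass by simp
  moreover have "(\<Sum>k\<le>n. size_mass ?x k * (?d (n - k) - qpoch_inf)) \<le> ?S"
    using size_mass_pos by (intro sum_mono mult_left_mono) (simp_all add: less_imp_le)
  ultimately have Sl: "?R \<le> ?S" by simp
  have pos: "0 \<le> ?x ^ Suc n" using pow_pos[of "Suc n"] by simp
  have "0.38 * y \<le> 1 / 2 * (S + R) \<and> 1 / 2 * (S + R) \<le> 14 * y"
    if "S \<le> 24 * y" "R \<le> 2 * y" "y \<le> R" "R \<le> S" "0 \<le> y" for S R y :: real
    using that by simp
  from this[OF Su Ru Rl Sl pos] show ?thesis unfolding tv x by simp
qed


end
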